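(* Let $m,n$ be relatively prime positive integers and let $1<p<\infty$. Let $$\mathcal B_{m/n}f(z)=\int_{H_{m/n}}\frac{|B_{m/n}(z,w)|^2}{B_{m/n}(z,z)}\,f(w)\,dV(w).$$ Then $\mathcal B_{m/n}$ is bounded on $L^p(H_{m/n})$ if and only if $p>m+n$.
   Context: For relatively prime positive integers $m,n$, the rational Hartogs triangle is $H_{m/n}=\{(z_1,z_2)\in\mathbb C^2:|z_1|^m<|z_2|^n<1\}$. $dV$ denotes Lebesgue measure on $\mathbb C^2$, and $L^p(H_{m/n})$ is taken with respect to $dV$. $B_{m/n}(z,w)$ denotes the Bergman kernel of $H_{m/n}$, i.e. the reproducing kernel of the Hilbert space of holomorphic functions on $H_{m/n}$ that are square integrable with respect to $dV$; it satisfies $B_{m/n}(z,z)>0$. An integral operator is bounded on $L^p$ if for every $f\in L^p$ the defining integral converges absolutely for almost every $z$ and the operator satisfies $\|Sf\|_{L^p}\le C\|f\|_{L^p}$ with $C$ independent of $f$. *)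

theory Defs
  imports "HOL-Analysis.Analysis"
begin

definition hartogs_triangle :: "nat \<Rightarrow> nat \<Rightarrow> (complex \<times> complex) set" where
  "hartogs_triangle m n = {(z1, z2). cmod z1 ^ m < cmod z2 ^ n \<and> cmod z2 ^ n < 1}"

text \<open>The library predicate \<^const>\<open>field_differentiable\<close> covers one variable only. On
  \<open>\<complex>\<^sup>2\<close> we ask for a total derivative that is complex-linear. The notion is meant for open sets.\<close>

definition holomorphic2_on :: "(complex \<times> complex \<Rightarrow> complex) \<Rightarrow> (complex \<times> complex) set \<Rightarrow> bool" where
  "holomorphic2_on f S \<longleftrightarrow>
     (\<forall>z\<in>S. \<exists>a b. (f has_derivative (\<lambda>(h, k). a * h + b * k)) (at z within S))"

definition bergman_space :: "(complex \<times> complex) set \<Rightarrow> (complex \<times> complex \<Rightarrow> complex) set" where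
  "bergman_space S =
     {f. holomorphic2_on f S \<and> integrable (lebesgue_on S) (\<lambda>z. (cmod (f z))\<^sup>2)}"

text \<open>The values of a kernel outside \<open>S \<times> S\<close> carry no meaning. They are set to \<open>0\<close> so that the
  reproducing kernel is unique as a total function.\<close>

definition reproducing_kernel ::
  "(complex \<times> complex) set \<Rightarrow> (complex \<times> complex \<Rightarrow> complex \<times> complex \<Rightarrow> complex) \<Rightarrow> bool" where
  "reproducing_kernel S K \<longleftrightarrow>
     (\<forall>w\<in>S. (\<lambda>z. K z w) \<in> bergman_space S) \<and>
     (\<forall>f\<in>bergman_space S. \<forall>z\<in>S. f z = (\<integral>w. f w * cnj (K w z) \<partial>lebesgue_on S)) \<and>
     (\<forall>z w. z \<notin> S \<or> w \<notin> S \<longrightarrow> K z w = 0)"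

lemma reproducing_kernel_unique:
  assumes K: "reproducing_kernel S K" and L: "reproducing_kernel S L"
  shows "K = L"
proof -
  have rep: "A z w = (\<integral>v. A v w * cnj (B v z) \<partial>lebesgue_on S)"
    if A: "reproducing_kernel S A" and B: "reproducing_kernel S B" and zw: "z \<in> S" "w \<in> S" for A B z w
  proof -
    have "(\<lambda>v. A v w) \<in> bergman_space S"
      using A zw by (simp add: reproducing_kernel_def)
    moreover have "\<forall>f\<in>bergman_space S. \<forall>z\<in>S. f z = (\<integral>w. f w * cnj (B w z) \<partial>lebesgue_on S)"
      using B by (simp add: reproducing_kernel_def)
    ultimately show ?thesis
      using zw by (auto dest!: bspec)
  qed
  have *: "A z w = cnj (B w z)"
    if A: "reproducing_kernel S A" and B: "reproducing_kernel S B" and zw: "z \<in> S" "w \<in> S" for A B z w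
  proof -
    have "A z w = (\<integral>v. cnj (B v z * cnj (A v w)) \<partial>lebesgue_on S)"
      using rep[OF A B zw] by (simp add: mult.commute)
    also have "\<dots> = cnj (\<integral>v. B v z * cnj (A v w) \<partial>lebesgue_on S)"
      by (rule Bochner_Integration.integral_cnj)
    also have "(\<integral>v. B v z * cnj (A v w) \<partial>lebesgue_on S) = B w z"
      using rep[OF B A zw(2) zw(1)] by simp
    finally show ?thesis .
  qed
  show ?thesis
  proof (intro ext)
    fix z w
    show "K z w = L z w"
    proof (cases "z \<in> S \<and> w \<in> S")
      case True
      then show ?thesis using *[OF K L] *[OF L L] by metis
    next
      case False
      then show ?thesis using K L unfolding reproducing_kernel_def by metis
    qed
  qed
qed

definition bergman_kernel ::
  "(complex \<times> complex) set \<Rightarrow> complex \<times> complex \<Rightarrow> complex \<times> complex \<Rightarrow> complex" where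
  "bergman_kernel S = (THE K. reproducing_kernel S K)"

definition in_Lp :: "real \<Rightarrow> 'a measure \<Rightarrow> ('a \<Rightarrow> complex) \<Rightarrow> bool" where
  "in_Lp p M f \<longleftrightarrow> f \<in> borel_measurable M \<and> integrable M (\<lambda>x. cmod (f x) powr p)"

definition Lp_norm :: "real \<Rightarrow> 'a measure \<Rightarrow> ('a \<Rightarrow> complex) \<Rightarrow> real" where
  "Lp_norm p M f = (\<integral>x. cmod (f x) powr p \<partial>M) powr (1 / p)"

definition integral_operator :: "'a measure \<Rightarrow> ('a \<Rightarrow> 'a \<Rightarrow> complex) \<Rightarrow> ('a \<Rightarrow> complex) \<Rightarrow> 'a \<Rightarrow> complex" where
  "integral_operator M k f z = (\<integral>w. k z w * f w \<partial>M)"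

text \<open>The Bochner integral is \<open>0\<close> where the integrand is not integrable, so absolute convergence
  is required explicitly. Likewise \<^const>\<open>Lp_norm\<close> is only meaningful on members of \<open>L\<^sup>p\<close>.\<close>

definition integral_operator_bounded_on_Lp :: "real \<Rightarrow> 'a measure \<Rightarrow> ('a \<Rightarrow> 'a \<Rightarrow> complex) \<Rightarrow> bool" where
  "integral_operator_bounded_on_Lp p M k \<longleftrightarrow>
     (\<exists>C. \<forall>f. in_Lp p M f \<longrightarrow>
        (AE z in M. integrable M (\<lambda>w. k z w * f w)) \<and>
        in_Lp p M (integral_operator M k f) \<and>
        Lp_norm p M (integral_operator M k f) \<le> C * Lp_norm p M f)"

definition berezin_kernel ::
  "(complex \<times> complex) set \<Rightarrow> complex \<times> complex \<Rightarrow> complex \<times> complex \<Rightarrow> complex" where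
  "berezin_kernel S z w =
     complex_of_real ((cmod (bergman_kernel S z w))\<^sup>2) / bergman_kernel S z z"

end

theory Submission
  imports Defs "HOL-Complex_Analysis.Complex_Analysis"
begin

text \<open>
  Put \<open>s = (z\<^sub>1 cnj w\<^sub>1)\<^sup>m / (z\<^sub>2 cnj w\<^sub>2)\<^sup>n\<close> and \<open>t = z\<^sub>2 cnj w\<^sub>2\<close>. The monomials
  \<open>z\<^sub>1\<^sup>a z\<^sub>2\<^sup>b\<close> with \<open>a \<ge> 0\<close> and \<open>m (b + 1) + n (a + 1) \<ge> 1\<close> are an orthogonal basis of the Bergman
  space. Grouping them by the residue of \<open>a\<close> modulo \<open>m\<close> writes the Bergman kernel as a sum of \<open>m\<close>
  products of a function of \<open>s\<close> and a function of \<open>t\<close>, each positive on the diagonal. Hence the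
  Berezin kernel is at most a constant times the sum of the Berezin-type quotients of the single products,
  and these behave like products of Berezin kernels of the disc, with an extra factor
  \<open>|w\<^sub>2|\<close> to the power \<open>-2 (m + n - 1) / m\<close>. Such kernels pass the Schur test on \<open>L\<^sup>p\<close> with a power weight as soon as
  \<open>p > m + n\<close>.

  If \<open>p \<le> m + n\<close>, take the basis monomial with \<open>m (b + 1) + n (a + 1) = 1\<close>, \<open>a < m\<close>, which exists because
  \<open>m\<close> and \<open>n\<close> are coprime. The Berezin transform of a radial function \<open>f \<ge> 0\<close> is bounded below by a fixed
  function times \<open>\<integral> |w\<^sub>1\<^sup>a w\<^sub>2\<^sup>b|\<^sup>2 f\<close>. For \<open>f\<close> the truncation to \<open>|w\<^sub>2| \<ge> exp (- N)\<close> of \<open>|w\<^sub>2|\<close> to the power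
  \<open>-2 (m + n) / (m p)\<close>, this integral grows at least like \<open>N\<close>, but the norm of \<open>f\<close> only like \<open>N\<close> to the power \<open>1/p\<close>.
\<close>

section \<open>Area integrals over the complex plane\<close>

text \<open>The threshold is decided near \<open>z\<^sub>2 = 0\<close>. On \<open>H\<close> a basis
  monomial is at most \<open>|z\<^sub>2|\<close> to the power \<open>- \<kappa>\<close> with
  \<open>\<kappa> = (m + n - 1) / m\<close>. Let the Schur weight behave there like
  \<open>|z\<^sub>2|\<close> to the power \<open>- 2 * \<theta>\<close>. One Schur inequality
  integrates the power \<open>- 2 * (\<kappa> + \<theta>)\<close>, which needs
  \<open>\<theta> < 1 / m\<close>. The other must absorb \<open>|w\<^sub>2|\<close> to the power
  \<open>- 2 * \<kappa>\<close> into the weight to the power \<open>p - 1\<close>, which needs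
  \<open>\<theta> * (p - 1) \<ge> \<kappa>\<close>. Such a \<open>\<theta>\<close> exists exactly
  for \<open>p > m + n\<close>.

  For necessity the obstacle is that the Berezin kernel is quadratic in the Bergman kernel, so
  orthogonality does not apply to it directly. Instead the radial test function times the critical
  monomial is paired with the Bergman kernel itself. Orthogonality leaves a multiple of that
  monomial, and Cauchy-Schwarz carries the result over to the squared kernel.\<close>

lemma nn_integral_translate:
  fixes f :: "'a::euclidean_space \<Rightarrow> ennreal"
  assumes [measurable]: "f \<in> borel_measurable borel"
  shows "(\<integral>\<^sup>+x. f (c + x) \<partial>lborel) = (\<integral>\<^sup>+x. f x \<partial>lborel)"
proof -
  have "(\<integral>\<^sup>+x. f x \<partial>lborel) = (\<integral>\<^sup>+x. f x \<partial>(distr lborel borel ((+) c)))"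
    by (simp only: lborel_distr_plus)
  also have "\<dots> = (\<integral>\<^sup>+x. f (c + x) \<partial>lborel)"
    by (subst nn_integral_distr) auto
  finally show ?thesis by simp
qed

text \<open>The rotated measure is translation invariant. A double integral compares it with the original one on
  \<open>A\<close> and on the unit ball, where both agree.\<close>

lemma lborel_distr_rotation:
  fixes c :: complex
  assumes c: "norm c = 1"
  shows "distr lborel borel (\<lambda>z. c * z) = lborel"
proof (rule measure_eqI)
  fix A :: "complex set"
  assume "A \<in> sets (distr lborel borel (\<lambda>z. c * z))"
  then have A[measurable]: "A \<in> sets borel" by simp
  have c0: "c \<noteq> 0" using c by auto
  let ?B = "ball (0::complex) 1"
  have [measurable]: "?B \<in> sets borel" by simp
  have B: "(\<integral>\<^sup>+y. indicator ?B (y - a) \<partial>lborel) = emeasure lborel ?B" for a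
  proof -
    have "(indicator ?B :: complex \<Rightarrow> ennreal) \<in> borel_measurable borel"
      by (rule borel_measurable_indicator) simp
    from nn_integral_translate[OF this, of "-a"] show ?thesis
      by (simp only: nn_integral_indicator uminus_add_conv_diff) simp
  qed
  have "emeasure (distr lborel borel (\<lambda>z. c * z)) A * emeasure lborel ?B
      = (\<integral>\<^sup>+x. indicator A (c * x) \<partial>lborel) * emeasure lborel ?B"
    by (simp add: nn_integral_distr flip: nn_integral_indicator)
  also have "\<dots> = (\<integral>\<^sup>+x. \<integral>\<^sup>+y. indicator A (c * x) * indicator ?B (y - c * x) \<partial>lborel \<partial>lborel)"
  proof -
    have "(\<integral>\<^sup>+y. indicator A (c * x) * indicator ?B (y - c * x) \<partial>lborel)
        = indicator A (c * x) * emeasure lborel ?B" for x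
      by (subst nn_integral_cmult) (auto simp: B)
    then show ?thesis by (subst nn_integral_multc[symmetric]) auto
  qed
  also have "\<dots> = (\<integral>\<^sup>+y. \<integral>\<^sup>+x. indicator A (c * x) * indicator ?B (y - c * x) \<partial>lborel \<partial>lborel)"
    by (rule lborel_pair.Fubini') auto
  also have "\<dots> = (\<integral>\<^sup>+y. \<integral>\<^sup>+x. indicator A (c * x + y) * indicator ?B (c * x) \<partial>lborel \<partial>lborel)"
  proof (rule nn_integral_cong)
    fix y :: complex
    have "(\<integral>\<^sup>+x. indicator A (c * x) * indicator ?B (y - c * x) \<partial>lborel)
        = (\<integral>\<^sup>+x. indicator A (c * (y / c + x)) * indicator ?B (y - c * (y / c + x)) \<partial>lborel)"
      by (rule nn_integral_translate[symmetric]) auto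
    also have "\<dots> = (\<integral>\<^sup>+x. indicator A (c * x + y) * indicator ?B (c * x) \<partial>lborel)"
      using c0 by (intro nn_integral_cong) (auto simp: algebra_simps indicator_def)
    finally show "(\<integral>\<^sup>+x. indicator A (c * x) * indicator ?B (y - c * x) \<partial>lborel) = \<dots>" .
  qed
  also have "\<dots> = (\<integral>\<^sup>+x. \<integral>\<^sup>+y. indicator A (c * x + y) * indicator ?B (c * x) \<partial>lborel \<partial>lborel)"
    by (rule lborel_pair.Fubini') auto
  also have "\<dots> = (\<integral>\<^sup>+x. emeasure lborel A * indicator ?B (c * x) \<partial>lborel)"
    using nn_integral_translate[of "indicator A"] by (simp add: nn_integral_multc)
  also have "\<dots> = (\<integral>\<^sup>+x. emeasure lborel A * indicator ?B x \<partial>lborel)"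
    using c by (intro nn_integral_cong) (auto simp: indicator_def norm_mult)
  also have "\<dots> = emeasure lborel A * emeasure lborel ?B"
    by (simp add: nn_integral_cmult)
  finally have eq: "emeasure (distr lborel borel (\<lambda>z. c * z)) A * emeasure lborel ?B
      = emeasure lborel A * emeasure lborel ?B" .
  have "emeasure lborel ?B = ennreal pi"
    by (simp add: emeasure_ball unit_ball_vol_2)
  with eq show "emeasure (distr lborel borel (\<lambda>z. c * z)) A = emeasure lborel A"
    by (simp add: mult.commute[of _ "ennreal pi"] ennreal_mult_cancel_left)
qed simp

text \<open>Polar coordinates with the angle integrated out. The disc of squared radius
  \<open>x\<close> has area \<open>pi * x\<close>, so both measures agree on the half-lines
  \<open>{..<x}\<close>, which form an intersection-stable generator.\<close>

lemma distr_cmod_square: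
  "distr lborel borel (\<lambda>z. (cmod z)\<^sup>2) = density lborel (\<lambda>t::real. ennreal pi * indicator {0..} t)"
proof (rule measure_eqI_generator_eq)
  let ?E = "range (lessThan :: real \<Rightarrow> real set)"
  show "Int_stable ?E" by (auto simp: Int_stable_def intro: image_eqI[where x = "min _ _"])
  show "?E \<subseteq> Pow UNIV" by auto
  show "sets (distr lborel borel (\<lambda>z. (cmod z)\<^sup>2)) = sigma_sets UNIV ?E"
    "sets (density lborel (\<lambda>t::real. ennreal pi * indicator {0..} t)) = sigma_sets UNIV ?E"
    by (simp_all add: borel_Iio)
  show "range (\<lambda>n::nat. {..<real n}) \<subseteq> ?E" by auto
  show "(\<Union>n::nat. {..<real n}) = UNIV" using reals_Archimedean2 by fastforce
  have M: "emeasure (distr lborel borel (\<lambda>z. (cmod z)\<^sup>2)) {..<x} = ennreal (pi * max x 0)" for x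
  proof -
    have "(\<lambda>z. (cmod z)\<^sup>2) -` {..<x} = ball 0 (sqrt (max x 0))"
    proof (cases "x > 0")
      case True
      have "\<And>z. (cmod z)\<^sup>2 < x \<longleftrightarrow> cmod z < sqrt x"
        using True by (metis norm_ge_zero real_less_lsqrt real_less_rsqrt real_sqrt_less_iff real_sqrt_abs abs_norm_cancel)
      then show ?thesis using True by (auto simp: max_def)
    next
      case False
      then have "\<not> (cmod z)\<^sup>2 < x" for z
        by (smt (verit) zero_le_power2)
      then show ?thesis using False by (auto simp: max_def)
    qed
    then show ?thesis
      by (simp add: emeasure_distr emeasure_ball unit_ball_vol_2)
  qed
  show "emeasure (distr lborel borel (\<lambda>z. (cmod z)\<^sup>2)) {..<real n} \<noteq> \<infinity>" for n
    by (simp add: M)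
  fix X assume "X \<in> ?E"
  then obtain x where X: "X = {..<x}" by auto
  have "emeasure (density lborel (\<lambda>t::real. ennreal pi * indicator {0..} t)) X
      = (\<integral>\<^sup>+t. ennreal pi * indicator {0..<x} t \<partial>lborel)"
    by (subst emeasure_density) (auto simp: X indicator_def intro!: nn_integral_cong)
  also have "\<dots> = ennreal pi * emeasure lborel {0..<x}"
    by (simp add: nn_integral_cmult)
  also have "emeasure lborel {0..<x} = ennreal (max x 0)"
    by (cases "0 \<le> x") (auto simp: max_def)
  finally show "emeasure (distr lborel borel (\<lambda>z. (cmod z)\<^sup>2)) X
      = emeasure (density lborel (\<lambda>t::real. ennreal pi * indicator {0..} t)) X"
    by (simp add: M X ennreal_mult)
qed

lemma nn_integral_radial:
  fixes f :: "real \<Rightarrow> ennreal"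
  assumes [measurable]: "f \<in> borel_measurable borel"
  shows "(\<integral>\<^sup>+z. f ((cmod z)\<^sup>2) \<partial>lborel) = ennreal pi * (\<integral>\<^sup>+t. f t * indicator {0..} t \<partial>lborel)"
proof -
  have "(\<integral>\<^sup>+z. f ((cmod z)\<^sup>2) \<partial>lborel) = (\<integral>\<^sup>+t. f t \<partial>distr lborel borel (\<lambda>z. (cmod z)\<^sup>2))"
    by (simp add: nn_integral_distr)
  also have "\<dots> = (\<integral>\<^sup>+t. ennreal pi * (f t * indicator {0..} t) \<partial>lborel)"
    unfolding distr_cmod_square
    by (subst nn_integral_density) (auto simp: mult_ac)
  finally show ?thesis by (simp add: nn_integral_cmult)
qed

section \<open>Power weights and the Forelli-Rudin integral on the unit interval\<close>

lemma nn_integral_powr_0: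
  assumes "\<gamma> > -1" "x \<ge> 0"
  shows "(\<integral>\<^sup>+t. ennreal (t powr \<gamma>) * indicator {0..x} t \<partial>lborel) = ennreal (x powr (\<gamma> + 1) / (\<gamma> + 1))"
proof -
  have "(\<integral>\<^sup>+t. ennreal (t powr \<gamma> * indicator {0..x} t) \<partial>lborel) = ennreal (x powr (\<gamma> + 1) / (\<gamma> + 1))"
  proof (rule nn_integral_has_integral_lborel)
    show "((\<lambda>t. t powr \<gamma> * indicator {0..x} t) has_integral x powr (\<gamma> + 1) / (\<gamma> + 1)) UNIV"
      using has_integral_powr_from_0[OF assms]
      by (subst (asm) has_integral_restrict_UNIV[symmetric])
        (simp add: indicator_def of_bool_def if_distrib cong: if_cong)
  qed auto
  then show ?thesis
    by (simp add: ennreal_mult' ennreal_indicator)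
qed

lemma nn_integral_powr_inf:
  assumes "e < -1" "x > (0::real)"
  shows "(\<integral>\<^sup>+t. ennreal (t powr e) * indicator {x..} t \<partial>lborel) = ennreal (x powr (e + 1) / (- e - 1))"
proof -
  have "(\<integral>\<^sup>+t. ennreal (t powr e * indicator {x..} t) \<partial>lborel) = ennreal (-(x powr (e + 1)) / (e + 1))"
  proof (rule nn_integral_has_integral_lborel)
    show "((\<lambda>t. t powr e * indicator {x..} t) has_integral -(x powr (e + 1)) / (e + 1)) UNIV"
      using has_integral_powr_to_inf[OF assms]
      by (subst (asm) has_integral_restrict_UNIV[symmetric])
        (simp add: indicator_def of_bool_def if_distrib cong: if_cong)
  qed auto
  also have "-(x powr (e + 1)) / (e + 1) = x powr (e + 1) / (- e - 1)"
    using assms by (simp add: field_simps)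
  finally show ?thesis
    by (simp add: ennreal_mult' ennreal_indicator)
qed

lemma nn_integral_cmod_powr:
  assumes "\<gamma> > -1" "R \<ge> 0"
  shows "(\<integral>\<^sup>+z. ennreal (cmod z powr (2 * \<gamma>)) * indicator (ball 0 R) z \<partial>lborel)
    = ennreal (pi * R powr (2 * \<gamma> + 2) / (\<gamma> + 1))"
proof -
  have "(\<integral>\<^sup>+z. ennreal (cmod z powr (2 * \<gamma>)) * indicator (ball 0 R) z \<partial>lborel)
     = (\<integral>\<^sup>+z. ennreal (((cmod z)\<^sup>2) powr \<gamma>) * indicator {..<R\<^sup>2} ((cmod z)\<^sup>2) \<partial>lborel)"
  proof (rule nn_integral_cong, goal_cases)
    case (1 z)
    have "cmod z powr (2 * \<gamma>) = ((cmod z)\<^sup>2) powr \<gamma>"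
      by (cases "z = 0") (simp_all add: powr_powr flip: powr_numeral)
    moreover have "cmod z < R \<longleftrightarrow> (cmod z)\<^sup>2 < R\<^sup>2"
      using assms by (metis norm_ge_zero power2_less_imp_less power_strict_mono zero_less_numeral)
    ultimately show ?case by (simp add: indicator_def)
  qed
  also have "\<dots> = ennreal pi * (\<integral>\<^sup>+t. ennreal (t powr \<gamma>) * indicator {..<R\<^sup>2} t * indicator {0..} t \<partial>lborel)"
    by (rule nn_integral_radial) auto
  also have "(\<integral>\<^sup>+t. ennreal (t powr \<gamma>) * indicator {..<R\<^sup>2} t * indicator {0..} t \<partial>lborel)
      = (\<integral>\<^sup>+t. ennreal (t powr \<gamma>) * indicator {0..R\<^sup>2} t \<partial>lborel)"
    using AE_lborel_singleton[of "R\<^sup>2"]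
    by (intro nn_integral_cong_AE) (auto simp: indicator_def elim!: eventually_mono)
  also have "\<dots> = ennreal ((R\<^sup>2) powr (\<gamma> + 1) / (\<gamma> + 1))"
    using assms by (intro nn_integral_powr_0) auto
  also have "(R\<^sup>2) powr (\<gamma> + 1) = R powr (2 * \<gamma> + 2)"
    using assms by (cases "R = 0") (simp_all add: powr_powr algebra_simps flip: powr_numeral)
  finally show ?thesis using assms by (simp add: ennreal_mult' flip: ennreal_mult)
qed

text \<open>Three regions are estimated separately. For \<open>t \<le> 1/2\<close> only
  \<open>t powr \<gamma>\<close> can be singular (\<open>F1\<close>). For larger \<open>t\<close>
  put \<open>u = 1 - t\<close> and \<open>d = 1 - x\<close>: the denominator is at least
  \<open>d ^ 3\<close>, used for \<open>u \<le> d\<close> (\<open>F2\<close>), and at least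
  \<open>u ^ 3\<close>, used for \<open>u > d\<close> (\<open>F3\<close>). The hypotheses
  \<open>\<gamma> > -1\<close>, \<open>-1 < \<beta>\<close> and \<open>\<beta> < 2\<close> make the
  three integrals converge in this order.\<close>

lemma forelli_rudin_real:
  assumes \<gamma>: "\<gamma> > -1" and \<beta>: "-1 < \<beta>" "\<beta> < 2"
  obtains C where "C > 0"
    "\<And>x. 0 \<le> x \<Longrightarrow> x < 1 \<Longrightarrow>
      (\<integral>\<^sup>+t. ennreal (t powr \<gamma> * (1 - t) powr \<beta> / (1 - x * t) ^ 3) * indicator {0..<1} t \<partial>lborel)
        \<le> ennreal (C * (1 - x) powr (\<beta> - 2))"
proof -
  \<comment> \<open>\<open>A\<close> bounds \<open>(1 - t) powr \<beta> / (1 - x * t) ^ 3\<close>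
    for \<open>t \<le> 1/2\<close>, and \<open>c\<close> bounds \<open>t powr \<gamma>\<close> for
    \<open>t > 1/2\<close>. The maxima cover both signs of the exponents.\<close>
  define A where "A = 8 * max 1 (2 powr (-\<beta>))"
  define c where "c = max 1 (2 powr (-\<gamma>))"
  define C where "C = A / (\<gamma> + 1) + c * (1 / (\<beta> + 1) + 1 / (2 - \<beta>))"
  have A: "A > 0" and c: "c > 0" by (auto simp: A_def c_def)
  have "C > 0"     unfolding C_def using A c assms by (simp add: add_pos_pos)
  moreover have "(\<integral>\<^sup>+t. ennreal (t powr \<gamma> * (1 - t) powr \<beta> / (1 - x * t) ^ 3) * indicator {0..<1} t \<partial>lborel)
        \<le> ennreal (C * (1 - x) powr (\<beta> - 2))" if x: "0 \<le> x" "x < 1" for x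
  proof -
    define d where "d = 1 - x"
    have d: "0 < d" "d \<le> 1" using x by (auto simp: d_def)
    define F1 where "F1 t = ennreal A * (ennreal (t powr \<gamma>) * indicator {0..1} t)" for t :: real
    define F2 where "F2 u = ennreal (c / d ^ 3) * (ennreal (u powr \<beta>) * indicator {0..d} u)" for u :: real
    define F3 where "F3 u = ennreal c * (ennreal (u powr (\<beta> - 3)) * indicator {d..} u)" for u :: real
    have [measurable]: "F1 \<in> borel_measurable borel" "F2 \<in> borel_measurable borel" "F3 \<in> borel_measurable borel"
      unfolding F1_def[abs_def] F2_def[abs_def] F3_def[abs_def] by measurable
    have bound: "ennreal (t powr \<gamma> * (1 - t) powr \<beta> / (1 - x * t) ^ 3) * indicator {0..<1} t
        \<le> F1 t + (F2 (1 - t) + F3 (1 - t))" for t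
    proof (cases "0 \<le> t \<and> t < 1")
      case t: True
      have xt: "x * t \<le> x" "x * t \<le> t" "x * t < 1"
        using t x mult_left_le[of t x] mult_right_le_one_le[of t x] by (auto simp: mult.commute) 
      show ?thesis
      proof (cases "t \<le> 1/2")
        case True
        have "(1 - t) powr \<beta> \<le> max 1 (2 powr (-\<beta>))"
        proof (cases "\<beta> \<ge> 0")
          case True
          then have "(1 - t) powr \<beta> \<le> 1" using t by (intro powr_le1) auto
          then show ?thesis by simp
        next
          case False
          then have "(1 - t) powr \<beta> \<le> (1/2) powr \<beta>" using t \<open>t \<le> 1/2\<close>
            by (intro powr_mono2') auto
          also have "\<dots> = 2 powr (-\<beta>)" by (simp add: powr_divide powr_minus field_simps)
          finally show ?thesis by simp
        qed
        moreover have "1 / (1 - x * t) ^ 3 \<le> 8"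
        proof -
          have "(1/2) ^ 3 \<le> (1 - x * t) ^ 3" using xt True by (intro power_mono) auto
          then show ?thesis using xt by (simp add: field_simps)
        qed
        ultimately have "(1 - t) powr \<beta> * (1 / (1 - x * t) ^ 3) \<le> max 1 (2 powr (-\<beta>)) * 8"
          using xt by (intro mult_mono) auto
        then have "t powr \<gamma> * ((1 - t) powr \<beta> * (1 / (1 - x * t) ^ 3)) \<le> t powr \<gamma> * A"
          by (intro mult_left_mono) (auto simp: A_def)
        then have "ennreal (t powr \<gamma> * (1 - t) powr \<beta> / (1 - x * t) ^ 3) \<le> ennreal (A * t powr \<gamma>)"
          by (intro ennreal_leI) (simp add: mult_ac)
        also have "\<dots> = F1 t" using t A by (simp add: F1_def ennreal_mult)
        finally show ?thesis using t by (simp add: add_increasing2)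
      next
        case False
        have 1: "t powr \<gamma> \<le> c"
        proof (cases "\<gamma> \<ge> 0")
          case True
          then have "t powr \<gamma> \<le> 1" using t by (intro powr_le1) auto
          then show ?thesis by (simp add: c_def)
        next
          case F: False
          then have "t powr \<gamma> \<le> (1/2) powr \<gamma>" using t False
            by (intro powr_mono2') auto
          also have "\<dots> = 2 powr (-\<gamma>)" by (simp add: powr_divide powr_minus field_simps)
          finally show ?thesis by (simp add: c_def)
        qed
        have 2: "ennreal (t powr \<gamma> * (1 - t) powr \<beta> / (1 - x * t) ^ 3) \<le> F2 (1 - t) + F3 (1 - t)"
        proof (cases "1 - t \<le> d")
          case True
          have "d ^ 3 \<le> (1 - x * t) ^ 3" using xt d by (intro power_mono) (auto simp: d_def)
          then have "1 / (1 - x * t) ^ 3 \<le> 1 / d ^ 3" using d xt by (intro divide_left_mono) auto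
          then have "t powr \<gamma> * (1 - t) powr \<beta> * (1 / (1 - x * t) ^ 3) \<le> c * (1 - t) powr \<beta> * (1 / d ^ 3)"
            using 1 xt c by (intro mult_mono) auto
          then have "ennreal (t powr \<gamma> * (1 - t) powr \<beta> / (1 - x * t) ^ 3) \<le> ennreal (c / d ^ 3 * (1 - t) powr \<beta>)"
            by (intro ennreal_leI) (simp add: mult_ac)
          also have "\<dots> = F2 (1 - t)" using True t c d by (simp add: F2_def flip: ennreal_mult)
          finally show ?thesis by (simp add: add_increasing2)
        next
          case False
          have "(1 - t) ^ 3 \<le> (1 - x * t) ^ 3" using xt t by (intro power_mono) auto
          then have "1 / (1 - x * t) ^ 3 \<le> 1 / (1 - t) ^ 3" using t xt by (intro divide_left_mono) auto
          then have "t powr \<gamma> * (1 - t) powr \<beta> * (1 / (1 - x * t) ^ 3) \<le> c * (1 - t) powr \<beta> * (1 / (1 - t) ^ 3)"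
            using 1 xt c by (intro mult_mono) auto
          also have "\<dots> = c * (1 - t) powr (\<beta> - 3)"
            using t by (simp add: powr_diff powr_numeral)
          finally have "ennreal (t powr \<gamma> * (1 - t) powr \<beta> / (1 - x * t) ^ 3) \<le> ennreal (c * (1 - t) powr (\<beta> - 3))"
            by (intro ennreal_leI) (simp add: mult_ac)
          also have "\<dots> = F3 (1 - t)" using False t c d by (simp add: F3_def ennreal_mult)
          finally show ?thesis by (simp add: add_increasing)
        qed
        then show ?thesis using t by (simp add: add_increasing)
      qed
    qed auto
    have refl: "(\<integral>\<^sup>+t. f (1 - t) \<partial>lborel) = (\<integral>\<^sup>+t. f t \<partial>lborel)"
      if [measurable]: "f \<in> borel_measurable borel" for f :: "real \<Rightarrow> ennreal"
      using nn_integral_real_affine[of f "-1" 1] by simp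
    have "(\<integral>\<^sup>+t. ennreal (t powr \<gamma> * (1 - t) powr \<beta> / (1 - x * t) ^ 3) * indicator {0..<1} t \<partial>lborel)
        \<le> (\<integral>\<^sup>+t. F1 t + (F2 (1 - t) + F3 (1 - t)) \<partial>lborel)"
      by (intro nn_integral_mono bound)
    also have "\<dots> = (\<integral>\<^sup>+t. F1 t \<partial>lborel) + ((\<integral>\<^sup>+t. F2 t \<partial>lborel) + (\<integral>\<^sup>+t. F3 t \<partial>lborel))"
      by (simp add: nn_integral_add refl)
    also have "(\<integral>\<^sup>+t. F1 t \<partial>lborel) = ennreal (A / (\<gamma> + 1))"
      unfolding F1_def using A assms
      by (subst nn_integral_cmult) (auto simp: nn_integral_powr_0 simp flip: ennreal_mult)
    also have "(\<integral>\<^sup>+t. F2 t \<partial>lborel) = ennreal (c / d ^ 3 * (d powr (\<beta> + 1) / (\<beta> + 1)))"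
      unfolding F2_def using c d assms
      by (subst nn_integral_cmult) (auto simp: nn_integral_powr_0 simp flip: ennreal_mult)
    also have "(\<integral>\<^sup>+t. F3 t \<partial>lborel) = ennreal (c * (d powr (\<beta> - 2) / (2 - \<beta>)))"
      unfolding F3_def using c d assms
      by (subst nn_integral_cmult) (auto simp: nn_integral_powr_inf simp flip: ennreal_mult)
    also have "ennreal (A / (\<gamma> + 1)) + (ennreal (c / d ^ 3 * (d powr (\<beta> + 1) / (\<beta> + 1))) + ennreal (c * (d powr (\<beta> - 2) / (2 - \<beta>))))
       = ennreal (A / (\<gamma> + 1) + (c / d ^ 3 * (d powr (\<beta> + 1) / (\<beta> + 1)) + c * (d powr (\<beta> - 2) / (2 - \<beta>))))"
      using A c d assms by (simp flip: ennreal_plus)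
    also have "\<dots> \<le> ennreal (C * (1 - x) powr (\<beta> - 2))"
    proof (rule ennreal_leI)
      have "d powr (\<beta> + 1) / d ^ 3 = d powr (\<beta> - 2)"
        using d by (simp add: powr_diff powr_add powr_numeral power3_eq_cube power2_eq_square field_simps)
      then have 1: "c / d ^ 3 * (d powr (\<beta> + 1) / (\<beta> + 1)) = c / (\<beta> + 1) * d powr (\<beta> - 2)"
        by (metis (no_types, opaque_lifting) mult.commute times_divide_eq_left times_divide_eq_right)
      \<comment> \<open>As \<open>\<beta> < 2\<close> and \<open>d \<le> 1\<close>, the target power
        is at least 1 and absorbs the constant contribution of \<open>F1\<close>.\<close>
      have "d powr (\<beta> - 2) \<ge> d powr 0" using d assms by (intro powr_mono') auto
      then have "d powr (\<beta> - 2) \<ge> 1" using d by simp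
      then have "A / (\<gamma> + 1) * 1 \<le> A / (\<gamma> + 1) * d powr (\<beta> - 2)"
        using A assms by (intro mult_left_mono) auto
      then show "A / (\<gamma> + 1) + (c / d ^ 3 * (d powr (\<beta> + 1) / (\<beta> + 1)) + c * (d powr (\<beta> - 2) / (2 - \<beta>)))
         \<le> C * (1 - x) powr (\<beta> - 2)"
        unfolding 1 C_def d_def[symmetric] by (simp add: algebra_simps)
    qed
    finally show ?thesis .
  qed
  ultimately show ?thesis using that by blast
qed

section \<open>Orthogonality of monomials\<close>

text \<open>Termwise integration under a bound that separates the index from the point: the
  integrals of the norms are then at most \<open>c i\<close> times the integral of \<open>g\<close>.
  All series expansions below are interchanged with integrals in this form.\<close>

lemma integral_sums_dominated:
  fixes f :: "nat \<Rightarrow> 'a \<Rightarrow> complex"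
  assumes meas: "\<And>i. f i \<in> borel_measurable M" and g: "integrable M g"
    and bound: "\<And>i x. x \<in> space M \<Longrightarrow> cmod (f i x) \<le> c i * g x"
    and c: "summable c" and s: "\<And>x. x \<in> space M \<Longrightarrow> (\<lambda>i. f i x) sums s x"
  shows "integrable M s \<and> (\<lambda>i. integral\<^sup>L M (f i)) sums integral\<^sup>L M s"
proof

  have int: "integrable M (f i)" for i
  proof (rule Bochner_Integration.integrable_bound[OF _ meas])
    show "integrable M (\<lambda>x. c i * g x)" using g by simp
    show "AE x in M. norm (f i x) \<le> norm (c i * g x)"
      using bound by (intro AE_I2) (auto intro: order.trans[OF bound])
  qed
  have "(\<integral>x. norm (f i x) \<partial>M) \<le> c i * integral\<^sup>L M g" for i
  proof -
    have "(\<integral>x. norm (f i x) \<partial>M) \<le> (\<integral>x. c i * g x \<partial>M)"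
      using g int bound by (intro integral_mono) auto
    then show ?thesis by simp
  qed
  then have summ: "summable (\<lambda>i. \<integral>x. norm (f i x) \<partial>M)"
    by (intro summable_comparison_test_ev[OF always_eventually summable_mult2[OF c, of "integral\<^sup>L M g"]])
      (auto simp: integral_nonneg_AE)
  have AE: "AE x in M. summable (\<lambda>i. norm (f i x))"
    using bound
    by (intro AE_I2 summable_comparison_test_ev[OF always_eventually summable_mult2[OF c]]) auto
  have "integrable M (\<lambda>x. \<Sum>i. f i x) \<longleftrightarrow> integrable M s"
    using s by (intro Bochner_Integration.integrable_cong) (auto simp: sums_iff)
  with integrable_suminf[OF int AE summ] show "integrable M s" by simp
  have "(\<integral>x. (\<Sum>i. f i x) \<partial>M) = integral\<^sup>L M s"
    using s by (intro Bochner_Integration.integral_cong) (auto simp: sums_iff)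
  with sums_integral[OF int AE summ] show "(\<lambda>i. integral\<^sup>L M (f i)) sums integral\<^sup>L M s" by simp
qed

lemma integral_rotation:
  fixes c :: complex and f :: "complex \<Rightarrow> 'b::{banach, second_countable_topology}"
  assumes "norm c = 1" and [measurable]: "f \<in> borel_measurable borel"
  shows "(\<integral>z. f (c * z) \<partial>lborel) = (\<integral>z. f z \<partial>lborel)"
proof -
  have "(\<integral>z. f z \<partial>lborel) = (\<integral>z. f z \<partial>distr lborel borel (\<lambda>z. c * z))"
    by (simp only: lborel_distr_rotation[OF assms(1)])
  also have "\<dots> = (\<integral>z. f (c * z) \<partial>lborel)"
    by (rule integral_distr) auto
  finally show ?thesis by simp
qed

lemma borel_measurable_power_int [measurable (raw)]:
  fixes f :: "'a \<Rightarrow> complex"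
  assumes [measurable]: "f \<in> borel_measurable M"
  shows "(\<lambda>x. f x powi k) \<in> borel_measurable M"
  unfolding power_int_def by measurable

lemma borel_measurable_cnj [measurable (raw)]:
  assumes "f \<in> borel_measurable M"
  shows "(\<lambda>x. cnj (f x)) \<in> borel_measurable M"
  using assms by (rule borel_measurable_continuous_on[OF continuous_on_cnj[OF continuous_on_id]])

text \<open>Rotation by the angle \<open>pi / (k - l)\<close> changes the sign of the integrand, so
  the integral equals its own negative. This also covers a non-integrable integrand, whose Bochner
  integral is 0 by convention.\<close>

lemma monomials_orthogonal:
  fixes \<rho> :: "real \<Rightarrow> real"
  assumes [measurable]: "\<rho> \<in> borel_measurable borel" and kl: "k \<noteq> l"
  shows "(\<integral>z. complex_of_real (\<rho> (cmod z)) * z powi k * cnj z powi l \<partial>lborel) = 0"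
proof -
  define c where "c = cis (pi / of_int (k - l))"
  let ?f = "\<lambda>z. complex_of_real (\<rho> (cmod z)) * z powi k * cnj z powi l"
  have c: "norm c = 1" by (simp add: c_def)
  have "cnj c = inverse c"
    using c by (simp add: c_def cis_cnj)
  then have "c powi k * cnj c powi l = c powi (k - l)"
    using c by (subst power_int_diff) (auto simp: field_simps power_int_inverse)
  also have "\<dots> = -1"
    using kl by (simp add: c_def cis_power_int)
  finally have ck: "c powi k * cnj c powi l = -1" .
  have "?f (c * z) = - ?f z" for z
  proof -
    have "?f (c * z) = (c powi k * cnj c powi l) * ?f z"
      using c by (simp add: norm_mult power_int_mult_distrib)
    then show ?thesis by (simp add: ck)
  qed
  then have "(\<integral>z. ?f z \<partial>lborel) = - (\<integral>z. ?f z \<partial>lborel)"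
    using integral_rotation[OF c, of ?f] by simp
  then show ?thesis by simp
qed

lemma monomials_orthogonal_nat:
  fixes \<rho> :: "real \<Rightarrow> real"
  assumes "\<rho> \<in> borel_measurable borel"
  shows "(\<integral>z. complex_of_real (\<rho> (cmod z)) * z ^ k * cnj z ^ l \<partial>lborel)
    = (if k = l then complex_of_real (\<integral>z. \<rho> (cmod z) * cmod z ^ (2 * k) \<partial>lborel) else 0)"
proof (cases "k = l")
  case True
  have "z ^ l * cnj z ^ l = complex_of_real (cmod z ^ (2 * l))" for z
    by (simp add: power_mult power_mult_distrib[symmetric] flip: complex_norm_square)
  then have "complex_of_real (\<rho> (cmod z)) * z ^ l * cnj z ^ l
    = complex_of_real (\<rho> (cmod z) * cmod z ^ (2 * l))" for z
    by (simp add: mult.assoc)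
  with True show ?thesis by (simp only: if_True refl integral_complex_of_real)
next
  case False
  then show ?thesis using monomials_orthogonal[OF assms, of "int k" "int l"] by simp
qed

section \<open>Taylor coefficients as moments against radial weights\<close>

lemma power_series_abs_summable:
  assumes hol: "E holomorphic_on ball 0 R" and r: "0 \<le> r" "r < R"
  shows "summable (\<lambda>k. cmod ((deriv ^^ k) E 0 / fact k) * r ^ k)"
proof -
  define r' where "r' = (r + R) / 2"
  have r': "r < r'" "r' < R" "0 < r'" using r by (auto simp: r'_def)
  have "(\<lambda>n. (deriv ^^ n) E 0 / fact n * (of_real r' - 0) ^ n) sums E (of_real r')"
    by (rule holomorphic_power_series[OF hol]) (use r' in auto)
  then have "summable (\<lambda>n. norm ((deriv ^^ n) E 0 / fact n * of_real r ^ n))"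
    using r r' by (intro powser_insidea[of _ "complex_of_real r'"]) (auto simp: sums_iff)
  then show ?thesis using r by (simp add: norm_mult norm_power norm_divide mult_ac)
qed

text \<open>By orthogonality only the term of degree \<open>l\<close> of the Taylor series survives.
  The series is dominated only on smaller discs, so the weight is first cut off at radii
  \<open>r i\<close> increasing to \<open>R\<close>. The limit is then taken by dominated
  convergence, with \<open>int\<close> and the integrability of the weight giving the
  majorants.\<close>

lemma holomorphic_moment:
  fixes \<rho> :: "real \<Rightarrow> real"
  assumes hol: "E holomorphic_on ball 0 R" and R: "R > 0"
    and [measurable]: "\<rho> \<in> borel_measurable borel" and \<rho>: "integrable lborel (\<lambda>z::complex. \<rho> (cmod z))"
    and supp: "\<And>r. r \<ge> R \<Longrightarrow> \<rho> r = 0"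
    and int: "integrable lborel (\<lambda>z. complex_of_real (\<rho> (cmod z)) * E z * cnj z ^ l)"
  shows "(\<integral>z. complex_of_real (\<rho> (cmod z)) * E z * cnj z ^ l \<partial>lborel)
    = (deriv ^^ l) E 0 / fact l * complex_of_real (\<integral>z. \<rho> (cmod z) * cmod z ^ (2 * l) \<partial>lborel)"
proof -
  define a where "a k = (deriv ^^ k) E 0 / fact k" for k
  have [measurable]: "(\<lambda>z. complex_of_real (\<rho> (cmod z)) * E z * cnj z ^ l) \<in> borel_measurable borel"
    using int by (simp add: integrable_iff_bounded)
  define r where "r i = R * (1 - 1 / real (i + 2))" for i
  have r: "0 \<le> r i" "r i < R" for i using R by (auto simp: r_def field_simps)
  have rlim: "r \<longlonglongrightarrow> R"
  proof -
    have "(\<lambda>i. 1 / real (i + 2)) \<longlonglongrightarrow> 0"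
      using LIMSEQ_ignore_initial_segment[OF lim_1_over_n[where 'a=real], of 2] by simp
    then have "r \<longlonglongrightarrow> R * (1 - 0)"
      unfolding r_def by (intro tendsto_intros)
    then show ?thesis by simp
  qed
  define \<rho>' where "\<rho>' i s = \<rho> s * indicator {..<r i} s" for i s
  have [measurable]: "\<rho>' i \<in> borel_measurable borel" for i unfolding \<rho>'_def by measurable
  have \<rho>'lim: "(\<lambda>i. \<rho>' i s) \<longlonglongrightarrow> \<rho> s" for s
  proof (cases "s < R")
    case True
    then have "eventually (\<lambda>i. s < r i) sequentially"
      using rlim order_tendstoD(1) by blast
    then have "eventually (\<lambda>i. \<rho>' i s = \<rho> s) sequentially"
      by eventually_elim (simp add: \<rho>'_def)
    then show ?thesis by (rule tendsto_eventually)
  next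
    case False
    then show ?thesis by (simp add: \<rho>'_def supp)
  qed
  have \<rho>'le: "\<bar>\<rho>' i s\<bar> \<le> \<bar>\<rho> s\<bar>" for i s by (simp add: \<rho>'_def indicator_def)
  have \<rho>'int: "integrable lborel (\<lambda>z::complex. \<rho>' i (cmod z))" for i
    by (rule Bochner_Integration.integrable_bound[OF \<rho>]) (auto simp: \<rho>'le)
  have *: "(\<integral>z. complex_of_real (\<rho>' i (cmod z)) * E z * cnj z ^ l \<partial>lborel)
     = a l * complex_of_real (\<integral>z. \<rho>' i (cmod z) * cmod z ^ (2 * l) \<partial>lborel)" for i
  proof -
    have "(\<lambda>k. \<integral>z. complex_of_real (\<rho>' i (cmod z)) * (a k * z ^ k) * cnj z ^ l \<partial>lborel)
       sums (\<integral>z. complex_of_real (\<rho>' i (cmod z)) * E z * cnj z ^ l \<partial>lborel)"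
    proof (rule integral_sums_dominated[where c = "\<lambda>k. cmod (a k) * r i ^ k"
          and g = "\<lambda>z. \<bar>\<rho>' i (cmod z)\<bar> * r i ^ l", THEN conjunct2])
      show "integrable lborel (\<lambda>z::complex. \<bar>\<rho>' i (cmod z)\<bar> * r i ^ l)"
        using \<rho>'int by (intro integrable_mult_left integrable_abs)
      show "summable (\<lambda>k. cmod (a k) * r i ^ k)"
        unfolding a_def using power_series_abs_summable[OF hol r] .
      show "cmod (complex_of_real (\<rho>' i (cmod z)) * (a k * z ^ k) * cnj z ^ l)
          \<le> cmod (a k) * r i ^ k * (\<bar>\<rho>' i (cmod z)\<bar> * r i ^ l)" for k z
      proof (cases "cmod z < r i")
        case True
        have "\<bar>\<rho>' i (cmod z)\<bar> * (cmod (a k) * (cmod z ^ k * cmod z ^ l))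
          \<le> \<bar>\<rho>' i (cmod z)\<bar> * (cmod (a k) * (r i ^ k * r i ^ l))"
          using True r[of i] by (intro mult_left_mono mult_mono power_mono) auto
        then show ?thesis by (simp add: norm_mult norm_power mult_ac)
      qed (simp add: \<rho>'_def)
      show "(\<lambda>k. complex_of_real (\<rho>' i (cmod z)) * (a k * z ^ k) * cnj z ^ l)
         sums (complex_of_real (\<rho>' i (cmod z)) * E z * cnj z ^ l)" for z
      proof (cases "cmod z < r i")
        case True
        then have "z \<in> ball 0 R" using r[of i] by auto
        from holomorphic_power_series[OF hol this] show ?thesis
          unfolding a_def by (intro sums_mult sums_mult2) simp
      qed (simp add: \<rho>'_def)
    qed measurable
    moreover have "(\<integral>z. complex_of_real (\<rho>' i (cmod z)) * (a k * z ^ k) * cnj z ^ l \<partial>lborel)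
       = (if k = l then a l * complex_of_real (\<integral>z. \<rho>' i (cmod z) * cmod z ^ (2 * l) \<partial>lborel) else 0)" for k
    proof -
      have "(\<integral>z. complex_of_real (\<rho>' i (cmod z)) * (a k * z ^ k) * cnj z ^ l \<partial>lborel)
        = a k * (\<integral>z. complex_of_real (\<rho>' i (cmod z)) * z ^ k * cnj z ^ l \<partial>lborel)"
        by (subst integral_mult_right_zero[symmetric]) (simp add: mult_ac)
      then show ?thesis by (simp add: monomials_orthogonal_nat)
    qed
    ultimately have "(\<lambda>k. if k = l then a l * complex_of_real (\<integral>z. \<rho>' i (cmod z) * cmod z ^ (2 * l) \<partial>lborel) else 0)
        sums (\<integral>z. complex_of_real (\<rho>' i (cmod z)) * E z * cnj z ^ l \<partial>lborel)"
      by (simp only:)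
    from sums_unique2[OF this sums_single] show ?thesis .
  qed
  have 1: "(\<lambda>i. \<integral>z. complex_of_real (\<rho>' i (cmod z)) * E z * cnj z ^ l \<partial>lborel)
     \<longlonglongrightarrow> (\<integral>z. complex_of_real (\<rho> (cmod z)) * E z * cnj z ^ l \<partial>lborel)"
  proof (rule integral_dominated_convergence[OF _ _ integrable_norm[OF int]])
    show "AE z in lborel. (\<lambda>i. complex_of_real (\<rho>' i (cmod z)) * E z * cnj z ^ l)
        \<longlonglongrightarrow> complex_of_real (\<rho> (cmod z)) * E z * cnj z ^ l"
      by (intro AE_I2 tendsto_intros \<rho>'lim)
    show "AE z in lborel. norm (complex_of_real (\<rho>' i (cmod z)) * E z * cnj z ^ l)
        \<le> norm (complex_of_real (\<rho> (cmod z)) * E z * cnj z ^ l)" for i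
      by (intro AE_I2) (auto simp: norm_mult intro!: mult_right_mono \<rho>'le)
    \<comment> \<open>\<open>E\<close> is arbitrary outside the disc and may fail to be measurable.
      Only its product with \<open>\<rho>\<close> is known to be, so the cut-off is written as an
      indicator times that product.\<close>
    have "(\<lambda>z. complex_of_real (\<rho>' i (cmod z)) * E z * cnj z ^ l)
       = (\<lambda>z. indicator (ball 0 (r i)) z * (complex_of_real (\<rho> (cmod z)) * E z * cnj z ^ l))" for i
      by (auto simp: \<rho>'_def indicator_def)
    moreover have [measurable]: "ball (0::complex) (r i) \<in> sets borel" for i by simp
    ultimately show "(\<lambda>z. complex_of_real (\<rho>' i (cmod z)) * E z * cnj z ^ l) \<in> borel_measurable lborel" for i
      by simp
  qed (use int in auto)
  have 2: "(\<lambda>i. \<integral>z. \<rho>' i (cmod z) * cmod z ^ (2 * l) \<partial>lborel)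
     \<longlonglongrightarrow> (\<integral>z. \<rho> (cmod z) * cmod z ^ (2 * l) \<partial>lborel)"
  proof (rule integral_dominated_convergence[where w = "\<lambda>z. \<bar>\<rho> (cmod z)\<bar> * R ^ (2 * l)"])
    show "integrable lborel (\<lambda>z::complex. \<bar>\<rho> (cmod z)\<bar> * R ^ (2 * l))"
      using \<rho> by (intro integrable_mult_left integrable_abs)
    show "AE z in lborel. (\<lambda>i. \<rho>' i (cmod z) * cmod z ^ (2 * l)) \<longlonglongrightarrow> \<rho> (cmod z) * cmod z ^ (2 * l)"
      by (intro AE_I2 tendsto_intros \<rho>'lim)
    show "AE z in lborel. norm (\<rho>' i (cmod z) * cmod z ^ (2 * l)) \<le> \<bar>\<rho> (cmod z)\<bar> * R ^ (2 * l)" for i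
    proof (intro AE_I2)
      fix z :: complex
      show "norm (\<rho>' i (cmod z) * cmod z ^ (2 * l)) \<le> \<bar>\<rho> (cmod z)\<bar> * R ^ (2 * l)"
      proof (cases "cmod z < R")
        case True
        then show ?thesis by (auto simp: abs_mult intro!: mult_mono \<rho>'le power_mono)
      next
        case False
        then show ?thesis by (auto simp: \<rho>'_def supp)
      qed
    qed
  qed auto
  have "(\<lambda>i. a l * complex_of_real (\<integral>z. \<rho>' i (cmod z) * cmod z ^ (2 * l) \<partial>lborel))
     \<longlonglongrightarrow> a l * complex_of_real (\<integral>z. \<rho> (cmod z) * cmod z ^ (2 * l) \<partial>lborel)"
    by (intro tendsto_intros 2)
  with 1 show ?thesis unfolding * a_def[symmetric] by (rule LIMSEQ_unique)
qed

section \<open>The Forelli-Rudin integral on the disc\<close>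

lemma sums_inverse_cube:
  fixes x :: real
  assumes "\<bar>x\<bar> < 1"
  shows "(\<lambda>k. real (Suc k) * real (Suc (Suc k)) * x ^ k) sums (2 / (1 - x) ^ 3)"
proof -
  have s1: "(\<lambda>k. x ^ k) sums (1 / (1 - x))" using assms by (intro geometric_sums) auto
  have s2: "(\<lambda>k. real (Suc k) * x ^ k) sums (1 / (1 - x)\<^sup>2)" using assms by (intro geometric_deriv_sums) auto
  have a1: "summable (\<lambda>k. norm (x ^ k))" using assms by (simp add: power_abs)
  have a2: "summable (\<lambda>k. norm (real (Suc k) * x ^ k))"
    using geometric_deriv_sums[of "\<bar>x\<bar>"] assms by (simp add: abs_mult power_abs sums_iff)
  \<comment> \<open>\<open>1 / (1 - x) ^ 3\<close> is the product of
    \<open>1 / (1 - x)\<^sup>2\<close> and \<open>1 / (1 - x)\<close>; the convolution of their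
    coefficients gives the triangular numbers.\<close>
  have "(\<lambda>k. \<Sum>i\<le>k. (real (Suc i) * x ^ i) * x ^ (k - i)) sums
      ((\<Sum>k. real (Suc k) * x ^ k) * (\<Sum>k. x ^ k))"
    by (rule Cauchy_product_sums[OF a2 a1])
  also have "(\<lambda>k. \<Sum>i\<le>k. (real (Suc i) * x ^ i) * x ^ (k - i))
      = (\<lambda>k. (real (Suc k) * real (Suc (Suc k)) / 2) * x ^ k)"
  proof
    fix k
    have "(\<Sum>i\<le>k. (real (Suc i) * x ^ i) * x ^ (k - i)) = (\<Sum>i\<le>k. real (Suc i)) * x ^ k"
      by (simp add: sum_distrib_right mult.assoc flip: power_add)
    also have "(\<Sum>i\<le>k. real (Suc i)) = real (Suc k) * real (Suc (Suc k)) / 2"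
      by (induction k) (auto simp: field_simps)
    finally show "(\<Sum>i\<le>k. (real (Suc i) * x ^ i) * x ^ (k - i))
      = (real (Suc k) * real (Suc (Suc k)) / 2) * x ^ k" .
  qed
  also have "(\<Sum>k. real (Suc k) * x ^ k) * (\<Sum>k. x ^ k) = 1 / (1 - x)\<^sup>2 * (1 / (1 - x))"
    using s1 s2 by (simp add: sums_iff)
  finally have "(\<lambda>k. 2 * (real (Suc k) * real (Suc (Suc k)) / 2 * x ^ k)) sums (2 * (1 / (1 - x)\<^sup>2 * (1 / (1 - x))))"
    by (rule sums_mult)
  then show ?thesis by (simp add: power3_eq_cube power2_eq_square mult_ac)
qed

lemma one_minus_norm_le:
  fixes x y :: complex
  assumes "cmod x \<le> r" "r < 1"
  shows "1 - r \<le> cmod (1 - x)"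
  using norm_triangle_ineq2[of 1 x] assms by simp

text \<open>By orthogonality the left side is a power series in \<open>|\<mu>|\<^sup>2\<close> with the moments of \<open>\<rho>\<close> times \<open>(l + 1)\<^sup>2\<close>
  as coefficients, the right side the same series with \<open>(l + 1) (l + 2)\<close>.\<close>

lemma integral_inverse_fourth_le:
  fixes \<rho> :: "real \<Rightarrow> real"
  assumes m: "m > 0" and lam: "cmod \<mu> < 1"
    and [measurable]: "\<rho> \<in> borel_measurable borel" and \<rho>: "integrable lborel (\<lambda>z::complex. \<rho> (cmod z))"
    and nonneg: "\<And>r. \<rho> r \<ge> 0" and supp: "\<And>r. r \<ge> 1 \<Longrightarrow> \<rho> r = 0"
  shows "(\<integral>\<^sup>+z. ennreal (\<rho> (cmod z) / cmod (1 - \<mu> * z ^ m) ^ 4) \<partial>lborel)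
    \<le> (\<integral>\<^sup>+z. ennreal (\<rho> (cmod z) * (2 / (1 - (cmod \<mu>)\<^sup>2 * cmod z ^ (2 * m)) ^ 3)) \<partial>lborel)"
proof -
  \<comment> \<open>The inverse fourth power is \<open>G * cnj G\<close>. The two factors are
    expanded one after the other (\<open>inner\<close>, then \<open>outer\<close>), so that each
    time only a single series is interchanged with the integral.\<close>
  define G where "G z = 1 / (1 - \<mu> * z ^ m)\<^sup>2" for z
  have [measurable]: "G \<in> borel_measurable borel" unfolding G_def by measurable
  define M where "M k = (\<integral>z. \<rho> (cmod z) * cmod z ^ (2 * k) \<partial>(lborel::complex measure))" for k
  define D where "D = 1 / (1 - cmod \<mu>)\<^sup>2"
  have D: "D \<ge> 0" by (simp add: D_def)
  have lz: "cmod (\<mu> * z ^ m) < 1" "cmod (\<mu> * z ^ m) \<le> cmod \<mu>" if "cmod z < 1" for z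
  proof -
    have "cmod \<mu> * cmod z ^ m \<le> cmod \<mu> * 1"
      using that by (intro mult_left_mono power_le_one) auto
    then show "cmod (\<mu> * z ^ m) < 1" "cmod (\<mu> * z ^ m) \<le> cmod \<mu>"
      using lam by (auto simp: norm_mult norm_power)
  qed
  have GD: "cmod (G z) \<le> D" if "cmod z < 1" for z
  proof -
    have le: "1 - cmod \<mu> \<le> cmod (1 - \<mu> * z ^ m)" by (rule one_minus_norm_le[OF lz(2)[OF that] lam])
    then have "0 < cmod (1 - \<mu> * z ^ m)" using lam by linarith
    moreover from le have "(1 - cmod \<mu>)\<^sup>2 \<le> (cmod (1 - \<mu> * z ^ m))\<^sup>2" using lam by (intro power_mono) auto
    ultimately show ?thesis using lam unfolding G_def D_def norm_divide norm_power norm_one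
      by (intro divide_left_mono mult_pos_pos zero_less_power) auto
  qed
  have sG: "(\<lambda>k. of_nat (Suc k) * (\<mu> * z ^ m) ^ k) sums G z" if "cmod z < 1" for z
    unfolding G_def using lz(1)[OF that] by (intro geometric_deriv_sums) auto
  have summ1: "summable (\<lambda>k. real (Suc k) * cmod \<mu> ^ k)"
    using geometric_deriv_sums[of "cmod \<mu>"] lam by (simp add: sums_iff)
  have bnd: "cmod (of_nat (Suc k) * (\<mu> * z ^ m) ^ k) \<le> real (Suc k) * cmod \<mu> ^ k" if "cmod z < 1" for k z
    unfolding norm_mult[of "of_nat (Suc k)"] norm_power norm_of_nat
    using lz(2)[OF that] by (intro mult_left_mono power_mono) auto
  have inner: "(\<integral>z. complex_of_real (\<rho> (cmod z)) * G z * cnj (\<mu> * z ^ m) ^ l \<partial>lborel)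
     = of_nat (Suc l) * complex_of_real (((cmod \<mu>)\<^sup>2) ^ l * M (m * l))" for l
  proof -
    have "(\<lambda>k. \<integral>z. complex_of_real (\<rho> (cmod z)) * (of_nat (Suc k) * (\<mu> * z ^ m) ^ k) * cnj (\<mu> * z ^ m) ^ l \<partial>lborel)
       sums (\<integral>z. complex_of_real (\<rho> (cmod z)) * G z * cnj (\<mu> * z ^ m) ^ l \<partial>lborel)"
    proof (rule integral_sums_dominated[THEN conjunct2, OF _ \<rho> _ summ1])
      show "cmod (complex_of_real (\<rho> (cmod z)) * (of_nat (Suc k) * (\<mu> * z ^ m) ^ k) * cnj (\<mu> * z ^ m) ^ l)
          \<le> real (Suc k) * cmod \<mu> ^ k * \<rho> (cmod z)" for k z
      proof (cases "cmod z < 1")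
        case True
        have "cmod (cnj (\<mu> * z ^ m) ^ l) \<le> 1"
          using lz(1)[OF True] unfolding norm_power complex_mod_cnj by (intro power_le_one) auto
        then have "cmod (of_nat (Suc k) * (\<mu> * z ^ m) ^ k) * cmod (cnj (\<mu> * z ^ m) ^ l) \<le> real (Suc k) * cmod \<mu> ^ k * 1"
          using bnd[OF True, of k] by (intro mult_mono) auto
        then have "\<rho> (cmod z) * (cmod (of_nat (Suc k) * (\<mu> * z ^ m) ^ k) * cmod (cnj (\<mu> * z ^ m) ^ l))
           \<le> \<rho> (cmod z) * (real (Suc k) * cmod \<mu> ^ k * 1)"
          using nonneg by (intro mult_left_mono) auto
        then show ?thesis using nonneg[of "cmod z"] by (simp only: norm_mult norm_of_real) (simp add: mult_ac)
      qed (simp add: supp)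
      show "(\<lambda>k. complex_of_real (\<rho> (cmod z)) * (of_nat (Suc k) * (\<mu> * z ^ m) ^ k) * cnj (\<mu> * z ^ m) ^ l)
        sums (complex_of_real (\<rho> (cmod z)) * G z * cnj (\<mu> * z ^ m) ^ l)" for z
      proof (cases "cmod z < 1")
        case True
        then show ?thesis by (intro sums_mult sums_mult2 sG)
      qed (simp add: supp)
    qed measurable
    moreover have "(\<integral>z. complex_of_real (\<rho> (cmod z)) * (of_nat (Suc k) * (\<mu> * z ^ m) ^ k) * cnj (\<mu> * z ^ m) ^ l \<partial>lborel)
       = (if k = l then of_nat (Suc l) * complex_of_real (((cmod \<mu>)\<^sup>2) ^ l * M (m * l)) else 0)" for k
    proof -
      have "(\<integral>z. complex_of_real (\<rho> (cmod z)) * (of_nat (Suc k) * (\<mu> * z ^ m) ^ k) * cnj (\<mu> * z ^ m) ^ l \<partial>lborel)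
        = (\<integral>z. of_nat (Suc k) * \<mu> ^ k * cnj \<mu> ^ l * (complex_of_real (\<rho> (cmod z)) * z ^ (m * k) * cnj z ^ (m * l)) \<partial>lborel)"
        unfolding power_mult[of _ m k] power_mult[of _ m l]
        by (intro Bochner_Integration.integral_cong refl)
          (simp only: power_mult_distrib complex_cnj_mult complex_cnj_power mult_ac)
      also have "\<dots> = of_nat (Suc k) * \<mu> ^ k * cnj \<mu> ^ l * (\<integral>z. complex_of_real (\<rho> (cmod z)) * z ^ (m * k) * cnj z ^ (m * l) \<partial>lborel)"
        by (rule integral_mult_right_zero)
      also have "\<dots> = (if k = l then of_nat (Suc l) * complex_of_real (((cmod \<mu>)\<^sup>2) ^ l * M (m * l)) else 0)"
      proof -
        have "\<mu> ^ l * cnj \<mu> ^ l = complex_of_real (((cmod \<mu>)\<^sup>2) ^ l)"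
          by (simp add: power_mult_distrib[symmetric] flip: complex_norm_square)
        then show ?thesis using m by (subst monomials_orthogonal_nat) (auto simp: M_def mult.assoc)
      qed
      finally show ?thesis .
    qed
    ultimately have "(\<lambda>k. if k = l then of_nat (Suc l) * complex_of_real (((cmod \<mu>)\<^sup>2) ^ l * M (m * l)) else 0)
        sums (\<integral>z. complex_of_real (\<rho> (cmod z)) * G z * cnj (\<mu> * z ^ m) ^ l \<partial>lborel)"
      by (simp only:)
    from sums_unique2[OF this sums_single] show ?thesis .
  qed
  have outer: "integrable lborel (\<lambda>z. complex_of_real (\<rho> (cmod z)) * G z * cnj (G z)) \<and>
      (\<lambda>l. \<integral>z. complex_of_real (\<rho> (cmod z)) * G z * cnj (of_nat (Suc l) * (\<mu> * z ^ m) ^ l) \<partial>lborel)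
       sums (\<integral>z. complex_of_real (\<rho> (cmod z)) * G z * cnj (G z) \<partial>lborel)"
  proof (rule integral_sums_dominated[OF _ _ _ summ1])
    show "integrable lborel (\<lambda>z::complex. \<rho> (cmod z) * D)" using \<rho> by simp
    show "cmod (complex_of_real (\<rho> (cmod z)) * G z * cnj (of_nat (Suc k) * (\<mu> * z ^ m) ^ k))
          \<le> real (Suc k) * cmod \<mu> ^ k * (\<rho> (cmod z) * D)" for k z
    proof (cases "cmod z < 1")
      case True
      have "cmod (G z) * cmod (of_nat (Suc k) * (\<mu> * z ^ m) ^ k) \<le> D * (real (Suc k) * cmod \<mu> ^ k)"
        using bnd[OF True, of k] GD[OF True] D by (intro mult_mono) auto
      then have "\<rho> (cmod z) * (cmod (G z) * cmod (of_nat (Suc k) * (\<mu> * z ^ m) ^ k)) \<le> \<rho> (cmod z) * (D * (real (Suc k) * cmod \<mu> ^ k))"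
        using nonneg by (intro mult_left_mono) auto
      then show ?thesis using nonneg[of "cmod z"]
        by (simp only: norm_mult[of _ "cnj _"] complex_mod_cnj norm_mult[of "complex_of_real _"] norm_of_real) (simp add: mult_ac)
    qed (simp add: supp)
    show "(\<lambda>k. complex_of_real (\<rho> (cmod z)) * G z * cnj (of_nat (Suc k) * (\<mu> * z ^ m) ^ k))
        sums (complex_of_real (\<rho> (cmod z)) * G z * cnj (G z))" for z
    proof (cases "cmod z < 1")
      case True
      then show ?thesis by (intro sums_mult sums_cnj[THEN iffD2] sG)
    qed (simp add: supp)
  qed measurable
  have outer': "(\<integral>z. complex_of_real (\<rho> (cmod z)) * G z * cnj (of_nat (Suc l) * (\<mu> * z ^ m) ^ l) \<partial>lborel)
     = complex_of_real ((real (Suc l))\<^sup>2 * (((cmod \<mu>)\<^sup>2) ^ l * M (m * l)))" for l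
  proof -
    have "(\<integral>z. complex_of_real (\<rho> (cmod z)) * G z * cnj (of_nat (Suc l) * (\<mu> * z ^ m) ^ l) \<partial>lborel)
     = (\<integral>z. of_nat (Suc l) * (complex_of_real (\<rho> (cmod z)) * G z * cnj (\<mu> * z ^ m) ^ l) \<partial>lborel)"
      by (intro Bochner_Integration.integral_cong refl) (simp add: mult_ac del: of_nat_Suc)
    also have "\<dots> = of_nat (Suc l) * (of_nat (Suc l) * complex_of_real (((cmod \<mu>)\<^sup>2) ^ l * M (m * l)))"
      by (simp only: integral_mult_right_zero inner)
    finally show ?thesis by (simp add: power2_eq_square mult_ac del: of_nat_Suc)
  qed
  have GG: "complex_of_real (\<rho> (cmod z)) * G z * cnj (G z) = complex_of_real (\<rho> (cmod z) / cmod (1 - \<mu> * z ^ m) ^ 4)" for z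
  proof -
    have "G z * cnj (G z) = complex_of_real ((cmod (G z))\<^sup>2)" by (rule complex_norm_square[symmetric])
    also have "(cmod (G z))\<^sup>2 = 1 / cmod (1 - \<mu> * z ^ m) ^ 4"
      by (simp add: G_def norm_divide norm_power power_divide flip: power_mult)
    finally show ?thesis by (simp add: mult.assoc)
  qed
  have int1: "integrable lborel (\<lambda>z. \<rho> (cmod z) / cmod (1 - \<mu> * z ^ m) ^ 4)"
    using conjunct1[OF outer] unfolding GG by (simp only: complex_of_real_integrable_eq)
  have L: "(\<lambda>l. (real (Suc l))\<^sup>2 * (((cmod \<mu>)\<^sup>2) ^ l * M (m * l))) sums (\<integral>z. \<rho> (cmod z) / cmod (1 - \<mu> * z ^ m) ^ 4 \<partial>lborel)"
    using conjunct2[OF outer] unfolding outer' GG integral_complex_of_real sums_of_real_iff .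
  define H where "H z = 2 / (1 - (cmod \<mu>)\<^sup>2 * cmod z ^ (2 * m)) ^ 3" for z :: complex
  have l2: "\<bar>(cmod \<mu>)\<^sup>2\<bar> < 1" using lam by (simp add: power_less_one_iff)
  have lz2: "\<bar>(cmod \<mu>)\<^sup>2 * cmod z ^ (2 * m)\<bar> \<le> (cmod \<mu>)\<^sup>2" if "cmod z < 1" for z
    using that by (simp add: abs_mult mult_left_le power_le_one)
  have outer2: "integrable (lborel::complex measure) (\<lambda>z. complex_of_real (\<rho> (cmod z) * H z)) \<and>
      (\<lambda>l. \<integral>z. complex_of_real (\<rho> (cmod z) * (real (Suc l) * real (Suc (Suc l)) * ((cmod \<mu>)\<^sup>2 * cmod z ^ (2 * m)) ^ l)) \<partial>lborel)
       sums (\<integral>z. complex_of_real (\<rho> (cmod z) * H z) \<partial>(lborel::complex measure))"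
  proof (rule integral_sums_dominated[OF _ \<rho> _ sums_summable[OF sums_inverse_cube[OF l2]]])
    show "cmod (complex_of_real (\<rho> (cmod z) * (real (Suc l) * real (Suc (Suc l)) * ((cmod \<mu>)\<^sup>2 * cmod z ^ (2 * m)) ^ l)))
       \<le> real (Suc l) * real (Suc (Suc l)) * ((cmod \<mu>)\<^sup>2) ^ l * \<rho> (cmod z)" for l and z :: complex
    proof (cases "cmod z < 1")
      case True
      have "\<rho> (cmod z) * (real (Suc l) * real (Suc (Suc l)) * ((cmod \<mu>)\<^sup>2 * cmod z ^ (2 * m)) ^ l)
        \<le> \<rho> (cmod z) * (real (Suc l) * real (Suc (Suc l)) * ((cmod \<mu>)\<^sup>2) ^ l)"
        using lz2[OF True] nonneg by (intro mult_left_mono power_mono) auto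
      then show ?thesis using nonneg[of "cmod z"]
        by (simp only: norm_of_real) (simp add: abs_mult mult_ac del: of_nat_Suc)
    qed (simp add: supp)
    show "(\<lambda>l. complex_of_real (\<rho> (cmod z) * (real (Suc l) * real (Suc (Suc l)) * ((cmod \<mu>)\<^sup>2 * cmod z ^ (2 * m)) ^ l)))
        sums complex_of_real (\<rho> (cmod z) * H z)" for z :: complex
    proof (cases "cmod z < 1")
      case True
      have "\<bar>(cmod \<mu>)\<^sup>2 * cmod z ^ (2 * m)\<bar> < 1" using lz2[OF True] l2 by linarith
      from sums_inverse_cube[OF this] show ?thesis
        unfolding H_def sums_of_real_iff by (intro sums_mult) 
    qed (simp add: supp)
  qed measurable
  have R: "(\<lambda>l. real (Suc l) * real (Suc (Suc l)) * (((cmod \<mu>)\<^sup>2) ^ l * M (m * l)))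
     sums (\<integral>z. \<rho> (cmod z) * H z \<partial>(lborel::complex measure))"
  proof -
    have "(\<integral>z. \<rho> (cmod z) * (real (Suc l) * real (Suc (Suc l)) * ((cmod \<mu>)\<^sup>2 * cmod z ^ (2 * m)) ^ l) \<partial>lborel)
      = (\<integral>z. real (Suc l) * real (Suc (Suc l)) * ((cmod \<mu>)\<^sup>2) ^ l * (\<rho> (cmod z) * cmod z ^ (2 * (m * l))) \<partial>(lborel::complex measure))" for l
      by (intro Bochner_Integration.integral_cong refl)
        (simp add: power_mult_distrib mult_ac power_mult[symmetric] del: of_nat_Suc)
    then have "(\<integral>z. \<rho> (cmod z) * (real (Suc l) * real (Suc (Suc l)) * ((cmod \<mu>)\<^sup>2 * cmod z ^ (2 * m)) ^ l) \<partial>(lborel::complex measure))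
      = real (Suc l) * real (Suc (Suc l)) * (((cmod \<mu>)\<^sup>2) ^ l * M (m * l))" for l
      by (simp only: integral_mult_right_zero M_def mult.assoc)
    with conjunct2[OF outer2] show ?thesis
      unfolding integral_complex_of_real sums_of_real_iff by simp
  qed
  have int2: "integrable (lborel::complex measure) (\<lambda>z. \<rho> (cmod z) * H z)"
    using conjunct1[OF outer2] unfolding complex_of_real_integrable_eq .
  have M0: "M k \<ge> 0" for k unfolding M_def by (intro integral_nonneg_AE AE_I2 mult_nonneg_nonneg nonneg) auto
  have "(\<integral>z. \<rho> (cmod z) / cmod (1 - \<mu> * z ^ m) ^ 4 \<partial>lborel) \<le> (\<integral>z. \<rho> (cmod z) * H z \<partial>lborel)"
    using M0 by (intro sums_le[OF _ L R] mult_right_mono mult_nonneg_nonneg) (auto simp: power2_eq_square)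
  moreover have "H z \<ge> 0" if "cmod z < 1" for z
    using lz2[OF that] l2 unfolding H_def by (intro divide_nonneg_nonneg zero_le_power) auto
  then have "\<rho> (cmod z) * H z \<ge> 0" for z using nonneg supp by (cases "cmod z < 1") auto
  ultimately show ?thesis
    using int1 int2 nonneg unfolding H_def[symmetric]
    by (subst (1 2) nn_integral_eq_integral) (auto intro!: ennreal_leI)
qed

text \<open>\<open>integral_inverse_fourth_le\<close> makes the integrand radial, and polar
  coordinates \<open>t = (cmod z)\<^sup>2\<close> lead to \<open>forelli_rudin_real\<close>. The
  remaining powers \<open>t ^ m\<close> are replaced by \<open>t\<close>: in the denominator by
  monotonicity, in the weight by \<open>base\<close>.\<close>

lemma forelli_rudin_disc:
  assumes m: "m > 0" and \<gamma>: "\<gamma> > -1" and \<beta>: "-1 < \<beta>" "\<beta> < 2"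
  obtains C where "C > 0"
    "\<And>\<mu>. cmod \<mu> < 1 \<Longrightarrow>
      (\<integral>\<^sup>+z. ennreal (cmod z powr (2 * \<gamma>) * (1 - cmod z ^ (2 * m)) powr \<beta> / cmod (1 - \<mu> * z ^ m) ^ 4)
          * indicator (ball 0 1) z \<partial>lborel)
        \<le> ennreal (C * (1 - (cmod \<mu>)\<^sup>2) powr (\<beta> - 2))"
proof -
  obtain C where C: "C > 0" and FR: "\<And>x. 0 \<le> x \<Longrightarrow> x < 1 \<Longrightarrow>
      (\<integral>\<^sup>+t. ennreal (t powr \<gamma> * (1 - t) powr \<beta> / (1 - x * t) ^ 3) * indicator {0..<1} t \<partial>lborel)
        \<le> ennreal (C * (1 - x) powr (\<beta> - 2))"
    using forelli_rudin_real[OF \<gamma> \<beta>] by blast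
  define c where "c = max 1 (real m powr \<beta>)"
  have c: "c > 0" by (simp add: c_def)
  define \<rho> where "\<rho> r = (if 0 \<le> r \<and> r < 1 then r powr (2 * \<gamma>) * (1 - r ^ (2 * m)) powr \<beta> else 0)" for r :: real
  have [measurable]: "\<rho> \<in> borel_measurable borel" unfolding \<rho>_def by measurable
  have nonneg: "\<rho> r \<ge> 0" for r by (simp add: \<rho>_def)
  have supp: "\<rho> r = 0" if "r \<ge> 1" for r using that by (simp add: \<rho>_def)
  \<comment> \<open>\<open>1 - t ^ m\<close> lies between \<open>1 - t\<close> and
    \<open>m * (1 - t)\<close>, the upper bound being Bernoulli's inequality. The sign of
    \<open>\<beta>\<close> decides which of the two bounds is used.\<close>
  have base: "(1 - t ^ m) powr \<beta> \<le> c * (1 - t) powr \<beta>" if t: "0 \<le> t" "t < 1" for t :: real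
  proof -
    have tm: "t ^ m \<le> t ^ 1" using t m by (intro power_decreasing) auto
    show ?thesis
    proof (cases "\<beta> \<ge> 0")
      case True
      have "1 + real m * (t - 1) \<le> (1 + (t - 1)) ^ m"
        using t by (intro Bernoulli_inequality) auto
      then have "1 - t ^ m \<le> real m * (1 - t)" by (simp add: algebra_simps)
      moreover have "0 \<le> 1 - t ^ m" using tm t by simp
      ultimately have "(1 - t ^ m) powr \<beta> \<le> (real m * (1 - t)) powr \<beta>"
        using True by (intro powr_mono2) auto
      also have "\<dots> = real m powr \<beta> * (1 - t) powr \<beta>" using t by (intro powr_mult)
      also have "\<dots> \<le> c * (1 - t) powr \<beta>" by (intro mult_right_mono) (auto simp: c_def)
      finally show ?thesis .
    next
      case False
      then have "(1 - t ^ m) powr \<beta> \<le> (1 - t) powr \<beta>" using t tm by (intro powr_mono2') auto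
      also have "\<dots> = 1 * (1 - t) powr \<beta>" by simp
      also have "\<dots> \<le> c * (1 - t) powr \<beta>" by (intro mult_right_mono) (auto simp: c_def)
      finally show ?thesis .
    qed
  qed
  have main: "(\<integral>\<^sup>+z. ennreal (\<rho> (cmod z) * (2 / (1 - x * cmod z ^ (2 * m)) ^ 3)) \<partial>lborel)
      \<le> ennreal (2 * c * pi * C * (1 - x) powr (\<beta> - 2))" if x: "0 \<le> x" "x < 1" for x :: real
  proof -
    have "(\<integral>\<^sup>+z. ennreal (\<rho> (cmod z) * (2 / (1 - x * cmod z ^ (2 * m)) ^ 3)) \<partial>lborel)
      \<le> (\<integral>\<^sup>+z. (\<lambda>t. ennreal (2 * c) * (ennreal (t powr \<gamma> * (1 - t) powr \<beta> / (1 - x * t) ^ 3) * indicator {0..<1} t)) ((cmod z)\<^sup>2) \<partial>lborel)"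
    proof (intro nn_integral_mono)
      fix z :: complex
      show "ennreal (\<rho> (cmod z) * (2 / (1 - x * cmod z ^ (2 * m)) ^ 3))
        \<le> (\<lambda>t. ennreal (2 * c) * (ennreal (t powr \<gamma> * (1 - t) powr \<beta> / (1 - x * t) ^ 3) * indicator {0..<1} t)) ((cmod z)\<^sup>2)"
      proof (cases "cmod z < 1")
        case True
        define t where "t = (cmod z)\<^sup>2"
        have t: "0 \<le> t" "t < 1" using True by (auto simp: t_def power_less_one_iff)
        have t1: "cmod z ^ (2 * m) = t ^ m" by (simp add: t_def power_mult)
        have t2: "cmod z powr (2 * \<gamma>) = t powr \<gamma>"
          by (cases "z = 0") (simp_all add: t_def powr_powr flip: powr_numeral)
        have r: "\<rho> (cmod z) = t powr \<gamma> * (1 - t ^ m) powr \<beta>"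
          using True by (simp add: \<rho>_def t1 t2)
        have "t ^ m \<le> t ^ 1" using t m by (intro power_decreasing) auto
        then have "x * t ^ m \<le> x * t" using x by (intro mult_left_mono) auto
        moreover have "x * t < 1" using x t mult_left_le[of t x] by auto
        ultimately have "2 / (1 - x * t ^ m) ^ 3 \<le> 2 / (1 - x * t) ^ 3"
          by (intro divide_left_mono power_mono mult_pos_pos zero_less_power) auto
        then have "t powr \<gamma> * (1 - t ^ m) powr \<beta> * (2 / (1 - x * t ^ m) ^ 3)
           \<le> t powr \<gamma> * (c * (1 - t) powr \<beta>) * (2 / (1 - x * t) ^ 3)"
          using base[OF t] c \<open>x * t ^ m \<le> x * t\<close> \<open>x * t < 1\<close> by (intro mult_mono) auto
        then have "ennreal (\<rho> (cmod z) * (2 / (1 - x * cmod z ^ (2 * m)) ^ 3))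
           \<le> ennreal (2 * c * (t powr \<gamma> * (1 - t) powr \<beta> / (1 - x * t) ^ 3))"
          unfolding r t1 by (intro ennreal_leI) (simp add: mult_ac)
        also have "\<dots> = ennreal (2 * c) * (ennreal (t powr \<gamma> * (1 - t) powr \<beta> / (1 - x * t) ^ 3) * indicator {0..<1} t)"
          using c t by (simp add: ennreal_mult'[symmetric] del: times_divide_eq_right)
        finally show ?thesis unfolding t_def .
      qed (simp add: supp)
    qed
    also have "\<dots> = ennreal pi * (\<integral>\<^sup>+t. ennreal (2 * c) * (ennreal (t powr \<gamma> * (1 - t) powr \<beta> / (1 - x * t) ^ 3) * indicator {0..<1} t) * indicator {0..} t \<partial>lborel)"
      by (rule nn_integral_radial) measurable
    also have "(\<integral>\<^sup>+t. ennreal (2 * c) * (ennreal (t powr \<gamma> * (1 - t) powr \<beta> / (1 - x * t) ^ 3) * indicator {0..<1} t) * indicator {0..} t \<partial>lborel)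
      = ennreal (2 * c) * (\<integral>\<^sup>+t. ennreal (t powr \<gamma> * (1 - t) powr \<beta> / (1 - x * t) ^ 3) * indicator {0..<1} t \<partial>lborel)"
      by (subst nn_integral_cmult[symmetric]) (auto intro!: nn_integral_cong simp: indicator_def)
    also have "ennreal pi * \<dots> \<le> ennreal pi * (ennreal (2 * c) * ennreal (C * (1 - x) powr (\<beta> - 2)))"
      by (intro mult_left_mono FR x) auto
    also have "\<dots> = ennreal (2 * c * pi * C * (1 - x) powr (\<beta> - 2))"
      using c C by (simp add: mult_ac ennreal_mult)
    finally show ?thesis .
  qed
  have int: "integrable lborel (\<lambda>z::complex. \<rho> (cmod z))"
  proof (rule integrableI_bounded)
    \<comment> \<open>The case \<open>x = 0\<close> of \<open>main\<close> already shows that the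
      weight is integrable.\<close>
    have "(\<integral>\<^sup>+z. ennreal (norm (\<rho> (cmod z))) \<partial>(lborel::complex measure)) \<le> (\<integral>\<^sup>+z. ennreal (\<rho> (cmod z) * (2 / (1 - 0 * cmod z ^ (2 * m)) ^ 3)) \<partial>(lborel::complex measure))"
      using nonneg by (intro nn_integral_mono ennreal_leI) auto
    also have "\<dots> < \<infinity>" by (rule order.strict_trans1[OF main]) auto
    finally show "(\<integral>\<^sup>+z. ennreal (norm (\<rho> (cmod z))) \<partial>(lborel::complex measure)) < \<infinity>" .
  qed measurable
  have "(\<integral>\<^sup>+z. ennreal (cmod z powr (2 * \<gamma>) * (1 - cmod z ^ (2 * m)) powr \<beta> / cmod (1 - \<mu> * z ^ m) ^ 4)
          * indicator (ball 0 1) z \<partial>lborel) \<le> ennreal (2 * c * pi * C * (1 - (cmod \<mu>)\<^sup>2) powr (\<beta> - 2))"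
    if mu: "cmod \<mu> < 1" for \<mu>
  proof -
    have "(\<integral>\<^sup>+z. ennreal (cmod z powr (2 * \<gamma>) * (1 - cmod z ^ (2 * m)) powr \<beta> / cmod (1 - \<mu> * z ^ m) ^ 4)
          * indicator (ball 0 1) z \<partial>lborel) = (\<integral>\<^sup>+z. ennreal (\<rho> (cmod z) / cmod (1 - \<mu> * z ^ m) ^ 4) \<partial>lborel)"
      by (intro nn_integral_cong) (simp add: \<rho>_def indicator_def)
    also have "\<dots> \<le> (\<integral>\<^sup>+z. ennreal (\<rho> (cmod z) * (2 / (1 - (cmod \<mu>)\<^sup>2 * cmod z ^ (2 * m)) ^ 3)) \<partial>lborel)"
      by (rule integral_inverse_fourth_le[OF m mu _ int nonneg supp]) auto
    also have "\<dots> \<le> ennreal (2 * c * pi * C * (1 - (cmod \<mu>)\<^sup>2) powr (\<beta> - 2))"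
      using mu by (intro main) (auto simp: power_less_one_iff)
    finally show ?thesis .
  qed
  moreover have "2 * c * pi * C > 0" using c C by simp
  ultimately show ?thesis using that by blast
qed

section \<open>Weighted Bergman spaces of the punctured disc\<close>

lemma integral_indicator_ball:
  fixes w :: complex
  assumes "R \<ge> 0"
  shows "(\<integral>z. indicator (ball w R) z \<partial>lborel) = pi * R\<^sup>2"
  using assms by (simp add: content_ball unit_ball_vol_2)

text \<open>The moment of degree 0 of \<open>z \<mapsto> F (w + z)\<close> against the indicator of
  a disc is the area mean value property. The closed disc is assumed to lie in \<open>S\<close> so
  that \<open>F\<close> is bounded on it.\<close>

lemma mean_value_ball:
  assumes hol: "F holomorphic_on S" and S: "open S" "cball w R \<subseteq> S" and R: "R > 0"
  shows "ennreal (cmod (F w) * (pi * R\<^sup>2)) \<le> (\<integral>\<^sup>+z. ennreal (cmod (F z)) * indicator (ball w R) z \<partial>lborel)"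
proof -
  define E where "E z = F (w + z)" for z
  define \<rho> where "\<rho> = (indicator {..<R} :: real \<Rightarrow> real)"
  have [measurable]: "\<rho> \<in> borel_measurable borel" unfolding \<rho>_def by measurable
  have \<rho>: "\<rho> (cmod z) = indicator (ball 0 R) z" for z by (simp add: \<rho>_def indicator_def)
  have img: "w + z \<in> S" if "z \<in> cball 0 R" for z
    using that by (intro subsetD[OF S(2)]) (simp add: dist_norm)
  have holE: "E holomorphic_on cball 0 R"
    unfolding E_def
  proof (rule holomorphic_on_compose_gen[OF _ hol, unfolded o_def])
    show "(\<lambda>z. w + z) holomorphic_on cball 0 R" by (intro holomorphic_intros)
    show "(\<lambda>z. w + z) ` cball 0 R \<subseteq> S" using img by blast
  qed
  have "integrable lborel (\<lambda>z. indicator (cball 0 R) z *\<^sub>R E z)"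
    by (intro borel_integrable_compact holomorphic_on_imp_continuous_on[OF holE]) auto
  then have "integrable lborel (\<lambda>z. indicator (ball 0 R) z *\<^sub>R (indicator (cball 0 R) z *\<^sub>R E z))"
    by (rule integrable_mult_indicator[rotated]) simp
  also have "(\<lambda>z. indicator (ball 0 R) z *\<^sub>R (indicator (cball 0 R) z *\<^sub>R E z))
      = (\<lambda>z. complex_of_real (\<rho> (cmod z)) * E z * cnj z ^ 0)"
    by (auto simp: \<rho> indicator_def fun_eq_iff)
  finally have int: "integrable lborel (\<lambda>z. complex_of_real (\<rho> (cmod z)) * E z * cnj z ^ 0)" .
  then have [measurable]: "(\<lambda>z. complex_of_real (\<rho> (cmod z)) * E z * cnj z ^ 0) \<in> borel_measurable borel"
    by (simp add: integrable_iff_bounded)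
  have \<rho>int: "integrable lborel (\<lambda>z::complex. \<rho> (cmod z))"
    unfolding \<rho> by (rule integrable_real_indicator) (use emeasure_lborel_ball_finite in auto)
  have "(\<integral>z. complex_of_real (\<rho> (cmod z)) * E z * cnj z ^ 0 \<partial>lborel)
     = (deriv ^^ 0) E 0 / fact 0 * complex_of_real (\<integral>z. \<rho> (cmod z) * cmod z ^ (2 * 0) \<partial>lborel)"
    using holE ball_subset_cball
    by (intro holomorphic_moment[OF _ R _ \<rho>int _ int]) (auto simp: \<rho>_def intro: holomorphic_on_subset)
  also have "\<dots> = F w * complex_of_real (pi * R\<^sup>2)"
  proof -
    have "(\<integral>z. \<rho> (cmod z) * cmod z ^ (2 * 0) \<partial>(lborel::complex measure)) = pi * R\<^sup>2"
      using integral_indicator_ball[of R 0] R by (simp only: \<rho> mult_0_right power_0 mult_1_right)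
    then show ?thesis by (simp only:) (simp add: E_def)
  qed
  finally have eq: "(\<integral>z. complex_of_real (\<rho> (cmod z)) * E z * cnj z ^ 0 \<partial>lborel) = F w * complex_of_real (pi * R\<^sup>2)" .
  have "ennreal (cmod (F w) * (pi * R\<^sup>2)) = ennreal (norm (\<integral>z. complex_of_real (\<rho> (cmod z)) * E z * cnj z ^ 0 \<partial>lborel))"
    by (simp only: eq norm_mult norm_of_real) simp
  also have "\<dots> \<le> (\<integral>\<^sup>+z. ennreal (norm (complex_of_real (\<rho> (cmod z)) * E z * cnj z ^ 0)) \<partial>lborel)"
    using integral_norm_bound_ennreal[OF int] .
  also have "\<dots> = (\<integral>\<^sup>+z. (\<lambda>z. ennreal (cmod (complex_of_real (\<rho> (cmod (z - w))) * E (z - w) * cnj (z - w) ^ 0))) (w + z) \<partial>lborel)"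
    by simp
  also have "\<dots> = (\<integral>\<^sup>+z. (\<lambda>z. ennreal (cmod (complex_of_real (\<rho> (cmod (z - w))) * E (z - w) * cnj (z - w) ^ 0))) z \<partial>lborel)"
  proof (rule nn_integral_translate)
    have "(\<lambda>z. (\<lambda>z. complex_of_real (\<rho> (cmod z)) * E z * cnj z ^ 0) (z - w)) \<in> borel_measurable borel"
      by (rule measurable_compose[of "\<lambda>z. z - w"]) measurable
    then show "(\<lambda>z. ennreal (cmod (complex_of_real (\<rho> (cmod (z - w))) * E (z - w) * cnj (z - w) ^ 0))) \<in> borel_measurable borel"
      by measurable
  qed
  also have "\<dots> = (\<integral>\<^sup>+z. ennreal (cmod (F z)) * indicator (ball w R) z \<partial>lborel)"
    by (intro nn_integral_cong) (auto simp: \<rho>_def indicator_def E_def dist_norm norm_minus_commute)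
  finally show ?thesis .
qed

text \<open>Dominated convergence along sequences. The centre lies in every ball, and
  \<open>h 0 = 0\<close> gives pointwise convergence there too.\<close>

lemma integral_ball_tendsto_0:
  fixes h :: "complex \<Rightarrow> real"
  assumes h: "integrable lborel h" and h0: "h 0 = 0"
  shows "((\<lambda>w. \<integral>z. indicator (ball 0 (2 * cmod w)) z * h z \<partial>lborel) \<longlongrightarrow> 0) (at 0)"
proof (rule tendsto_at_iff_sequentially[THEN iffD2], intro allI impI, unfold o_def)
  fix X :: "nat \<Rightarrow> complex" assume "\<forall>i. X i \<in> UNIV - {0}" and X: "X \<longlonglongrightarrow> 0"
  have [measurable]: "h \<in> borel_measurable borel" using h by (simp add: integrable_iff_bounded)
  have [measurable]: "ball (0::complex) r \<in> sets borel" for r by simp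
  have "(\<lambda>i. \<integral>z. indicator (ball 0 (2 * cmod (X i))) z * h z \<partial>lborel) \<longlonglongrightarrow> (\<integral>z. 0 \<partial>(lborel::complex measure))"
  proof (rule integral_dominated_convergence[OF _ _ integrable_norm[OF h]])
    show "AE z in lborel. (\<lambda>i. indicator (ball 0 (2 * cmod (X i))) z * h z) \<longlonglongrightarrow> 0"
    proof (rule AE_I2)
      fix z :: complex
      show "(\<lambda>i. indicator (ball 0 (2 * cmod (X i))) z * h z) \<longlonglongrightarrow> 0"
      proof (cases "z = 0")
        case False
        have "(\<lambda>i. 2 * cmod (X i)) \<longlonglongrightarrow> 2 * cmod 0" by (intro tendsto_intros X)
        from order_tendstoD(2)[OF this, of "cmod z"] have "eventually (\<lambda>i. 2 * cmod (X i) < cmod z) sequentially"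
          using False by simp
        then have "eventually (\<lambda>i. indicator (ball 0 (2 * cmod (X i))) z * h z = 0) sequentially"
          by eventually_elim (auto simp: indicator_def)
        then show ?thesis by (rule tendsto_eventually)
      qed (simp add: h0)
    qed
  qed (auto simp: indicator_def)
  then show "(\<lambda>i. \<integral>z. indicator (ball 0 (2 * cmod (X i))) z * h z \<partial>lborel) \<longlonglongrightarrow> 0" by simp
qed

text \<open>Square integrability limits the pole: \<open>\<lfloor>-\<sigma>\<rfloor>\<close> is the
  least integer \<open>b\<close> with \<open>b + \<sigma> > -1\<close>, that is, the least exponent
  of a monomial that is square integrable near 0 for this weight. The mean value estimate on discs
  of radius \<open>cmod w / 2\<close> bounds the growth of \<open>G\<close>, and Riemann's removable
  singularity theorem applies to \<open>g\<close>.\<close>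

lemma punctured_disc_extension:
  fixes G :: "complex \<Rightarrow> complex" and \<sigma> :: real
  assumes hol: "G holomorphic_on ball 0 1 - {0}" and \<sigma>: "\<sigma> \<ge> 0"
    and int: "integrable lborel (\<lambda>z. indicator (ball 0 1) z * (cmod z powr (2 * \<sigma>) * (cmod (G z))\<^sup>2))"
  obtains E where "E holomorphic_on ball 0 1"
    "\<And>z. z \<in> ball 0 1 - {0} \<Longrightarrow> G z = z powi \<lfloor>-\<sigma>\<rfloor> * E z"
proof -
  define \<beta> where "\<beta> = \<lfloor>-\<sigma>\<rfloor>"
  have \<beta>: "of_int \<beta> \<le> -\<sigma>" unfolding \<beta>_def by linarith
  define h where "h z = indicator (ball 0 1) z * (cmod z powr (2 * \<sigma>) * (cmod (G z))\<^sup>2)" for z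
  have h: "integrable lborel h" using int by (simp add: h_def[abs_def])
  have h_nonneg: "h z \<ge> 0" for z by (simp add: h_def)
  define \<Psi> where "\<Psi> w = (\<integral>z. indicator (ball 0 (2 * cmod w)) z * h z \<partial>lborel)" for w :: complex
  \<comment> \<open>Mere boundedness of \<open>\<Psi>\<close> would leave a simple pole of
    \<open>g\<close> possible when \<open>\<sigma>\<close> is an integer; the limit 0 excludes
    it.\<close>
  have \<Psi>: "(\<Psi> \<longlongrightarrow> 0) (at 0)"
    unfolding \<Psi>_def by (rule integral_ball_tendsto_0[OF h]) (simp add: h_def)
  have \<Psi>nn: "(\<integral>\<^sup>+z. indicator (ball 0 (2 * cmod w)) z * ennreal (h z) \<partial>lborel) = ennreal (\<Psi> w)" for w
  proof -
    have "integrable lborel (\<lambda>z. indicator (ball 0 (2 * cmod w)) z *\<^sub>R h z)"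
      by (intro integrable_mult_indicator h) auto
    then have "(\<integral>\<^sup>+z. ennreal (indicator (ball 0 (2 * cmod w)) z * h z) \<partial>lborel) = ennreal (\<Psi> w)"
      unfolding \<Psi>_def by (intro nn_integral_eq_integral) (auto simp: h_nonneg)
    then show ?thesis by (simp add: ennreal_mult' ennreal_indicator h_nonneg)
  qed
  \<comment> \<open>The mean value property of \<open>G\<^sup>2\<close> replaces the Cauchy--Schwarz inequality.\<close>
  have growth: "(cmod (G w))\<^sup>2 * cmod w powr (2 * \<sigma> + 2) \<le> 2 powr (2 * \<sigma> + 2) / pi * \<Psi> w"
    if w: "w \<noteq> 0" "cmod w < 1/2" for w
  proof -
    \<comment> \<open>On the ball of this radius around \<open>w\<close> one has
      \<open>R \<le> cmod z\<close> and \<open>cmod z < 2 * cmod w\<close>. So the weight is at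
      least \<open>R powr (2 * \<sigma>)\<close> there, and the ball lies in the region of
      integration of \<open>\<Psi> w\<close>.\<close>
    define R where "R = cmod w / 2"
    have R: "R > 0" using w by (simp add: R_def)
    have sub: "cball w R \<subseteq> ball 0 1 - {0}"
    proof
      fix z assume "z \<in> cball w R"
      then have "cmod (w - z) \<le> cmod w / 2" by (simp add: R_def dist_norm)
      then show "z \<in> ball 0 1 - {0}"
        using w norm_triangle_ineq2[of z w] norm_triangle_ineq2[of w z] by (auto simp: norm_minus_commute)
    qed
    have "ennreal (R powr (2 * \<sigma>)) * ennreal (cmod ((G w)\<^sup>2) * (pi * R\<^sup>2))
      \<le> ennreal (R powr (2 * \<sigma>)) * (\<integral>\<^sup>+z. ennreal (cmod ((G z)\<^sup>2)) * indicator (ball w R) z \<partial>lborel)"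
      using hol sub R by (intro mult_left_mono mean_value_ball[where S = "ball 0 1 - {0}"] holomorphic_intros) auto
    also have "\<dots> = (\<integral>\<^sup>+z. ennreal (R powr (2 * \<sigma>)) * (ennreal (cmod ((G z)\<^sup>2)) * indicator (ball w R) z) \<partial>lborel)"
    proof (rule nn_integral_cmult[symmetric])
      have "continuous_on (ball w R) G"
        using sub by (intro continuous_on_subset[OF holomorphic_on_imp_continuous_on[OF hol]]) (auto simp: subset_iff)
      then have "(\<lambda>z. indicator (ball w R) z *\<^sub>R G z) \<in> borel_measurable borel"
        by (intro borel_measurable_continuous_on_indicator) auto
      then have "(\<lambda>z. ennreal (cmod ((indicator (ball w R) z *\<^sub>R G z)\<^sup>2))) \<in> borel_measurable lborel" by measurable
      also have "(\<lambda>z. ennreal (cmod ((indicator (ball w R) z *\<^sub>R G z)\<^sup>2))) = (\<lambda>z. ennreal (cmod ((G z)\<^sup>2)) * indicator (ball w R) z)"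
        by (auto simp: indicator_def fun_eq_iff)
      finally show "(\<lambda>z. ennreal (cmod ((G z)\<^sup>2)) * indicator (ball w R) z) \<in> borel_measurable lborel" .
    qed
    also have "\<dots> \<le> (\<integral>\<^sup>+z. indicator (ball 0 (2 * cmod w)) z * ennreal (h z) \<partial>lborel)"
    proof (intro nn_integral_mono)
      fix z :: complex
      show "ennreal (R powr (2 * \<sigma>)) * (ennreal (cmod ((G z)\<^sup>2)) * indicator (ball w R) z)
         \<le> indicator (ball 0 (2 * cmod w)) z * ennreal (h z)"
      proof (cases "z \<in> ball w R")
        case True
        then have "cmod (w - z) < cmod w / 2" by (simp add: R_def dist_norm)
        then have z: "cmod z \<ge> R" "cmod z < 2 * cmod w" "cmod z < 1"
          using w norm_triangle_ineq2[of z w] norm_triangle_ineq2[of w z] by (auto simp: norm_minus_commute R_def)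
        have "R powr (2 * \<sigma>) \<le> cmod z powr (2 * \<sigma>)"
          using z R \<sigma> by (intro powr_mono2) auto
        then have "R powr (2 * \<sigma>) * (cmod (G z))\<^sup>2 \<le> h z"
          using z by (simp add: h_def mult_right_mono)
        then have "ennreal (R powr (2 * \<sigma>) * (cmod (G z))\<^sup>2) \<le> ennreal (h z)" by (rule ennreal_leI)
        then show ?thesis using True z by (simp add: ennreal_mult' norm_power)
      qed simp
    qed
    also have "\<dots> = ennreal (\<Psi> w)" by (rule \<Psi>nn)
    finally have "ennreal (R powr (2 * \<sigma>) * (cmod ((G w)\<^sup>2) * (pi * R\<^sup>2))) \<le> ennreal (\<Psi> w)"
      by (simp add: ennreal_mult')
    moreover have "\<Psi> w \<ge> 0" unfolding \<Psi>_def by (intro integral_nonneg_AE AE_I2) (simp add: h_nonneg)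
    ultimately have "R powr (2 * \<sigma>) * (cmod ((G w)\<^sup>2) * (pi * R\<^sup>2)) \<le> \<Psi> w"
      by (simp add: ennreal_le_iff)
    moreover have "R powr (2 * \<sigma>) * R\<^sup>2 = cmod w powr (2 * \<sigma> + 2) / 2 powr (2 * \<sigma> + 2)"
    proof -
      have "R powr (2 * \<sigma>) * R\<^sup>2 = R powr (2 * \<sigma> + 2)"
        using R by (simp add: powr_add powr_numeral)
      then show ?thesis using w by (simp add: R_def powr_divide)
    qed
    moreover have "R powr (2 * \<sigma>) * (cmod ((G w)\<^sup>2) * (pi * R\<^sup>2)) = (cmod (G w))\<^sup>2 * (R powr (2 * \<sigma>) * R\<^sup>2) * pi"
      by (simp only: norm_power mult_ac)
    ultimately have "(cmod (G w))\<^sup>2 * (cmod w powr (2 * \<sigma> + 2) / 2 powr (2 * \<sigma> + 2)) * pi \<le> \<Psi> w"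
      by (simp only:)
    then show ?thesis by (simp add: field_simps)
  qed
  define g where "g z = G z * z powi (-\<beta>)" for z
  have holg: "g holomorphic_on ball 0 1 - {0}"
    unfolding g_def by (intro holomorphic_intros hol) auto
  have "((\<lambda>w. (cmod (w * g w))\<^sup>2) \<longlongrightarrow> 0) (at 0)"
  proof (rule tendsto_sandwich[OF _ _ tendsto_const])
    have "((\<lambda>w. 2 powr (2 * \<sigma> + 2) / pi * \<Psi> w) \<longlongrightarrow> 2 powr (2 * \<sigma> + 2) / pi * 0) (at 0)"
      by (intro tendsto_intros \<Psi>)
    then show "((\<lambda>w. 2 powr (2 * \<sigma> + 2) / pi * \<Psi> w) \<longlongrightarrow> 0) (at 0)" by simp
    have "eventually (\<lambda>w. w \<noteq> 0 \<and> cmod w < 1/2) (at (0::complex))"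
      unfolding eventually_at by (intro exI[of _ "1/2"]) auto
    then show "eventually (\<lambda>w. (cmod (w * g w))\<^sup>2 \<le> 2 powr (2 * \<sigma> + 2) / pi * \<Psi> w) (at 0)"
    proof eventually_elim
      case (elim w)
      have "cmod (z powi (-\<beta>)) = cmod z powr (- of_int \<beta>)" if "z \<noteq> 0" for z
        using that by (simp add: norm_power_int powr_real_of_int' flip: of_int_minus)
      then have "cmod (w * g w) = cmod (G w) * (cmod w * cmod w powr (- of_int \<beta>))"
        using elim by (simp add: g_def norm_mult mult_ac)
      also have "\<dots> \<le> cmod (G w) * (cmod w * cmod w powr \<sigma>)"
        using \<beta> elim by (intro mult_left_mono powr_mono') auto
      also have "cmod w * cmod w powr \<sigma> = cmod w powr (\<sigma> + 1)" using elim by (simp add: powr_add)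
      finally have "(cmod (w * g w))\<^sup>2 \<le> (cmod (G w) * cmod w powr (\<sigma> + 1))\<^sup>2"
        by (intro power_mono) auto
      also have "\<dots> = (cmod (G w))\<^sup>2 * cmod w powr (2 * \<sigma> + 2)"
        using elim by (simp add: power_mult_distrib powr_powr[symmetric] powr_numeral[symmetric] powr_powr algebra_simps del: powr_numeral)
      also have "\<dots> \<le> 2 powr (2 * \<sigma> + 2) / pi * \<Psi> w" using elim by (intro growth) auto
      finally show ?case .
    qed
  qed auto
  then have "((\<lambda>w. sqrt ((cmod (w * g w))\<^sup>2)) \<longlongrightarrow> sqrt 0) (at 0)"
    by (rule tendsto_real_sqrt)
  then have "((\<lambda>w. cmod (w * g w)) \<longlongrightarrow> 0) (at 0)" by simp
  then have "((\<lambda>w. (w - 0) * g w) \<longlongrightarrow> 0) (at 0)" unfolding tendsto_norm_zero_iff by simp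
  then obtain E where E: "E holomorphic_on ball 0 1" "\<forall>z\<in>ball 0 1 - {0}. E z = g z"
    using holomorphic_on_extend_lim[OF holg] by auto
  have "G z = z powi \<beta> * E z" if "z \<in> ball 0 1 - {0}" for z
    using E(2) that by (simp add: g_def power_int_minus)
  then show ?thesis using that E(1) unfolding \<beta>_def by blast
qed

lemma integral_cmod_powr:
  assumes "\<gamma> > -1" "R \<ge> 0"
  shows "integrable lborel (\<lambda>z::complex. indicator (ball 0 R) z * cmod z powr (2 * \<gamma>))"
    "(\<integral>z. indicator (ball 0 R) z * cmod z powr (2 * \<gamma>) \<partial>(lborel::complex measure)) = pi * R powr (2 * \<gamma> + 2) / (\<gamma> + 1)"
proof -
  have [measurable]: "ball (0::complex) R \<in> sets borel" by simp
  have m: "(\<lambda>z::complex. indicator (ball 0 R) z * cmod z powr (2 * \<gamma>)) \<in> borel_measurable lborel" by measurable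
  have "(\<integral>\<^sup>+z. ennreal (indicator (ball 0 R) z * cmod z powr (2 * \<gamma>)) \<partial>(lborel::complex measure))
      = ennreal (pi * R powr (2 * \<gamma> + 2) / (\<gamma> + 1))"
    using nn_integral_cmod_powr[OF assms] by (simp add: ennreal_mult' ennreal_indicator mult.commute)
  then have "integrable lborel (\<lambda>z::complex. indicator (ball 0 R) z * cmod z powr (2 * \<gamma>)) \<and>
    (\<integral>z. indicator (ball 0 R) z * cmod z powr (2 * \<gamma>) \<partial>(lborel::complex measure)) = pi * R powr (2 * \<gamma> + 2) / (\<gamma> + 1)"
    using assms by (subst (asm) nn_integral_eq_integrable[OF m]) auto
  then show "integrable lborel (\<lambda>z::complex. indicator (ball 0 R) z * cmod z powr (2 * \<gamma>))"
    "(\<integral>z. indicator (ball 0 R) z * cmod z powr (2 * \<gamma>) \<partial>(lborel::complex measure)) = pi * R powr (2 * \<gamma> + 2) / (\<gamma> + 1)"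
    by auto
qed

text \<open>The power of \<open>z\<close> split off from \<open>G\<close> and its conjugate partner
  combine with the weight to a radial weight of half exponent
  \<open>\<beta> + \<sigma> > -1\<close>. It is integrable, which reduces the claim to
  \<open>holomorphic_moment\<close> for \<open>E\<close>.\<close>

lemma punctured_disc_moment:
  fixes G E :: "complex \<Rightarrow> complex" and \<sigma> :: real
  assumes E: "E holomorphic_on ball 0 1" "\<And>z. z \<in> ball 0 1 - {0} \<Longrightarrow> G z = z powi \<lfloor>-\<sigma>\<rfloor> * E z"
    and int: "integrable lborel (\<lambda>z. indicator (ball 0 1) z * (cmod z powr (2 * \<sigma>) * (cmod (G z))\<^sup>2))"
  shows "(\<integral>z. complex_of_real (indicator (ball 0 1) z * cmod z powr (2 * \<sigma>)) * G z * cnj z powi (\<lfloor>-\<sigma>\<rfloor> + int l) \<partial>lborel)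
    = (deriv ^^ l) E 0 / fact l * complex_of_real (pi / (of_int \<lfloor>-\<sigma>\<rfloor> + real l + \<sigma> + 1))"
proof -
  define \<beta> where "\<beta> = \<lfloor>-\<sigma>\<rfloor>"
  have \<beta>: "of_int \<beta> + \<sigma> > -1" unfolding \<beta>_def by linarith
  have [measurable]: "ball (0::complex) 1 \<in> sets borel" by simp
  define \<rho> where "\<rho> r = indicator {..<1} r * r powr (2 * (of_int \<beta> + \<sigma>))" for r :: real
  have [measurable]: "\<rho> \<in> borel_measurable borel" unfolding \<rho>_def by measurable
  have pw: "cmod (z powi k) = cmod z powr of_int k" if "z \<noteq> 0" for z k
    using that by (simp add: norm_power_int powr_real_of_int')
  have eq: "complex_of_real (indicator (ball 0 1) z * cmod z powr (2 * \<sigma>)) * G z * cnj z powi (\<beta> + int l)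
      = complex_of_real (\<rho> (cmod z)) * E z * cnj z ^ l" for z
  proof (cases "z = 0 \<or> cmod z \<ge> 1")
    case False
    then have G: "G z = z powi \<beta> * E z" using E(2)[of z] by (simp add: \<beta>_def)
    have "z powi \<beta> * cnj z powi \<beta> = complex_of_real ((cmod z)\<^sup>2) powi \<beta>"
      by (simp only: power_int_mult_distrib[symmetric] complex_norm_square)
    also have "\<dots> = complex_of_real (((cmod z)\<^sup>2) powi \<beta>)" by (simp only: of_real_power_int)
    also have "((cmod z)\<^sup>2) powi \<beta> = cmod z powr (2 * of_int \<beta>)"
      using False by (simp add: powr_real_of_int'[symmetric] powr_powr flip: powr_numeral)
    finally have zz: "z powi \<beta> * cnj z powi \<beta> = complex_of_real (cmod z powr (2 * of_int \<beta>))" .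
    have "complex_of_real (indicator (ball 0 1) z * cmod z powr (2 * \<sigma>)) * G z * cnj z powi (\<beta> + int l)
       = complex_of_real (cmod z powr (2 * \<sigma>)) * (z powi \<beta> * cnj z powi \<beta>) * E z * cnj z ^ l"
      using False G by (simp add: power_int_add)
    also have "\<dots> = complex_of_real (\<rho> (cmod z)) * E z * cnj z ^ l"
      using False unfolding zz \<rho>_def by (simp add: distrib_left powr_add mult_ac)
    finally show ?thesis .
  qed (auto simp: \<rho>_def)
  have \<rho>ball: "\<rho> (cmod z) = indicator (ball 0 1) z * cmod z powr (2 * (of_int \<beta> + \<sigma>))" for z
    by (simp add: \<rho>_def indicator_def)
  have \<rho>int: "integrable lborel (\<lambda>z::complex. \<rho> (cmod z))"
    unfolding \<rho>ball by (rule integral_cmod_powr) (use \<beta> in auto)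
  have Emeas: "(\<lambda>z. indicator (ball 0 1) z *\<^sub>R E z) \<in> borel_measurable borel"
    by (intro borel_measurable_continuous_on_indicator holomorphic_on_imp_continuous_on E) auto
  have Eeq: "complex_of_real (\<rho> (cmod z)) * E z * cnj z ^ l
      = complex_of_real (\<rho> (cmod z)) * (indicator (ball 0 1) z *\<^sub>R E z) * cnj z ^ l" for z
    by (simp add: \<rho>_def indicator_def)
  have intE: "integrable lborel (\<lambda>z. complex_of_real (\<rho> (cmod z)) * E z * cnj z ^ l)"
  proof (rule Bochner_Integration.integrable_bound)
    show "integrable lborel (\<lambda>z::complex. indicator (ball 0 1) z * (cmod z powr (2 * \<sigma>) * (cmod (G z))\<^sup>2)
        + indicator (ball 0 1) z * cmod z powr (2 * (of_int \<beta> + real l + \<sigma>)))"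
      using \<beta> by (intro Bochner_Integration.integrable_add int integral_cmod_powr(1)) auto
    show "(\<lambda>z. complex_of_real (\<rho> (cmod z)) * E z * cnj z ^ l) \<in> borel_measurable lborel"
      using Emeas unfolding Eeq by measurable
    show "AE z in lborel. norm (complex_of_real (\<rho> (cmod z)) * E z * cnj z ^ l)
       \<le> norm (indicator (ball 0 1) z * (cmod z powr (2 * \<sigma>) * (cmod (G z))\<^sup>2)
        + indicator (ball 0 1) z * cmod z powr (2 * (of_int \<beta> + real l + \<sigma>)))"
    proof (rule AE_I2)
      fix z :: complex
      show "norm (complex_of_real (\<rho> (cmod z)) * E z * cnj z ^ l)
       \<le> norm (indicator (ball 0 1) z * (cmod z powr (2 * \<sigma>) * (cmod (G z))\<^sup>2)
        + indicator (ball 0 1) z * cmod z powr (2 * (of_int \<beta> + real l + \<sigma>)))"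
      proof (cases "z = 0 \<or> cmod z \<ge> 1")
        case True
        then show ?thesis by (auto simp: \<rho>_def)
      next
        case False
        define a where "a = cmod z powr \<sigma> * cmod (G z)"
        define b where "b = cmod z powr (of_int \<beta> + real l + \<sigma>)"
        have "norm (complex_of_real (\<rho> (cmod z)) * E z * cnj z ^ l) = a * b"
        proof -
          define y where "y = complex_of_real (cmod z powr (2 * \<sigma>))"
          have "complex_of_real (indicator (ball 0 1) z * cmod z powr (2 * \<sigma>)) = y"
            using False by (simp add: y_def)
          then have "norm (complex_of_real (\<rho> (cmod z)) * E z * cnj z ^ l)
              = norm y * cmod (G z) * cmod (cnj z powi (\<beta> + int l))"
            unfolding eq[symmetric] by (simp only: norm_mult)
          also have "cmod (cnj z powi (\<beta> + int l)) = cmod z powr (of_int \<beta> + real l)"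
            using False pw[of "cnj z" "\<beta> + int l"] by simp
          also have "norm y = cmod z powr \<sigma> * cmod z powr \<sigma>"
            by (simp add: y_def flip: powr_add)
          finally show ?thesis by (simp only: a_def b_def powr_add mult_ac)
        qed
        \<comment> \<open>Both squares are integrable: the first by hypothesis, the second as a
          power weight. This gives an integrable majorant for the product.\<close>
        also have "\<dots> \<le> a\<^sup>2 + b\<^sup>2"
        proof -
          have "0 \<le> a * b" by (simp add: a_def b_def)
          then show ?thesis using sum_squares_bound[of a b] by linarith
        qed
        also have "a\<^sup>2 = cmod z powr (2 * \<sigma>) * (cmod (G z))\<^sup>2"
          by (simp add: a_def power_mult_distrib power2_eq_square flip: powr_add)
        also have "b\<^sup>2 = cmod z powr (2 * (of_int \<beta> + real l + \<sigma>))"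
          by (simp add: b_def power2_eq_square algebra_simps flip: powr_add)
        finally show ?thesis using False by simp
      qed
    qed
  qed
  have "(\<integral>z. \<rho> (cmod z) * cmod z ^ (2 * l) \<partial>(lborel::complex measure))
     = (\<integral>z. indicator (ball 0 1) z * cmod z powr (2 * (of_int \<beta> + real l + \<sigma>)) \<partial>(lborel::complex measure))"
  proof (intro Bochner_Integration.integral_cong refl)
    fix z :: complex
    show "\<rho> (cmod z) * cmod z ^ (2 * l) = indicator (ball 0 1) z * cmod z powr (2 * (of_int \<beta> + real l + \<sigma>))"
    proof (cases "z = 0")
      case False
      then have "cmod z ^ (2 * l) = cmod z powr (2 * real l)"
        by (simp flip: powr_realpow)
      then show ?thesis by (simp add: \<rho>ball distrib_left powr_add mult_ac)
    qed (simp add: \<rho>_def)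
  qed
  also have "\<dots> = pi * 1 powr (2 * (of_int \<beta> + real l + \<sigma>) + 2) / (of_int \<beta> + real l + \<sigma> + 1)"
    using \<beta> by (intro integral_cmod_powr(2)) auto
  finally have val: "(\<integral>z. \<rho> (cmod z) * cmod z ^ (2 * l) \<partial>(lborel::complex measure)) = pi / (of_int \<beta> + real l + \<sigma> + 1)"
    by simp
  have "(\<integral>z. complex_of_real (\<rho> (cmod z)) * E z * cnj z ^ l \<partial>lborel)
     = (deriv ^^ l) E 0 / fact l * complex_of_real (\<integral>z. \<rho> (cmod z) * cmod z ^ (2 * l) \<partial>lborel)"
    by (rule holomorphic_moment[OF E(1) _ _ \<rho>int _ intE]) (auto simp: \<rho>_def)
  then show ?thesis unfolding \<beta>_def[symmetric] eq val .
qed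

section \<open>Slices of functions of two variables and their Taylor coefficients\<close>

lemma holomorphic2_on_imp_continuous_on:
  "holomorphic2_on f S \<Longrightarrow> continuous_on S f"
  unfolding holomorphic2_on_def continuous_on_eq_continuous_within
  by (meson has_derivative_continuous)

lemma holomorphic2_on_slices:
  assumes hol: "holomorphic2_on f S" and S: "open S"
  shows "(\<lambda>x. f (x, w)) holomorphic_on {x. (x, w) \<in> S}"
    and "(\<lambda>y. f (x, y)) holomorphic_on {y. (x, y) \<in> S}"
proof -
  have D: "\<exists>a b. (f has_derivative (\<lambda>(h, k). a * h + b * k)) (at z)" if "z \<in> S" for z
    using hol that S unfolding holomorphic2_on_def by (metis at_within_open)
  show "(\<lambda>x. f (x, w)) holomorphic_on {x. (x, w) \<in> S}"
  proof (unfold holomorphic_on_def, intro ballI)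
    fix x assume "x \<in> {x. (x, w) \<in> S}"
    then obtain a b where ab: "(f has_derivative (\<lambda>(h, k). a * h + b * k)) (at (x, w))" using D by blast
    have "((\<lambda>x. (x, w)) has_derivative (\<lambda>h. (h, 0))) (at x)"
      by (auto intro!: derivative_eq_intros)
    from diff_chain_at[OF this ab] have "((\<lambda>x. f (x, w)) has_derivative (*) a) (at x)"
      by (simp add: o_def)
    then show "(\<lambda>x. f (x, w)) field_differentiable at x within {x. (x, w) \<in> S}"
      unfolding field_differentiable_def has_field_derivative_def
      by (blast intro: has_derivative_at_withinI)
  qed
  show "(\<lambda>y. f (x, y)) holomorphic_on {y. (x, y) \<in> S}"
  proof (unfold holomorphic_on_def, intro ballI)
    fix y assume "y \<in> {y. (x, y) \<in> S}"
    then obtain a b where ab: "(f has_derivative (\<lambda>(h, k). a * h + b * k)) (at (x, y))" using D by blast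
    have "((\<lambda>y. (x, y)) has_derivative (\<lambda>h. (0, h))) (at y)"
      by (auto intro!: derivative_eq_intros)
    from diff_chain_at[OF this ab] have "((\<lambda>y. f (x, y)) has_derivative (*) b) (at y)"
      by (simp add: o_def)
    then show "(\<lambda>y. f (x, y)) field_differentiable at y within {y. (x, y) \<in> S}"
      unfolding field_differentiable_def has_field_derivative_def
      by (blast intro: has_derivative_at_withinI)
  qed
qed

text \<open>Under Cauchy's estimates the tail is dominated by a geometric series of ratio 1/2. The
  error depends on the coefficients only through \<open>M\<close> and \<open>\<epsilon>\<close>,
  which makes the limit in \<open>slice_coeff_holomorphic\<close> uniform.\<close>

lemma power_series_truncation:
  fixes c :: "nat \<Rightarrow> complex"
  assumes c: "\<And>i. cmod (c i) \<le> M / \<epsilon> ^ i" and \<epsilon>: "\<epsilon> > 0" and x: "x \<noteq> 0" "cmod x \<le> \<epsilon> / 2"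
    and s: "(\<lambda>i. c i * x ^ i) sums s"
  shows "cmod ((s - (\<Sum>i<a. c i * x ^ i)) / x ^ a - c a) \<le> 2 * M / \<epsilon> ^ Suc a * cmod x"
proof -
  have M: "M \<ge> 0" using order.trans[OF norm_ge_zero c[of 0]] by simp
  have "(\<lambda>i. c (i + Suc a) * x ^ (i + Suc a)) sums (s - (\<Sum>i<Suc a. c i * x ^ i))"
    using s by (rule sums_split_initial_segment)
  then have "(\<lambda>i. c (i + Suc a) * x ^ (i + Suc a) / x ^ a) sums ((s - (\<Sum>i<Suc a. c i * x ^ i)) / x ^ a)"
    by (rule sums_divide)
  also have "(\<lambda>i. c (i + Suc a) * x ^ (i + Suc a) / x ^ a) = (\<lambda>i. c (i + Suc a) * x ^ Suc i)"
    using x by (simp add: power_add fun_eq_iff field_simps)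
  also have "(s - (\<Sum>i<Suc a. c i * x ^ i)) / x ^ a = (s - (\<Sum>i<a. c i * x ^ i)) / x ^ a - c a"
    using x by (simp add: field_simps)
  finally have S: "(\<lambda>i. c (i + Suc a) * x ^ Suc i) sums ((s - (\<Sum>i<a. c i * x ^ i)) / x ^ a - c a)" .
  have G: "(\<lambda>i. M / \<epsilon> ^ Suc a * cmod x * (1/2) ^ i) sums (M / \<epsilon> ^ Suc a * cmod x * (1 / (1 - 1/2)))"
    by (intro sums_mult geometric_sums) auto
  have bnd: "norm (c (i + Suc a) * x ^ Suc i) \<le> M / \<epsilon> ^ Suc a * cmod x * (1/2) ^ i" for i
  proof -
    have "norm (c (i + Suc a) * x ^ Suc i) = cmod (c (i + Suc a)) * (cmod x * cmod x ^ i)"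
      by (simp add: norm_mult norm_power)
    also have "\<dots> \<le> M / \<epsilon> ^ (i + Suc a) * (cmod x * (\<epsilon> / 2) ^ i)"
      using x \<epsilon> M by (intro mult_mono c power_mono mult_left_mono) auto
    also have "\<dots> = M / \<epsilon> ^ Suc a * cmod x * (1/2) ^ i"
      using \<epsilon> by (simp add: power_add power_divide field_simps)
    finally show ?thesis .
  qed
  have "cmod ((s - (\<Sum>i<a. c i * x ^ i)) / x ^ a - c a) = norm (\<Sum>i. c (i + Suc a) * x ^ Suc i)"
    using S by (simp add: sums_iff)
  also have "\<dots> \<le> (\<Sum>i. M / \<epsilon> ^ Suc a * cmod x * (1/2) ^ i)"
    using bnd by (intro norm_suminf_le sums_summable[OF G]) 
  also have "\<dots> = 2 * M / \<epsilon> ^ Suc a * cmod x"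
    using G by (simp add: sums_iff)
  finally show ?thesis .
qed

definition slice_coeff :: "(complex \<times> complex \<Rightarrow> complex) \<Rightarrow> nat \<Rightarrow> complex \<Rightarrow> complex" where
  "slice_coeff f a w = (deriv ^^ a) (\<lambda>x. f (x, w)) 0 / fact a"

text \<open>By induction on \<open>a\<close>, the coefficient is the uniform limit, as \<open>x\<close> tends to
  \<open>0\<close>, of the remainders \<open>(f (x, w) - (\<Sum>i<a. slice_coeff f i w * x ^ i)) / x ^ a\<close>, which are holomorphic in \<open>w\<close>.\<close>

lemma slice_coeff_holomorphic:
  assumes hol: "holomorphic2_on f S" and S: "open S" and U: "open U" "\<And>w. w \<in> U \<Longrightarrow> (0, w) \<in> S"
  shows "slice_coeff f a holomorphic_on U"
proof (rule holomorphic_on_open[OF U(1), THEN iffD2], intro ballI)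
  fix w0 assume "w0 \<in> U"
  then have "(0, w0) \<in> S" by (rule U(2))
  then obtain A B where AB: "open A" "open B" "(0, w0) \<in> A \<times> B" "A \<times> B \<subseteq> S"
    using S unfolding open_prod_def by metis
  from AB obtain \<epsilon> where \<epsilon>: "\<epsilon> > 0" "cball 0 \<epsilon> \<subseteq> A" by (auto simp: open_contains_cball)
  from AB obtain \<delta> where \<delta>: "\<delta> > 0" "cball w0 \<delta> \<subseteq> B" by (auto simp: open_contains_cball)
  have sub: "cball 0 \<epsilon> \<times> cball w0 \<delta> \<subseteq> S" using \<epsilon> \<delta> AB by auto
  have "compact (f ` (cball 0 \<epsilon> \<times> cball w0 \<delta>))"
    by (intro compact_continuous_image compact_Times
        continuous_on_subset[OF holomorphic2_on_imp_continuous_on[OF hol] sub]) auto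
  then obtain M where M: "\<And>x w. x \<in> cball 0 \<epsilon> \<Longrightarrow> w \<in> cball w0 \<delta> \<Longrightarrow> cmod (f (x, w)) \<le> M"
  proof -
    assume *: "\<And>M. (\<And>x w. x \<in> cball 0 \<epsilon> \<Longrightarrow> w \<in> cball w0 \<delta> \<Longrightarrow> cmod (f (x, w)) \<le> M) \<Longrightarrow> thesis"
    from \<open>compact (f ` (cball 0 \<epsilon> \<times> cball w0 \<delta>))\<close>
    obtain M where "\<forall>y\<in>f ` (cball 0 \<epsilon> \<times> cball w0 \<delta>). norm y \<le> M"
      using compact_imp_bounded bounded_iff by blast
    then show thesis by (intro *[of M]) auto
  qed
  have slice: "(\<lambda>x. f (x, w)) holomorphic_on cball 0 \<epsilon>" if "w \<in> ball w0 \<delta>" for w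
    using sub that by (intro holomorphic_on_subset[OF holomorphic2_on_slices(1)[OF hol S]]) auto
  have bound: "cmod (slice_coeff f i w) \<le> M / \<epsilon> ^ i" if "w \<in> ball w0 \<delta>" for i w
  proof -
    have "cmod ((deriv ^^ i) (\<lambda>x. f (x, w)) 0) \<le> fact i * M / \<epsilon> ^ i"
      using slice[OF that] that \<epsilon>(1)
      by (intro Cauchy_inequality holomorphic_on_imp_continuous_on M)
        (auto intro: holomorphic_on_subset)
    then show ?thesis by (simp add: slice_coeff_def norm_divide field_simps)
  qed
  have sums: "(\<lambda>i. slice_coeff f i w * x ^ i) sums f (x, w)" if "w \<in> ball w0 \<delta>" "cmod x < \<epsilon>" for x w
    using holomorphic_power_series[OF holomorphic_on_subset[OF slice[OF that(1)] ball_subset_cball], of x] that(2)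
    by (simp add: slice_coeff_def)
  \<comment> \<open>Nonzero sample points tending to 0. The factor 2 keeps them in the range
    \<open>cmod x \<le> \<epsilon> / 2\<close> of \<open>power_series_truncation\<close>.\<close>
  define x where "x N = complex_of_real (\<epsilon> / (2 * real (Suc N)))" for N
  have x: "x N \<noteq> 0" "cmod (x N) = \<epsilon> / (2 * real (Suc N))" "cmod (x N) \<le> \<epsilon> / 2" "cmod (x N) < \<epsilon>" for N
  proof -
    show x0: "x N \<noteq> 0" unfolding x_def of_real_eq_0_iff using \<epsilon> by simp
    show x1: "cmod (x N) = \<epsilon> / (2 * real (Suc N))"
      unfolding x_def norm_of_real using \<epsilon> by simp
    show x2: "cmod (x N) \<le> \<epsilon> / 2" unfolding x1 using \<epsilon> by (intro divide_left_mono) auto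
    show "cmod (x N) < \<epsilon>" using x2 \<epsilon> by linarith
  qed
  have main: "slice_coeff f a holomorphic_on ball w0 \<delta>" for a
  proof (induction a rule: less_induct)
    case (less a)
    define F where "F N w = (f (x N, w) - (\<Sum>i<a. slice_coeff f i w * x N ^ i)) / x N ^ a" for N w
    show ?case
    proof (rule holomorphic_uniform_sequence[where f = F])
      show "F N holomorphic_on ball w0 \<delta>" for N
      proof -
        have "(\<lambda>w. f (x N, w)) holomorphic_on ball w0 \<delta>"
          using sub x(4)[of N]
          by (intro holomorphic_on_subset[OF holomorphic2_on_slices(2)[OF hol S]]) (auto simp: subset_iff)
        then show ?thesis unfolding F_def using less x(1)[of N] by (intro holomorphic_intros) auto
      qed
      fix w assume "w \<in> ball w0 \<delta>"
      then obtain d where d: "d > 0" "cball w d \<subseteq> ball w0 \<delta>"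
        using open_contains_cball open_ball by metis
      have "uniform_limit (cball w d) F (slice_coeff f a) sequentially"
      proof (rule uniform_limitI)
        fix e :: real assume e: "e > 0"
        have "(\<lambda>N. 2 * M / \<epsilon> ^ Suc a * (\<epsilon> / 2 * (1 / real (Suc N)))) \<longlonglongrightarrow> 2 * M / \<epsilon> ^ Suc a * (\<epsilon> / 2 * 0)"
          by (intro tendsto_intros LIMSEQ_Suc[OF lim_1_over_n])
        from order_tendstoD(2)[OF this, of e]
        have "eventually (\<lambda>N. 2 * M / \<epsilon> ^ Suc a * (\<epsilon> / 2 * (1 / real (Suc N))) < e) sequentially"
          using e by simp
        then show "eventually (\<lambda>N. \<forall>v\<in>cball w d. dist (F N v) (slice_coeff f a v) < e) sequentially"
        proof eventually_elim
          case (elim N)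
          show ?case
          proof
            fix v assume "v \<in> cball w d"
            then have v: "v \<in> ball w0 \<delta>" using d by blast
            have "dist (F N v) (slice_coeff f a v) \<le> 2 * M / \<epsilon> ^ Suc a * cmod (x N)"
              unfolding dist_norm F_def
              by (rule power_series_truncation[OF bound[OF v] \<epsilon>(1) x(1) x(3) sums[OF v x(4)]])
            also have "cmod (x N) = \<epsilon> / 2 * (1 / real (Suc N))"
              unfolding x(2) by simp
            finally show "dist (F N v) (slice_coeff f a v) < e" using elim by linarith
          qed
        qed
      qed
      then show "\<exists>d>0. cball w d \<subseteq> ball w0 \<delta> \<and> uniform_limit (cball w d) F (slice_coeff f a) sequentially"
        using d by blast
    qed auto
  qed
  show "\<exists>f'. (slice_coeff f a has_field_derivative f') (at w0)"
    using main[of a] \<delta>(1) holomorphic_on_open[OF open_ball] by (metis centre_in_ball)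
qed

section \<open>Total holomorphy on \<open>\<complex>\<^sup>2\<close>\<close>

lemma borel_measurable_fst_complex [measurable]: "(fst :: complex \<times> complex \<Rightarrow> complex) \<in> borel_measurable borel"
  by (intro borel_measurable_continuous_onI continuous_intros)

lemma borel_measurable_snd_complex [measurable]: "(snd :: complex \<times> complex \<Rightarrow> complex) \<in> borel_measurable borel"
  by (intro borel_measurable_continuous_onI continuous_intros)

lemma holomorphic2_onI:
  assumes "\<And>z. z \<in> S \<Longrightarrow> \<exists>a b. (f has_derivative (\<lambda>h. a * fst h + b * snd h)) (at z within S)"
  shows "holomorphic2_on f S"
  using assms unfolding holomorphic2_on_def case_prod_unfold by blast

lemma holomorphic2_onD:
  assumes "holomorphic2_on f S" "z \<in> S"
  obtains a b where "(f has_derivative (\<lambda>h. a * fst h + b * snd h)) (at z within S)"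
  using assms unfolding holomorphic2_on_def case_prod_unfold by blast

lemma holomorphic2_on_const [intro]: "holomorphic2_on (\<lambda>z. c) S"
  by (intro holomorphic2_onI exI[of _ 0]) (auto intro!: derivative_eq_intros)

lemma holomorphic2_on_fst [intro]: "holomorphic2_on fst S"
  by (intro holomorphic2_onI exI[of _ 1] exI[of _ 0]) (auto intro!: derivative_eq_intros)

lemma holomorphic2_on_snd [intro]: "holomorphic2_on snd S"
  by (intro holomorphic2_onI exI[of _ 0] exI[of _ 1]) (auto intro!: derivative_eq_intros)

lemma holomorphic2_on_add [intro]:
  assumes "holomorphic2_on f S" "holomorphic2_on g S"
  shows "holomorphic2_on (\<lambda>z. f z + g z) S"
proof (rule holomorphic2_onI)
  fix z assume z: "z \<in> S"
  obtain a b where Df: "(f has_derivative (\<lambda>h. a * fst h + b * snd h)) (at z within S)"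
    by (rule holomorphic2_onD[OF assms(1) z])
  obtain c d where Dg: "(g has_derivative (\<lambda>h. c * fst h + d * snd h)) (at z within S)"
    by (rule holomorphic2_onD[OF assms(2) z])
  have "((\<lambda>z. f z + g z) has_derivative (\<lambda>h. (a + c) * fst h + (b + d) * snd h)) (at z within S)"
    using has_derivative_add[OF Df Dg] by (simp add: algebra_simps)
  then show "\<exists>a b. ((\<lambda>z. f z + g z) has_derivative (\<lambda>h. a * fst h + b * snd h)) (at z within S)" by blast
qed

lemma holomorphic2_on_mult [intro]:
  assumes "holomorphic2_on f S" "holomorphic2_on g S"
  shows "holomorphic2_on (\<lambda>z. f z * g z) S"
proof (rule holomorphic2_onI)
  fix z assume z: "z \<in> S"
  obtain a b where Df: "(f has_derivative (\<lambda>h. a * fst h + b * snd h)) (at z within S)"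
    by (rule holomorphic2_onD[OF assms(1) z])
  obtain c d where Dg: "(g has_derivative (\<lambda>h. c * fst h + d * snd h)) (at z within S)"
    by (rule holomorphic2_onD[OF assms(2) z])
  have "((\<lambda>z. f z * g z) has_derivative (\<lambda>h. (f z * c + a * g z) * fst h + (f z * d + b * g z) * snd h)) (at z within S)"
    using has_derivative_mult[OF Df Dg] by (simp add: algebra_simps)
  then show "\<exists>a b. ((\<lambda>z. f z * g z) has_derivative (\<lambda>h. a * fst h + b * snd h)) (at z within S)" by blast
qed

lemma holomorphic2_on_compose:
  assumes f: "holomorphic2_on f S" and \<phi>: "\<phi> holomorphic_on T" "open T" "\<And>z. z \<in> S \<Longrightarrow> f z \<in> T"
  shows "holomorphic2_on (\<lambda>z. \<phi> (f z)) S"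
proof (rule holomorphic2_onI)
  fix z assume z: "z \<in> S"
  obtain a b where D: "(f has_derivative (\<lambda>h. a * fst h + b * snd h)) (at z within S)"
    by (rule holomorphic2_onD[OF f z])
  obtain c where "(\<phi> has_field_derivative c) (at (f z))"
    using \<phi> z holomorphic_on_open by blast
  then have "(\<phi> has_derivative (*) c) (at (f z))" by (simp add: has_field_derivative_def)
  from has_derivative_compose[OF D this]
  have "((\<lambda>z. \<phi> (f z)) has_derivative (\<lambda>h. (c * a) * fst h + (c * b) * snd h)) (at z within S)"
    by (simp add: algebra_simps)
  then show "\<exists>a b. ((\<lambda>z. \<phi> (f z)) has_derivative (\<lambda>h. a * fst h + b * snd h)) (at z within S)" by blast
qed

lemma holomorphic2_on_sum:
  "(\<And>j. j \<in> J \<Longrightarrow> holomorphic2_on (f j) S) \<Longrightarrow> holomorphic2_on (\<lambda>z. \<Sum>j\<in>J. f j z) S"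
  by (induction J rule: infinite_finite_induct) auto

lemma holomorphic2_on_cong:
  assumes "\<And>z. z \<in> S \<Longrightarrow> f z = g z" "holomorphic2_on f S"
  shows "holomorphic2_on g S"
proof (rule holomorphic2_onI)
  fix z assume z: "z \<in> S"
  obtain a b where "(f has_derivative (\<lambda>h. a * fst h + b * snd h)) (at z within S)"
    by (rule holomorphic2_onD[OF assms(2) z])
  then have "(g has_derivative (\<lambda>h. a * fst h + b * snd h)) (at z within S)"
    by (rule has_derivative_transform[OF z, rotated]) (simp add: assms(1))
  then show "\<exists>a b. (g has_derivative (\<lambda>h. a * fst h + b * snd h)) (at z within S)" by blast
qed

text \<open>The second claim is Bessel's inequality for a single monomial: the integral of
  \<open>(cmod (F z - c * z ^ a))\<^sup>2\<close> over the disc is nonnegative, and with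
  \<open>c\<close> the Taylor coefficient the cross term is known from the first claim.\<close>

lemma disc_coeff:
  fixes F :: "complex \<Rightarrow> complex"
  assumes hol: "F holomorphic_on ball 0 r" and r: "r > 0"
    and int: "integrable lborel (\<lambda>z. indicator (ball 0 r) z * (cmod (F z))\<^sup>2)"
  shows "(\<integral>z. indicator (ball 0 r) z * F z * cnj z ^ a \<partial>lborel)
      = (deriv ^^ a) F 0 / fact a * complex_of_real (pi * r ^ (2 * a + 2) / (real a + 1))" (is ?A)
    and "(cmod ((deriv ^^ a) F 0 / fact a))\<^sup>2 * (pi * r ^ (2 * a + 2) / (real a + 1))
      \<le> (\<integral>z. indicator (ball 0 r) z * (cmod (F z))\<^sup>2 \<partial>lborel)" (is ?B)
proof -
  define c where "c = (deriv ^^ a) F 0 / fact a"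
  define N where "N = pi * r ^ (2 * a + 2) / (real a + 1)"
  have [measurable]: "ball (0::complex) r \<in> sets borel" by simp
  define \<rho> where "\<rho> = (indicator {..<r} :: real \<Rightarrow> real)"
  have [measurable]: "\<rho> \<in> borel_measurable borel" unfolding \<rho>_def by measurable
  have \<rho>: "\<rho> (cmod z) = indicator (ball 0 r) z" for z by (simp add: \<rho>_def indicator_def)
  have \<rho>int: "integrable lborel (\<lambda>z::complex. \<rho> (cmod z))"
    unfolding \<rho> by (rule integrable_real_indicator) (use emeasure_lborel_ball_finite in auto)
  \<comment> \<open>The point 0 is excluded because \<open>0 powr 0 = 0\<close> while
    \<open>0 ^ 0 = 1\<close>.\<close>
  have pw: "\<rho> (cmod z) * cmod z ^ (2 * a) = indicator (ball 0 r) z * cmod z powr (2 * real a)" if "z \<noteq> 0" for z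
    using that by (simp add: \<rho> flip: powr_realpow)
  have AE0: "AE z in lborel. z \<noteq> (0::complex)" by (rule AE_lborel_singleton)
  have Nint: "integrable lborel (\<lambda>z::complex. \<rho> (cmod z) * cmod z ^ (2 * a))"
  proof (rule integrable_cong_AE_imp[OF integral_cmod_powr(1)[of "real a" r]])
    show "AE z in lborel. indicator (ball 0 r) z * cmod z powr (2 * real a) = \<rho> (cmod z) * cmod z ^ (2 * a)"
      using AE0 by eventually_elim (simp add: pw)
  qed (use r in auto)
  have Nval: "(\<integral>z. \<rho> (cmod z) * cmod z ^ (2 * a) \<partial>(lborel::complex measure)) = N"
  proof -
    have "(\<integral>z. \<rho> (cmod z) * cmod z ^ (2 * a) \<partial>(lborel::complex measure))
        = (\<integral>z. indicator (ball 0 r) z * cmod z powr (2 * real a) \<partial>(lborel::complex measure))"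
      using AE0 by (intro integral_cong_AE) (auto elim!: eventually_mono simp: pw)
    also have "\<dots> = pi * r powr (2 * real a + 2) / (real a + 1)" using r by (intro integral_cmod_powr) auto
    also have "r powr (2 * real a + 2) = r ^ (2 * a + 2)"
      using powr_realpow[OF r, of "2 * a + 2"] by (simp add: add.commute)
    finally show ?thesis by (simp add: N_def)
  qed
  have Fmeas: "(\<lambda>z. indicator (ball 0 r) z *\<^sub>R F z) \<in> borel_measurable borel"
    by (intro borel_measurable_continuous_on_indicator holomorphic_on_imp_continuous_on hol) auto
  have eq: "indicator (ball 0 r) z * F z * cnj z ^ a = complex_of_real (\<rho> (cmod z)) * F z * cnj z ^ a" for z
    by (simp add: \<rho> indicator_def)
  have eq2: "complex_of_real (\<rho> (cmod z)) * F z * cnj z ^ a = (indicator (ball 0 r) z *\<^sub>R F z) * cnj z ^ a" for z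
    by (simp add: \<rho> indicator_def)
  have Fint: "integrable lborel (\<lambda>z. complex_of_real (\<rho> (cmod z)) * F z * cnj z ^ a)"
  proof (rule Bochner_Integration.integrable_bound[OF Bochner_Integration.integrable_add[OF int Nint]])
    show "(\<lambda>z. complex_of_real (\<rho> (cmod z)) * F z * cnj z ^ a) \<in> borel_measurable lborel"
      unfolding eq2 using Fmeas by measurable
    show "AE z in lborel. norm (complex_of_real (\<rho> (cmod z)) * F z * cnj z ^ a)
      \<le> norm (indicator (ball 0 r) z * (cmod (F z))\<^sup>2 + \<rho> (cmod z) * cmod z ^ (2 * a))"
    proof (rule AE_I2)
      fix z :: complex
      have "cmod (F z) * cmod z ^ a \<le> (cmod (F z))\<^sup>2 + (cmod z ^ a)\<^sup>2"
        using sum_squares_bound[of "cmod (F z)" "cmod z ^ a"] mult_nonneg_nonneg[OF norm_ge_zero[of "F z"] zero_le_power[OF norm_ge_zero[of z], of a]]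
        by linarith
      then show "norm (complex_of_real (\<rho> (cmod z)) * F z * cnj z ^ a)
      \<le> norm (indicator (ball 0 r) z * (cmod (F z))\<^sup>2 + \<rho> (cmod z) * cmod z ^ (2 * a))"
        unfolding \<rho> by (cases "z \<in> ball 0 r") (auto simp: norm_mult norm_power power_even_eq)
    qed
  qed
  have A: "(\<integral>z. complex_of_real (\<rho> (cmod z)) * F z * cnj z ^ a \<partial>lborel) = c * complex_of_real N"
    using holomorphic_moment[OF hol r _ \<rho>int _ Fint] Nval by (simp add: \<rho>_def c_def)
  then show ?A unfolding eq c_def N_def .
  have I1: "(\<integral>z. Re (cnj c * (complex_of_real (\<rho> (cmod z)) * F z * cnj z ^ a)) \<partial>lborel) = (cmod c)\<^sup>2 * N"
  proof -
    have "(\<integral>z. Re (cnj c * (complex_of_real (\<rho> (cmod z)) * F z * cnj z ^ a)) \<partial>lborel)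
      = Re (\<integral>z. cnj c * (complex_of_real (\<rho> (cmod z)) * F z * cnj z ^ a) \<partial>lborel)"
      using Fint by (intro integral_Re) auto
    also have "\<dots> = Re (cnj c * (c * complex_of_real N))" by (simp only: integral_mult_right_zero A)
    also have "cnj c * (c * complex_of_real N) = complex_of_real ((cmod c)\<^sup>2 * N)"
      by (simp only: of_real_mult complex_norm_square mult_ac)
    finally show ?thesis by simp
  qed
  have "0 \<le> (\<integral>z. \<rho> (cmod z) * (cmod (F z - c * z ^ a))\<^sup>2 \<partial>lborel)"
    by (intro integral_nonneg_AE AE_I2) (simp add: \<rho>)
  also have "\<dots> = (\<integral>z. indicator (ball 0 r) z * (cmod (F z))\<^sup>2
      + (cmod c)\<^sup>2 * (\<rho> (cmod z) * cmod z ^ (2 * a))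
      - 2 * Re (cnj c * (complex_of_real (\<rho> (cmod z)) * F z * cnj z ^ a)) \<partial>lborel)"
  proof (intro Bochner_Integration.integral_cong refl)
    fix z :: complex
    have "(cmod (F z - c * z ^ a))\<^sup>2 = (cmod (F z))\<^sup>2 + (cmod c)\<^sup>2 * cmod z ^ (2 * a) - 2 * Re (cnj c * (F z * cnj z ^ a))"
    proof -
      have "(cmod (x - y))\<^sup>2 = (cmod x)\<^sup>2 + (cmod y)\<^sup>2 - 2 * Re (cnj y * x)" for x y
        unfolding cmod_power2 by (simp add: power2_eq_square algebra_simps)
      from this[of "F z" "c * z ^ a"] show ?thesis
        by (simp only: norm_mult norm_power power_mult_distrib power_even_eq complex_cnj_mult complex_cnj_power mult.assoc mult.commute[of "F z"])
    qed
    then show "\<rho> (cmod z) * (cmod (F z - c * z ^ a))\<^sup>2 = indicator (ball 0 r) z * (cmod (F z))\<^sup>2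
      + (cmod c)\<^sup>2 * (\<rho> (cmod z) * cmod z ^ (2 * a))
      - 2 * Re (cnj c * (complex_of_real (\<rho> (cmod z)) * F z * cnj z ^ a))"
      by (cases "z \<in> ball 0 r") (auto simp: \<rho> algebra_simps)
  qed
  also have "\<dots> = (\<integral>z. indicator (ball 0 r) z * (cmod (F z))\<^sup>2 \<partial>lborel) + (cmod c)\<^sup>2 * N - 2 * ((cmod c)\<^sup>2 * N)"
  proof -
    have R: "integrable lborel (\<lambda>z. Re (cnj c * (complex_of_real (\<rho> (cmod z)) * F z * cnj z ^ a)))"
      using Fint by (intro integrable_Re integrable_mult_right)
    note cN = integrable_mult_right[OF Nint, of "(cmod c)\<^sup>2"]
    show ?thesis
      by (simp only: Bochner_Integration.integral_diff[OF Bochner_Integration.integrable_add[OF int cN] integrable_mult_right[OF R]]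
          Bochner_Integration.integral_add[OF int cN] integral_mult_right_zero I1 Nval)
  qed
  finally have "(cmod c)\<^sup>2 * N \<le> (\<integral>z. indicator (ball 0 r) z * (cmod (F z))\<^sup>2 \<partial>lborel)"
    by linarith
  then show ?B unfolding c_def N_def .
qed

text \<open>The generating function of the arithmetic progression \<open>m * k + d\<close>. Along
  one residue class the reciprocal squared norms of the basis monomials grow like such a progression
  in each of the two indices.\<close>

definition arith_kernel :: "nat \<Rightarrow> real \<Rightarrow> complex \<Rightarrow> complex" where
  "arith_kernel m d x = (of_real d + of_real (real m - d) * x) / (1 - x)\<^sup>2"

lemma arith_kernel_sums:
  assumes "cmod x < 1"
  shows "(\<lambda>k. of_real (real m * real k + d) * x ^ k) sums arith_kernel m d x"
proof -
  have x: "1 - x \<noteq> 0" using assms by auto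
  have "(\<lambda>k. of_real (real m) * (of_nat (Suc k) * x ^ k) + of_real (d - real m) * x ^ k)
     sums (of_real (real m) * (1 / (1 - x)\<^sup>2) + of_real (d - real m) * (1 / (1 - x)))"
    using assms by (intro sums_add sums_mult geometric_deriv_sums geometric_sums)
  also have "(\<lambda>k. of_real (real m) * (of_nat (Suc k) * x ^ k) + of_real (d - real m) * x ^ k)
      = (\<lambda>k. of_real (real m * real k + d) * x ^ k)"
    by (auto simp: algebra_simps)
  also have "of_real (real m) * (1 / (1 - x)\<^sup>2) + of_real (d - real m) * (1 / (1 - x)) = arith_kernel m d x"
    using x unfolding arith_kernel_def by (simp add: divide_simps power2_eq_square) (simp add: algebra_simps)
  finally show ?thesis .
qed

lemma arith_kernel_le:
  assumes "0 \<le> d" "d \<le> real m" "cmod x < 1"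
  shows "cmod (arith_kernel m d x) \<le> real m / (cmod (1 - x))\<^sup>2"
proof -
  have "cmod (of_real d + of_real (real m - d) * x) \<le> d + (real m - d) * cmod x"
    using norm_triangle_ineq[of "complex_of_real d" "of_real (real m - d) * x"] assms
    unfolding norm_mult norm_of_real by simp
  also have "\<dots> \<le> d + (real m - d) * 1" using assms by (intro add_left_mono mult_left_mono) auto
  finally show ?thesis unfolding arith_kernel_def norm_divide norm_power
    by (intro divide_right_mono) auto
qed

text \<open>On the diagonal the arguments are real and lie in \<open>[0, 1)\<close>. The lower bound
  has the same shape as the upper bound in \<open>arith_kernel_le\<close>, so numerator and
  denominator of the Berezin kernel can be compared.\<close>

lemma arith_kernel_ge:
  assumes "1 \<le> d" "d \<le> real m" "0 \<le> x" "x < 1"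
  shows "arith_kernel m d (of_real x) = of_real (Re (arith_kernel m d (of_real x)))"
    "1 / (1 - x)\<^sup>2 \<le> Re (arith_kernel m d (of_real x))"
proof -
  have eq: "arith_kernel m d (of_real x) = of_real ((d + (real m - d) * x) / (1 - x)\<^sup>2)"
    by (simp add: arith_kernel_def)
  then show "arith_kernel m d (of_real x) = of_real (Re (arith_kernel m d (of_real x)))" by simp
  have "1 \<le> d + (real m - d) * x" using mult_nonneg_nonneg[of "real m - d" x] assms by linarith
  then show "1 / (1 - x)\<^sup>2 \<le> Re (arith_kernel m d (of_real x))"
    unfolding eq Re_complex_of_real by (intro divide_right_mono) auto
qed

lemma arith_kernel_cnj: "arith_kernel m d (cnj x) = cnj (arith_kernel m d x)"
  by (simp add: arith_kernel_def)

lemma borel_measurable_arith_kernel [measurable (raw)]: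
  assumes [measurable]: "f \<in> borel_measurable M"
  shows "(\<lambda>x. arith_kernel m d (f x)) \<in> borel_measurable M"
  unfolding arith_kernel_def by measurable

section \<open>Geometry of the triangle and its square integrable monomials\<close>

locale hartogs =
  fixes m n :: nat
  assumes m: "m > 0" and n: "n > 0"
begin

abbreviation "H \<equiv> hartogs_triangle m n"
abbreviation "M \<equiv> lebesgue_on H"

definition radius :: "complex \<Rightarrow> real" where "radius w = cmod w powr (real n / real m)"

lemma radius_power: "w \<noteq> 0 \<Longrightarrow> radius w ^ m = cmod w ^ n"
  using m by (simp add: radius_def powr_power powr_realpow)

lemma radius_pos: "w \<noteq> 0 \<Longrightarrow> radius w > 0"
  by (simp add: radius_def)

text \<open>The right side excludes \<open>w = 0\<close>, since \<open>0 powr x = 0\<close>.\<close>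

lemma H_iff: "(z, w) \<in> H \<longleftrightarrow> cmod w < 1 \<and> cmod z < radius w"
proof (cases "w = 0")
  case True
  then show ?thesis using n by (auto simp: hartogs_triangle_def radius_def power_0_left not_less)
next
  case False
  have "cmod z ^ m < radius w ^ m \<longleftrightarrow> cmod z < radius w"
    using radius_pos[OF False] m by (meson norm_ge_zero less_imp_le power_less_imp_less_base power_strict_mono)
  moreover have "cmod w ^ n < 1 \<longleftrightarrow> cmod w < 1"
    using n by (simp add: power_less_one_iff)
  ultimately show ?thesis
    using False by (auto simp: hartogs_triangle_def radius_power)
qed

lemma H_D:
  assumes "z \<in> H"
  shows "snd z \<noteq> 0" "cmod (snd z) < 1" "cmod (fst z) < radius (snd z)"
  using assms H_iff[of "fst z" "snd z"] by (auto simp: radius_def)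

lemma indicator_H: "indicator H (z, w) = (indicator (ball 0 (radius w)) z * indicator (ball 0 1) w :: 'a::semiring_1)"
  by (simp add: indicator_def H_iff)

lemma open_H: "open H"
proof -
  have "H = {z. cmod (fst z) ^ m < cmod (snd z) ^ n} \<inter> {z. cmod (snd z) ^ n < 1}"
    by (auto simp: hartogs_triangle_def)
  also have "open \<dots>" by (intro open_Int open_Collect_less continuous_intros)
  finally show ?thesis .
qed

lemma H_borel [measurable]: "H \<in> sets borel"
  using open_H by (rule borel_open)

lemma H_lebesgue [simp]: "H \<in> sets lebesgue"
  using H_borel by (intro sets_completionI_sets) simp

lemma borel_imp_measurable_M: "f \<in> borel_measurable borel \<Longrightarrow> f \<in> borel_measurable M"
  by (intro measurable_restrict_space1 measurable_completion) simp

lemma nn_integral_M: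
  assumes [measurable]: "g \<in> borel_measurable borel"
  shows "(\<integral>\<^sup>+z. g z \<partial>M) = (\<integral>\<^sup>+w. (\<integral>\<^sup>+z. g (z, w) * indicator (ball 0 (radius w)) z \<partial>lborel) * indicator (ball 0 1) w \<partial>lborel)"
proof -
  have [measurable]: "ball (0::complex) 1 \<in> sets borel" by simp
  have "(\<integral>\<^sup>+z. g z \<partial>M) = (\<integral>\<^sup>+z. g z * indicator H z \<partial>lborel)"
    by (simp add: nn_integral_restrict_space nn_integral_completion)
  also have "\<dots> = (\<integral>\<^sup>+z. g z * indicator H z \<partial>(lborel \<Otimes>\<^sub>M lborel))"
    by (simp add: lborel_prod)
  also have "\<dots> = (\<integral>\<^sup>+w. \<integral>\<^sup>+z. g (z, w) * indicator H (z, w) \<partial>lborel \<partial>lborel)"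
    by (rule lborel_pair.nn_integral_snd[symmetric]) (simp add: lborel_prod)
  also have "\<dots> = (\<integral>\<^sup>+w. (\<integral>\<^sup>+z. g (z, w) * indicator (ball 0 (radius w)) z \<partial>lborel) * indicator (ball 0 1) w \<partial>lborel)"
  proof (intro nn_integral_cong)
    fix w :: complex
    have [measurable]: "ball (0::complex) (radius w) \<in> sets borel" by simp
    show "(\<integral>\<^sup>+z. g (z, w) * indicator H (z, w) \<partial>lborel) = (\<integral>\<^sup>+z. g (z, w) * indicator (ball 0 (radius w)) z \<partial>lborel) * indicator (ball 0 1) w"
      by (subst nn_integral_multc[symmetric]) (auto simp: indicator_H mult.assoc)
  qed
  finally show ?thesis .
qed

text \<open>The slice over \<open>w\<close> has area \<open>pi * (radius w)\<^sup>2\<close>, which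
  shifts the half exponent by \<open>n / m\<close>.\<close>

lemma nn_integral_M_snd_powr:
  assumes "\<gamma> + real n / real m > -1"
  shows "(\<integral>\<^sup>+z. ennreal (cmod (snd z) powr (2 * \<gamma>)) \<partial>M) = ennreal (pi * pi / (\<gamma> + real n / real m + 1))"
proof -
  have [measurable]: "ball (0::complex) 1 \<in> sets borel" by simp
  have "(\<integral>\<^sup>+z. ennreal (cmod (snd z) powr (2 * \<gamma>)) \<partial>M)
    = (\<integral>\<^sup>+w. (\<integral>\<^sup>+z. ennreal (cmod w powr (2 * \<gamma>)) * indicator (ball (0::complex) (radius w)) z \<partial>lborel) * indicator (ball (0::complex) 1) w \<partial>lborel)"
    by (subst nn_integral_M) auto
  also have "\<dots> = (\<integral>\<^sup>+w. ennreal pi * (ennreal (cmod w powr (2 * (\<gamma> + real n / real m))) * indicator (ball 0 1) w) \<partial>lborel)"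
  proof (intro nn_integral_cong)
    fix w :: complex
    have [measurable]: "ball (0::complex) (radius w) \<in> sets borel" by simp
    have "(\<integral>\<^sup>+z. ennreal (cmod w powr (2 * \<gamma>)) * indicator (ball (0::complex) (radius w)) z \<partial>lborel)
       = ennreal (cmod w powr (2 * \<gamma>)) * ennreal (pi * (radius w)\<^sup>2)"
      by (subst nn_integral_cmult_indicator) (auto simp: emeasure_ball unit_ball_vol_2 radius_def)
    also have "\<dots> = ennreal pi * ennreal (cmod w powr (2 * (\<gamma> + real n / real m)))"
    proof -
      have "cmod w powr (2 * (\<gamma> + real n / real m)) = cmod w powr (2 * \<gamma>) * (radius w)\<^sup>2"
        by (cases "w = 0") (simp_all add: radius_def powr_power distrib_left powr_add mult.commute)
      then show ?thesis by (simp add: mult_ac flip: ennreal_mult)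
    qed
    finally show "(\<integral>\<^sup>+z. ennreal (cmod w powr (2 * \<gamma>)) * indicator (ball (0::complex) (radius w)) z \<partial>lborel) * indicator (ball 0 1) w
       = ennreal pi * (ennreal (cmod w powr (2 * (\<gamma> + real n / real m))) * indicator (ball 0 1) w)"
      by (simp add: mult.assoc)
  qed
  also have "\<dots> = ennreal pi * (\<integral>\<^sup>+w. ennreal (cmod w powr (2 * (\<gamma> + real n / real m))) * indicator (ball 0 1) w \<partial>lborel)"
    by (rule nn_integral_cmult) measurable
  also have "\<dots> = ennreal pi * ennreal (pi * 1 powr (2 * (\<gamma> + real n / real m) + 2) / (\<gamma> + real n / real m + 1))"
    using assms by (subst nn_integral_cmod_powr) auto
  also have "\<dots> = ennreal (pi * pi / (\<gamma> + real n / real m + 1))"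
    using assms by (simp flip: ennreal_mult)
  finally show ?thesis .
qed

text \<open>The monomial \<open>z\<^sub>1\<^sup>a z\<^sub>2\<^sup>b\<close> is square integrable on \<open>H\<close> iff \<open>b \<ge> \<beta> a\<close>, and for \<open>b = \<beta> a + l\<close> its squared norm is
  \<open>\<pi>\<^sup>2 m / ((a + 1) (m l + d a))\<close>. Here \<open>d a\<close> is an integer between \<open>1\<close> and \<open>m\<close>. The slice integral of
  \<open>|z\<^sub>1|\<close> to the power \<open>2 a\<close> is proportional to \<open>|z\<^sub>2|\<close> to the power \<open>2 \<sigma> a\<close>.\<close>

definition \<sigma> :: "nat \<Rightarrow> real" where "\<sigma> a = real n * (real a + 1) / real m"
definition \<beta> :: "nat \<Rightarrow> int" where "\<beta> a = \<lfloor>- \<sigma> a\<rfloor>"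
definition d :: "nat \<Rightarrow> real" where "d a = real m * (of_int (\<beta> a) + \<sigma> a + 1)"
text \<open>The worst growth of basis monomials. At the boundary of a slice the monomial with
  \<open>b = \<beta> a\<close> has size \<open>|z\<^sub>2|\<close> to the power
  \<open>(d a - m - n) / m\<close>, and this exponent is smallest, namely \<open>- \<kappa>\<close>,
  for \<open>d a = 1\<close>.\<close>

definition \<kappa> :: real where "\<kappa> = (real m + real n - 1) / real m"

lemma \<sigma>_nonneg: "\<sigma> a \<ge> 0" by (simp add: \<sigma>_def)

text \<open>Raising \<open>a\<close> by \<open>m\<close> raises \<open>\<sigma>\<close> by the
  integer \<open>n\<close>. Hence the floor shifts along and \<open>d\<close> depends only on the
  residue of \<open>a\<close>; this periodicity lets the kernel factor into series in
  \<open>s\<close> and in \<open>t\<close>.\<close>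

lemma \<sigma>_shift: "\<sigma> (m * k + j) = \<sigma> j + real (n * k)"
  using m by (simp add: \<sigma>_def field_simps)

lemma \<beta>_shift: "\<beta> (m * k + j) = \<beta> j - int (n * k)"
proof -
  have "- \<sigma> (m * k + j) = - \<sigma> j - of_int (int (n * k))" by (simp add: \<sigma>_shift)
  then show ?thesis unfolding \<beta>_def by (simp only: floor_diff_of_int)
qed

lemma d_shift: "d (m * k + j) = d j"
  by (simp add: d_def \<sigma>_shift \<beta>_shift)

lemma d_eq: "d a = of_int (int m * (\<beta> a + 1) + int n * (int a + 1))"
  using m by (simp add: d_def \<sigma>_def field_simps)

text \<open>The floor gives \<open>0 < d a \<le> m\<close>. By \<open>d_eq\<close> the number is an
  integer, so the strict lower bound improves to 1.\<close>

lemma d_bounds: "1 \<le> d a" "d a \<le> real m"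
proof -
  have "of_int (\<beta> a) \<le> - \<sigma> a" "- \<sigma> a < of_int (\<beta> a) + 1"
    unfolding \<beta>_def by linarith+
  then show "d a \<le> real m" using m unfolding d_def by (simp add: mult_le_cancel_left1)
  have "d a > 0" using m \<open>- \<sigma> a < of_int (\<beta> a) + 1\<close> unfolding d_def by (intro mult_pos_pos) auto
  then show "1 \<le> d a" unfolding d_eq by (metis of_int_0_less_iff of_int_1_le_iff zless_imp_add1_zle add_0)
qed

text \<open>One pointwise bound for all \<open>a\<close> at once; it turns the single integrability
  condition on \<open>cmod (F w) * cmod (snd w) powr (- \<kappa>)\<close> into a majorant for every
  monomial pairing below.\<close>

lemma monomial_le:
  assumes w: "w \<in> H"
  shows "cmod (fst w) ^ a * cmod (snd w) powr (of_int (\<beta> a)) \<le> cmod (snd w) powr (- \<kappa>)"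
proof -
  note w = H_D[OF w]
  have "cmod (fst w) ^ a * cmod (snd w) powr (of_int (\<beta> a)) \<le> radius (snd w) ^ a * cmod (snd w) powr (of_int (\<beta> a))"
    using w by (intro mult_right_mono power_mono) auto
  also have "\<dots> = cmod (snd w) powr (real n / real m * real a + of_int (\<beta> a))"
    using w by (simp add: radius_def powr_power powr_add mult.commute)
  also have "\<dots> \<le> cmod (snd w) powr (- \<kappa>)"
  proof (intro powr_mono')
    have "real n / real m * real a + of_int (\<beta> a) = (d a - real m - real n) / real m"
      using m by (simp add: d_def \<sigma>_def field_simps)
    also have "- \<kappa> \<le> \<dots>" unfolding \<kappa>_def minus_divide_left
      using d_bounds(1)[of a] by (intro divide_right_mono) auto
    finally show "- \<kappa> \<le> real n / real m * real a + of_int (\<beta> a)" .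
  qed (use w in auto)
  finally show ?thesis .
qed

end

section \<open>The Bergman kernel of the Hartogs triangle\<close>

context hartogs begin

definition U :: "complex \<times> complex \<Rightarrow> real" where
  "U z = cmod (fst z) ^ m / cmod (snd z) ^ n"

definition S :: "complex \<times> complex \<Rightarrow> complex \<times> complex \<Rightarrow> complex" where
  "S z w = (fst z * cnj (fst w)) ^ m / (snd z * cnj (snd w)) ^ n"

definition T :: "complex \<times> complex \<Rightarrow> complex \<times> complex \<Rightarrow> complex" where
  "T z w = snd z * cnj (snd w)"

text \<open>The residue class \<open>a = m * k + j\<close> in closed form: the factor in
  \<open>S\<close> sums \<open>a + 1\<close> over \<open>k\<close>, the factor in \<open>T\<close>
  sums \<open>m * l + d j\<close> over the exponents of \<open>z\<^sub>2\<close>.\<close>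

definition K_part :: "nat \<Rightarrow> complex \<times> complex \<Rightarrow> complex \<times> complex \<Rightarrow> complex" where
  "K_part j z w = (fst z * cnj (fst w)) ^ j * T z w powi \<beta> j
     * arith_kernel m (real j + 1) (S z w) * arith_kernel m (d j) (T z w) / of_real (real m * pi\<^sup>2)"

text \<open>Extended by 0, as \<open>reproducing_kernel\<close> prescribes off
  \<open>H \<times> H\<close>.\<close>

definition K :: "complex \<times> complex \<Rightarrow> complex \<times> complex \<Rightarrow> complex" where
  "K z w = (if z \<in> H \<and> w \<in> H then \<Sum>j<m. K_part j z w else 0)"

lemma U_bounds:
  assumes "z \<in> H" shows "0 \<le> U z" "U z < 1"
proof -
  note z = H_D[OF assms]
  show "0 \<le> U z" by (simp add: U_def)
  have "cmod (fst z) ^ m < radius (snd z) ^ m"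
    using z m by (intro power_strict_mono) auto
  then show "U z < 1" using z by (simp add: U_def radius_power divide_less_eq)
qed

lemma norm_S: "cmod (S z w) = U z * U w"
  by (simp add: S_def U_def norm_divide norm_mult norm_power power_mult_distrib)

lemma norm_T: "cmod (T z w) = cmod (snd z) * cmod (snd w)"
  by (simp add: T_def norm_mult)

lemma norm_S_le: "z \<in> H \<Longrightarrow> w \<in> H \<Longrightarrow> cmod (S z w) \<le> U z"
  unfolding norm_S using U_bounds[of z] U_bounds[of w] by (intro mult_right_le_one_le) auto

lemma norm_T_le: "z \<in> H \<Longrightarrow> w \<in> H \<Longrightarrow> cmod (T z w) \<le> cmod (snd z)"
  unfolding norm_T using H_D[of w] by (intro mult_right_le_one_le) auto

lemma norm_S_less: "z \<in> H \<Longrightarrow> w \<in> H \<Longrightarrow> cmod (S z w) < 1"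
  using norm_S_le U_bounds(2) by (rule order.strict_trans1)

lemma norm_T_less: "z \<in> H \<Longrightarrow> w \<in> H \<Longrightarrow> cmod (T z w) < 1"
  using norm_T_le H_D(2) by (rule order.strict_trans1)

lemma norm_powi: "z \<noteq> 0 \<Longrightarrow> cmod (z powi k) = cmod z powr of_int k"
  by (simp add: norm_power_int powr_real_of_int')

lemma norm_T_powi: "z \<in> H \<Longrightarrow> w \<in> H \<Longrightarrow>
    cmod (T z w powi k) = cmod (snd z) powr of_int k * cmod (snd w) powr of_int k"
  using H_D[of z] H_D[of w] by (simp add: T_def power_int_mult_distrib norm_mult norm_powi)

section \<open>Expansion of integrals against the kernel into moments\<close>

lemma arith_kernel_bound:
  assumes "0 \<le> c" "c \<le> real m" "cmod x \<le> r" "r < 1"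
  shows "cmod (arith_kernel m c x) \<le> real m / (1 - r)\<^sup>2"
proof -
  have "cmod (arith_kernel m c x) \<le> real m / (cmod (1 - x))\<^sup>2"
    using assms by (intro arith_kernel_le) auto
  also have "\<dots> \<le> real m / (1 - r)\<^sup>2"
    using one_minus_norm_le[OF assms(3,4)] assms(4)
    by (intro divide_left_mono power_mono mult_pos_pos zero_less_power) auto
  finally show ?thesis .
qed

text \<open>The reciprocal squared norm of the monomial is
  \<open>(a + 1) * (m * l + d a) / (m * pi\<^sup>2)\<close>. Here stands the part that does not
  involve \<open>l\<close>, together with the \<open>z\<^sub>1\<close>-factor of the
  monomial.\<close>

definition coef :: "nat \<Rightarrow> complex \<times> complex \<Rightarrow> complex" where
  "coef a z = of_real ((real a + 1) / (real m * pi\<^sup>2)) * fst z ^ a"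

definition mom :: "(complex \<times> complex \<Rightarrow> complex) \<Rightarrow> nat \<Rightarrow> nat \<Rightarrow> complex" where
  "mom F a l = (\<integral>w. F w * cnj (fst w) ^ a * cnj (snd w) powi (\<beta> a + int l) \<partial>M)"

text \<open>The part of the kernel with \<open>z\<^sub>1\<close>-exponent \<open>a\<close>; the factor in \<open>T\<close> sums over all exponents of \<open>z\<^sub>2\<close>.\<close>

definition row :: "nat \<Rightarrow> complex \<times> complex \<Rightarrow> complex \<times> complex \<Rightarrow> complex" where
  "row a z w = coef a z * cnj (fst w) ^ a * T z w powi \<beta> a * arith_kernel m (d a) (T z w)"

lemma measurable_M [measurable]:
  "fst \<in> borel_measurable M" "snd \<in> borel_measurable M"
  by (intro borel_imp_measurable_M; measurable)+

lemma row_measurable [measurable]: "row a z \<in> borel_measurable M"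
  unfolding row_def[abs_def] T_def by measurable

text \<open>The series in \<open>T\<close> is integrated term by term; \<open>monomial_le\<close>
  supplies the majorant. \<open>F\<close> is just a measurable function because the expansion serves
  both for Bergman functions and for the truncated test function of the lower bound.\<close>

lemma row_expansion:
  assumes z: "z \<in> H" and [measurable]: "F \<in> borel_measurable M"
    and int: "integrable M (\<lambda>w. cmod (F w) * cmod (snd w) powr (- \<kappa>))"
  shows "(\<lambda>l. coef a z * of_real (real m * real l + d a) * snd z powi (\<beta> a + int l) * mom F a l)
     sums (\<integral>w. F w * row a z w \<partial>M)"
proof -
  note zH = H_D[OF z]
  have "(\<lambda>l. \<integral>w. F w * (coef a z * cnj (fst w) ^ a * T z w powi \<beta> a * (of_real (real m * real l + d a) * T z w ^ l)) \<partial>M)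
     sums (\<integral>w. F w * row a z w \<partial>M)"
  proof (rule integral_sums_dominated[THEN conjunct2, OF _ int])
    show "summable (\<lambda>l. cmod (coef a z) * cmod (snd z) powr of_int (\<beta> a) * norm (of_real (real m * real l + d a) * snd z ^ l))"
    proof (intro summable_mult)
      have "summable (\<lambda>l. of_real (real m * real l + d a) * (complex_of_real (cmod (snd z))) ^ l)"
        using zH by (intro sums_summable[OF arith_kernel_sums]) auto
      also have "(\<lambda>l. of_real (real m * real l + d a) * (complex_of_real (cmod (snd z))) ^ l)
         = (\<lambda>l. complex_of_real ((real m * real l + d a) * cmod (snd z) ^ l))" by simp
      finally have "summable (\<lambda>l. (real m * real l + d a) * cmod (snd z) ^ l)"
        unfolding summable_of_real_iff .
      also have "(\<lambda>l. (real m * real l + d a) * cmod (snd z) ^ l) = (\<lambda>l. norm (of_real (real m * real l + d a) * snd z ^ l))"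
        using d_bounds(1)[of a] by (simp only: norm_mult norm_of_real norm_power) (simp add: abs_of_nonneg)
      finally show "summable (\<lambda>l. norm (of_real (real m * real l + d a) * snd z ^ l))" .
    qed
    fix w l assume "w \<in> space M"
    then have w: "w \<in> H" by simp
    show "(\<lambda>l. F w * (coef a z * cnj (fst w) ^ a * T z w powi \<beta> a * (of_real (real m * real l + d a) * T z w ^ l)))
       sums (F w * row a z w)"
      unfolding row_def by (intro sums_mult arith_kernel_sums norm_T_less z w)
    have "norm (F w * (coef a z * cnj (fst w) ^ a * T z w powi \<beta> a * (of_real (real m * real l + d a) * T z w ^ l)))
      = cmod (coef a z) * cmod (snd z) powr of_int (\<beta> a) * norm (complex_of_real (real m * real l + d a)) * cmod (T z w) ^ l
         * (cmod (F w) * (cmod (fst w) ^ a * cmod (snd w) powr of_int (\<beta> a)))"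
      by (simp only: norm_mult norm_power norm_T_powi[OF z w] complex_mod_cnj mult_ac)
    also have "\<dots> \<le> cmod (coef a z) * cmod (snd z) powr of_int (\<beta> a) * norm (complex_of_real (real m * real l + d a)) * cmod (snd z) ^ l
         * (cmod (F w) * cmod (snd w) powr (- \<kappa>))"
      by (intro mult_mono mult_left_mono monomial_le w power_mono norm_T_le z) auto
    also have "\<dots> = cmod (coef a z) * cmod (snd z) powr of_int (\<beta> a) * norm (of_real (real m * real l + d a) * snd z ^ l) * (cmod (F w) * cmod (snd w) powr (- \<kappa>))"
      by (simp only: norm_mult norm_power mult_ac)
    finally show "norm (F w * (coef a z * cnj (fst w) ^ a * T z w powi \<beta> a * (of_real (real m * real l + d a) * T z w ^ l)))
      \<le> cmod (coef a z) * cmod (snd z) powr of_int (\<beta> a) * norm (of_real (real m * real l + d a) * snd z ^ l) * (cmod (F w) * cmod (snd w) powr (- \<kappa>))" .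
  next
    show "(\<lambda>w. F w * (coef a z * cnj (fst w) ^ a * T z w powi \<beta> a * (of_real (real m * real l + d a) * T z w ^ l))) \<in> borel_measurable M" for l
      unfolding T_def by measurable
  qed
  moreover have "(\<integral>w. F w * (coef a z * cnj (fst w) ^ a * T z w powi \<beta> a * (of_real (real m * real l + d a) * T z w ^ l)) \<partial>M)
     = coef a z * of_real (real m * real l + d a) * snd z powi (\<beta> a + int l) * mom F a l" for l
  proof -
    have "(\<integral>w. F w * (coef a z * cnj (fst w) ^ a * T z w powi \<beta> a * (of_real (real m * real l + d a) * T z w ^ l)) \<partial>M)
      = (\<integral>w. coef a z * of_real (real m * real l + d a) * snd z powi (\<beta> a + int l) * (F w * cnj (fst w) ^ a * cnj (snd w) powi (\<beta> a + int l)) \<partial>M)"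
    proof (intro Bochner_Integration.integral_cong refl)
      fix w assume "w \<in> space M"
      then have w: "snd w \<noteq> 0" using H_D(1)[of w] by simp
      have "T z w powi \<beta> a * T z w ^ l = T z w powi (\<beta> a + int l)"
        using w zH by (simp add: T_def power_int_add)
      also have "\<dots> = snd z powi (\<beta> a + int l) * cnj (snd w) powi (\<beta> a + int l)"
        by (simp add: T_def power_int_mult_distrib)
      finally have e: "T z w powi \<beta> a * T z w ^ l = snd z powi (\<beta> a + int l) * cnj (snd w) powi (\<beta> a + int l)" .
      have "F w * (coef a z * cnj (fst w) ^ a * T z w powi \<beta> a * (of_real (real m * real l + d a) * T z w ^ l))
         = coef a z * of_real (real m * real l + d a) * F w * cnj (fst w) ^ a * (T z w powi \<beta> a * T z w ^ l)"
        by (simp only: mult_ac)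
      then show "F w * (coef a z * cnj (fst w) ^ a * T z w powi \<beta> a * (of_real (real m * real l + d a) * T z w ^ l))
         = coef a z * of_real (real m * real l + d a) * snd z powi (\<beta> a + int l) * (F w * cnj (fst w) ^ a * cnj (snd w) powi (\<beta> a + int l))"
        unfolding e by (simp only: mult_ac)
    qed
    then show ?thesis unfolding mom_def by (simp only: integral_mult_right_zero)
  qed
  ultimately show ?thesis by (simp only:)
qed

text \<open>By the periodicity of \<open>\<beta>\<close> and \<open>d\<close>, passing from
  \<open>j\<close> to \<open>m * k + j\<close> multiplies the monomial part by
  \<open>S z w ^ k\<close> and changes only the coefficient \<open>a + 1\<close>.\<close>

lemma row_eq:
  assumes z: "z \<in> H" and w: "w \<in> H"
  shows "row (m * k + j) z w = of_real (real m * real k + (real j + 1)) * S z w ^ k *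
     ((fst z * cnj (fst w)) ^ j * T z w powi \<beta> j * arith_kernel m (d j) (T z w) / of_real (real m * pi\<^sup>2))"
proof -
  have T0: "T z w \<noteq> 0" using H_D(1)[OF z] H_D(1)[OF w] by (simp add: T_def)
  have "T z w powi \<beta> (m * k + j) = T z w powi \<beta> j / (T z w ^ n) ^ k"
    using T0 unfolding \<beta>_shift by (subst power_int_diff) (simp_all only: power_int_of_nat power_mult simp_thms)
  then have "(fst z * cnj (fst w)) ^ (m * k + j) * T z w powi \<beta> (m * k + j) =
     S z w ^ k * ((fst z * cnj (fst w)) ^ j * T z w powi \<beta> j)"
    by (simp add: S_def T_def power_add power_mult power_divide)
  moreover have "row (m * k + j) z w = of_real (real m * real k + (real j + 1)) / of_real (real m * pi\<^sup>2) *
      ((fst z * cnj (fst w)) ^ (m * k + j) * T z w powi \<beta> (m * k + j)) * arith_kernel m (d j) (T z w)"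
    unfolding row_def coef_def d_shift by (simp add: power_mult_distrib mult_ac add_ac)
  ultimately show ?thesis by (simp add: mult_ac)
qed

text \<open>For fixed \<open>z\<close> the factor in \<open>T\<close> stays bounded and
  \<open>monomial_le\<close> bounds the \<open>w\<close>-monomial, so the powers of
  \<open>U z\<close> alone make the series summable.\<close>

lemma K_part_expansion:
  assumes z: "z \<in> H" and [measurable]: "F \<in> borel_measurable M"
    and int: "integrable M (\<lambda>w. cmod (F w) * cmod (snd w) powr (- \<kappa>))" and j: "j < m"
  shows "integrable M (\<lambda>w. F w * K_part j z w) \<and>
    (\<lambda>k. \<integral>w. F w * row (m * k + j) z w \<partial>M) sums (\<integral>w. F w * K_part j z w \<partial>M)"
proof (rule integral_sums_dominated)
  define C where "C = cmod (fst z) ^ j * cmod (snd z) powr of_int (\<beta> j) * (real m / (1 - cmod (snd z))\<^sup>2) / (real m * pi\<^sup>2)"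
  have C: "C \<ge> 0" unfolding C_def by simp
  show "integrable M (\<lambda>w. C * (cmod (F w) * cmod (snd w) powr (- \<kappa>)))"
    using int by simp
  show "summable (\<lambda>k. (real m * real k + (real j + 1)) * U z ^ k)"
  proof -
    have "summable (\<lambda>k. of_real (real m * real k + (real j + 1)) * (complex_of_real (U z)) ^ k)"
      using U_bounds[OF z] by (intro sums_summable[OF arith_kernel_sums]) auto
    also have "(\<lambda>k. of_real (real m * real k + (real j + 1)) * (complex_of_real (U z)) ^ k)
       = (\<lambda>k. complex_of_real ((real m * real k + (real j + 1)) * U z ^ k))" by simp
    finally show ?thesis unfolding summable_of_real_iff .
  qed
  show "(\<lambda>w. F w * row (m * k + j) z w) \<in> borel_measurable M" for k by measurable
  fix w k assume "w \<in> space M"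
  then have w: "w \<in> H" by simp
  define Q where "Q = (fst z * cnj (fst w)) ^ j * T z w powi \<beta> j * arith_kernel m (d j) (T z w) / of_real (real m * pi\<^sup>2)"
  have "(\<lambda>k. F w * (of_real (real m * real k + (real j + 1)) * S z w ^ k * Q)) sums (F w * (arith_kernel m (real j + 1) (S z w) * Q))"
    by (intro sums_mult sums_mult2 arith_kernel_sums norm_S_less z w)
  then show "(\<lambda>k. F w * row (m * k + j) z w) sums (F w * K_part j z w)"
    unfolding row_eq[OF z w] Q_def K_part_def by (simp add: mult_ac)
  have "cmod Q = cmod (fst z) ^ j * cmod (snd z) powr of_int (\<beta> j) * cmod (arith_kernel m (d j) (T z w)) / (real m * pi\<^sup>2)
       * (cmod (fst w) ^ j * cmod (snd w) powr of_int (\<beta> j))"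
    unfolding Q_def norm_divide norm_mult norm_power norm_T_powi[OF z w] norm_of_real
    by (simp add: power_mult_distrib)
  also have "\<dots> \<le> C * cmod (snd w) powr (- \<kappa>)"
    unfolding C_def using d_bounds[of j] H_D[OF z]
    by (intro mult_mono divide_right_mono mult_left_mono monomial_le w arith_kernel_bound norm_T_le z) auto
  finally have Q: "cmod Q \<le> C * cmod (snd w) powr (- \<kappa>)" .
  have "norm (F w * row (m * k + j) z w) = (real m * real k + (real j + 1)) * cmod (S z w) ^ k * (cmod (F w) * cmod Q)"
    unfolding row_eq[OF z w] Q_def[symmetric] norm_mult norm_power norm_of_real by simp
  also have "\<dots> \<le> (real m * real k + (real j + 1)) * U z ^ k * (cmod (F w) * (C * cmod (snd w) powr (- \<kappa>)))"
    using U_bounds[OF z] by (intro mult_mono power_mono norm_S_le z w Q) auto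
  finally show "norm (F w * row (m * k + j) z w)
     \<le> (real m * real k + (real j + 1)) * U z ^ k * (C * (cmod (F w) * cmod (snd w) powr (- \<kappa>)))"
    by (simp only: mult_ac)
qed

lemma kernel_expansion:
  assumes z: "z \<in> H" and [measurable]: "F \<in> borel_measurable M"
    and int: "integrable M (\<lambda>w. cmod (F w) * cmod (snd w) powr (- \<kappa>))"
  shows "integrable M (\<lambda>w. F w * K z w)"
    "(\<lambda>k. \<Sum>j<m. \<integral>w. F w * row (m * k + j) z w \<partial>M) sums (\<integral>w. F w * K z w \<partial>M)"
proof -
  note E = K_part_expansion[OF assms]
  have eq: "F w * K z w = (\<Sum>j<m. F w * K_part j z w)" if "w \<in> space M" for w
    using that z by (simp add: K_def sum_distrib_left)
  have "integrable M (\<lambda>w. \<Sum>j<m. F w * K_part j z w)"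
    using E by (intro Bochner_Integration.integrable_sum) auto
  moreover have "integrable M (\<lambda>w. F w * K z w) \<longleftrightarrow> integrable M (\<lambda>w. \<Sum>j<m. F w * K_part j z w)"
    using eq by (intro Bochner_Integration.integrable_cong refl) 
  ultimately show "integrable M (\<lambda>w. F w * K z w)" by simp
  have "(\<integral>w. F w * K z w \<partial>M) = (\<integral>w. (\<Sum>j<m. F w * K_part j z w) \<partial>M)"
    using eq by (intro Bochner_Integration.integral_cong refl)
  also have "\<dots> = (\<Sum>j<m. \<integral>w. F w * K_part j z w \<partial>M)"
    using E by (intro Bochner_Integration.integral_sum) auto
  finally show "(\<lambda>k. \<Sum>j<m. \<integral>w. F w * row (m * k + j) z w \<partial>M) sums (\<integral>w. F w * K z w \<partial>M)"
    using E by (auto intro!: sums_sum)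
qed

text \<open>The left side equals \<open>1 / m - 1\<close>. The margin \<open>1 / m\<close> is what
  the Schur weight may later use up.\<close>

lemma \<kappa>_less: "- \<kappa> + real n / real m > -1"
  using m by (simp add: \<kappa>_def field_simps)

lemma integrable_M_snd_powr:
  assumes "\<gamma> + real n / real m > -1"
  shows "integrable M (\<lambda>w. cmod (snd w) powr (2 * \<gamma>))"
proof (rule integrableI_bounded)
  show "(\<integral>\<^sup>+w. ennreal (norm (cmod (snd w) powr (2 * \<gamma>))) \<partial>M) < \<infinity>"
    using nn_integral_M_snd_powr[OF assms] by simp
qed measurable

section \<open>Moments of Bergman functions\<close>

lemma integral_M_eq:
  fixes g :: "complex \<times> complex \<Rightarrow> 'b::{banach, second_countable_topology}"
  assumes "(\<lambda>z. indicator H z *\<^sub>R g z) \<in> borel_measurable borel"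
  shows "integral\<^sup>L M g = (\<integral>z. indicator H z *\<^sub>R g z \<partial>lborel)"
    "integrable M g \<longleftrightarrow> integrable lborel (\<lambda>z. indicator H z *\<^sub>R g z)"
  using assms by (simp_all add: integral_restrict_space integral_completion integrable_restrict_space integrable_completion)

lemma bergman_measurable:
  assumes f: "f \<in> bergman_space H"
  shows "f \<in> borel_measurable M" "(\<lambda>z. indicator H z *\<^sub>R f z) \<in> borel_measurable borel"
    and "integrable M (\<lambda>w. (cmod (f w))\<^sup>2)"
proof -
  have "continuous_on H f"
    using f by (intro holomorphic2_on_imp_continuous_on) (simp add: bergman_space_def)
  then show "f \<in> borel_measurable M" "(\<lambda>z. indicator H z *\<^sub>R f z) \<in> borel_measurable borel"
    by (auto intro!: continuous_imp_measurable_on_sets_lebesgue borel_measurable_continuous_on_indicator)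
  show "integrable M (\<lambda>w. (cmod (f w))\<^sup>2)" using f by (simp add: bergman_space_def)
qed

lemma bergman_weight_integrable:
  assumes f: "f \<in> bergman_space H"
  shows "integrable M (\<lambda>w. cmod (f w) * cmod (snd w) powr (- \<kappa>))"
proof (rule Bochner_Integration.integrable_bound)
  note [measurable] = bergman_measurable(1)[OF f]
  show "integrable M (\<lambda>w. (cmod (f w))\<^sup>2 + cmod (snd w) powr (2 * (- \<kappa>)))"
    by (intro Bochner_Integration.integrable_add bergman_measurable f integrable_M_snd_powr \<kappa>_less)
  show "(\<lambda>w. cmod (f w) * cmod (snd w) powr (- \<kappa>)) \<in> borel_measurable M" by measurable
  show "AE w in M. norm (cmod (f w) * cmod (snd w) powr (- \<kappa>)) \<le> norm ((cmod (f w))\<^sup>2 + cmod (snd w) powr (2 * (- \<kappa>)))"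
  proof (rule AE_I2)
    fix w
    define a b where "a = cmod (f w)" and "b = cmod (snd w) powr (- \<kappa>)"
    have ab: "0 \<le> a * b" by (simp add: a_def b_def)
    have "cmod (snd w) powr (2 * (- \<kappa>)) = b\<^sup>2"
      by (simp add: b_def power2_eq_square flip: powr_add)
    moreover have "a * b \<le> a\<^sup>2 + b\<^sup>2"
      using sum_squares_bound[of a b] ab by linarith
    ultimately show "norm (cmod (f w) * cmod (snd w) powr (- \<kappa>)) \<le> norm ((cmod (f w))\<^sup>2 + cmod (snd w) powr (2 * (- \<kappa>)))"
      using ab by (simp add: flip: a_def b_def)
  qed
qed

lemma radius_powr:
  assumes "w \<noteq> 0"
  shows "radius w ^ (2 * a + 2) = cmod w powr (2 * \<sigma> a)"
proof -
  have "radius w ^ (2 * a + 2) = cmod w powr (real n / real m * real (2 * a + 2))"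
    unfolding radius_def using assms by (subst powr_power) (auto simp: mult_ac)
  also have "real n / real m * real (2 * a + 2) = 2 * \<sigma> a"
    using m by (simp add: \<sigma>_def field_simps)
  finally show ?thesis .
qed

text \<open>By Fubini almost every horizontal slice is square integrable, and
  \<open>disc_coeff\<close> applies to it on the disc of radius \<open>radius w\<close>.\<close>

lemma bergman_slice:
  assumes f: "f \<in> bergman_space H"
  shows "integrable lborel (\<lambda>w. \<integral>x. indicator H (x, w) * (cmod (f (x, w)))\<^sup>2 \<partial>lborel)"
    and "AE w in lborel. w \<in> ball 0 1 - {0} \<longrightarrow>
      (\<integral>x. indicator H (x, w) * f (x, w) * cnj x ^ a \<partial>lborel)
         = slice_coeff f a w * complex_of_real (pi * cmod w powr (2 * \<sigma> a) / (real a + 1)) \<and>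
      (cmod (slice_coeff f a w))\<^sup>2 * (pi * cmod w powr (2 * \<sigma> a) / (real a + 1))
         \<le> (\<integral>x. indicator H (x, w) * (cmod (f (x, w)))\<^sup>2 \<partial>lborel)"
proof -
  have [measurable]: "(\<lambda>z. indicator H z *\<^sub>R f z) \<in> borel_measurable borel"
    by (rule bergman_measurable(2)[OF f])
  have eq: "indicator H z * (cmod (f z))\<^sup>2 = (cmod (indicator H z *\<^sub>R f z))\<^sup>2" for z
    by (simp add: indicator_def)
  have "(\<lambda>z. indicator H z *\<^sub>R (cmod (f z))\<^sup>2) \<in> borel_measurable borel"
    unfolding real_scaleR_def eq by measurable
  then have "integrable lborel (\<lambda>z. indicator H z *\<^sub>R (cmod (f z))\<^sup>2)"
    using bergman_measurable(3)[OF f] by (rule integral_M_eq(2)[THEN iffD1])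
  then have int: "integrable (lborel \<Otimes>\<^sub>M lborel) (case_prod (\<lambda>x w. indicator H (x, w) * (cmod (f (x, w)))\<^sup>2))"
    by (simp add: lborel_prod case_prod_unfold)
  show "integrable lborel (\<lambda>w. \<integral>x. indicator H (x, w) * (cmod (f (x, w)))\<^sup>2 \<partial>lborel)"
    by (rule lborel_pair.integrable_snd[OF int])
  have "AE w in lborel. integrable lborel (\<lambda>x. indicator H (x, w) * (cmod (f (x, w)))\<^sup>2)"
    by (rule lborel_pair.AE_integrable_snd[OF int])
  then show "AE w in lborel. w \<in> ball 0 1 - {0} \<longrightarrow>
      (\<integral>x. indicator H (x, w) * f (x, w) * cnj x ^ a \<partial>lborel)
         = slice_coeff f a w * complex_of_real (pi * cmod w powr (2 * \<sigma> a) / (real a + 1)) \<and>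
      (cmod (slice_coeff f a w))\<^sup>2 * (pi * cmod w powr (2 * \<sigma> a) / (real a + 1))
         \<le> (\<integral>x. indicator H (x, w) * (cmod (f (x, w)))\<^sup>2 \<partial>lborel)"
  proof eventually_elim
    case (elim w)
    show ?case
    proof
      assume w: "w \<in> ball 0 1 - {0}"
      have ind: "indicator H (x, w) = (indicator (ball 0 (radius w)) x :: 'c::semiring_1)" for x
        using w by (simp add: indicator_H)
      have "(\<lambda>x. f (x, w)) holomorphic_on {x. (x, w) \<in> H}"
        using f by (intro holomorphic2_on_slices open_H) (simp add: bergman_space_def)
      then have hol: "(\<lambda>x. f (x, w)) holomorphic_on ball 0 (radius w)"
        by (rule holomorphic_on_subset) (use w in \<open>auto simp: H_iff\<close>)
      have r: "radius w > 0" using w by (intro radius_pos) auto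
      have i: "integrable lborel (\<lambda>x. indicator (ball 0 (radius w)) x * (cmod (f (x, w)))\<^sup>2)"
        using elim by (simp only: ind)
      have rp: "radius w ^ (2 * a + 2) = cmod w powr (2 * \<sigma> a)" using w by (intro radius_powr) auto
      show "(\<integral>x. indicator H (x, w) * f (x, w) * cnj x ^ a \<partial>lborel)
         = slice_coeff f a w * complex_of_real (pi * cmod w powr (2 * \<sigma> a) / (real a + 1)) \<and>
      (cmod (slice_coeff f a w))\<^sup>2 * (pi * cmod w powr (2 * \<sigma> a) / (real a + 1))
         \<le> (\<integral>x. indicator H (x, w) * (cmod (f (x, w)))\<^sup>2 \<partial>lborel)"
        using disc_coeff[OF hol r i, of a] unfolding ind slice_coeff_def rp by blast
    qed
  qed
qed

text \<open>Fubini with the \<open>z\<^sub>1\<close>-integral inside. Borel measurability of the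
  extension by zero is asked for besides measurability on \<open>M\<close>, because the product of
  two copies of \<open>lborel\<close> carries only Borel sets.\<close>

lemma mom_iterated:
  assumes [measurable]: "F \<in> borel_measurable M" "(\<lambda>z. indicator H z *\<^sub>R F z) \<in> borel_measurable borel"
    and int: "integrable M (\<lambda>w. cmod (F w) * cmod (snd w) powr (- \<kappa>))"
  shows "integrable lborel (\<lambda>w. \<integral>x. indicator H (x, w) *\<^sub>R (F (x, w) * cnj x ^ a * cnj w powi (\<beta> a + int l)) \<partial>lborel)"
    and "mom F a l = (\<integral>w. \<integral>x. indicator H (x, w) *\<^sub>R (F (x, w) * cnj x ^ a * cnj w powi (\<beta> a + int l)) \<partial>lborel \<partial>lborel)"
proof -
  define g where "g w = F w * cnj (fst w) ^ a * cnj (snd w) powi (\<beta> a + int l)" for w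
  have gm: "(\<lambda>z. indicator H z *\<^sub>R g z) \<in> borel_measurable borel"
  proof -
    have "(\<lambda>z. indicator H z *\<^sub>R g z) = (\<lambda>z. (indicator H z *\<^sub>R F z) * cnj (fst z) ^ a * cnj (snd z) powi (\<beta> a + int l))"
      by (auto simp: g_def)
    then show ?thesis by (simp only:) measurable
  qed
  have "integrable M g"
  proof (rule Bochner_Integration.integrable_bound[OF int])
    show "g \<in> borel_measurable M" unfolding g_def[abs_def] by measurable
    show "AE w in M. norm (g w) \<le> norm (cmod (F w) * cmod (snd w) powr (- \<kappa>))"
    proof (rule AE_I2)
      fix w assume "w \<in> space M"
      then have w: "w \<in> H" by simp
      note wH = H_D[OF w]
      have "norm (g w) = cmod (F w) * (cmod (fst w) ^ a * cmod (snd w) powr of_int (\<beta> a)) * cmod (snd w) ^ l"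
        using wH by (simp add: g_def norm_mult norm_power power_int_add norm_powi)
      also have "\<dots> \<le> cmod (F w) * cmod (snd w) powr (- \<kappa>) * 1"
        using wH by (intro mult_mono mult_left_mono monomial_le w power_le_one) auto
      finally show "norm (g w) \<le> norm (cmod (F w) * cmod (snd w) powr (- \<kappa>))" by simp
    qed
  qed
  then have "integrable lborel (\<lambda>z. indicator H z *\<^sub>R g z)" using integral_M_eq(2)[OF gm] by simp
  then have int: "integrable (lborel \<Otimes>\<^sub>M lborel) (case_prod (\<lambda>x w. indicator H (x, w) *\<^sub>R g (x, w)))"
    by (simp add: lborel_prod case_prod_unfold)
  show "integrable lborel (\<lambda>w. \<integral>x. indicator H (x, w) *\<^sub>R (F (x, w) * cnj x ^ a * cnj w powi (\<beta> a + int l)) \<partial>lborel)"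
    using lborel_pair.integrable_snd[OF int] by (simp add: g_def)
  have "mom F a l = (\<integral>z. indicator H z *\<^sub>R g z \<partial>lborel)"
    unfolding mom_def g_def[symmetric] by (rule integral_M_eq(1)[OF gm])
  also have "\<dots> = (\<integral>w. \<integral>x. indicator H (x, w) *\<^sub>R g (x, w) \<partial>lborel \<partial>lborel)"
    using lborel_pair.integral_snd[OF int] by (simp add: lborel_prod case_prod_unfold)
  finally show "mom F a l = (\<integral>w. \<integral>x. indicator H (x, w) *\<^sub>R (F (x, w) * cnj x ^ a * cnj w powi (\<beta> a + int l)) \<partial>lborel \<partial>lborel)"
    by (simp add: g_def)
qed

text \<open>Two one-variable arguments are stacked. The slice coefficient is holomorphic on the
  punctured disc, and Bessel's inequality on slices makes it square integrable there with weight
  \<open>cmod w powr (2 * \<sigma> a)\<close>. So its pole has order at most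
  \<open>- \<beta> a\<close>, and the moments are Taylor coefficients of \<open>E\<close> times
  squared norms of monomials.\<close>

lemma bergman_moment:
  assumes f: "f \<in> bergman_space H"
  obtains E where "E holomorphic_on ball 0 1"
    "\<And>w. w \<in> ball 0 1 - {0} \<Longrightarrow> slice_coeff f a w = w powi \<beta> a * E w"
    "\<And>l. mom f a l = (deriv ^^ l) E 0 / fact l * complex_of_real (pi\<^sup>2 * real m / ((real a + 1) * (real m * real l + d a)))"
proof -
  define G where "G = slice_coeff f a"
  have [measurable]: "ball (0::complex) 1 \<in> sets borel" by simp
  have [measurable]: "(\<lambda>z. indicator H z *\<^sub>R f z) \<in> borel_measurable borel"
    by (rule bergman_measurable(2)[OF f])
  note [measurable] = bergman_measurable(1)[OF f]
  have holG: "G holomorphic_on ball 0 1 - {0}"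
    unfolding G_def
  proof (rule slice_coeff_holomorphic[OF _ open_H])
    show "holomorphic2_on f H" using f by (simp add: bergman_space_def)
  qed (auto simp: H_iff radius_pos)
  note slice = bergman_slice(1)[OF f] bergman_slice(2)[OF f, of a, folded G_def]
  have intG: "integrable lborel (\<lambda>w. indicator (ball 0 1) w * (cmod w powr (2 * \<sigma> a) * (cmod (G w))\<^sup>2))"
  proof (rule Bochner_Integration.integrable_bound)
    show "integrable lborel (\<lambda>w. (real a + 1) / pi * (\<integral>x. indicator H (x, w) * (cmod (f (x, w)))\<^sup>2 \<partial>lborel))"
      using slice(1) by simp
    have "(\<lambda>w. indicator (ball 0 1 - {0}) w *\<^sub>R G w) \<in> borel_measurable borel"
      by (intro borel_measurable_continuous_on_indicator holomorphic_on_imp_continuous_on holG) auto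
    then have "(\<lambda>w. cmod w powr (2 * \<sigma> a) * (cmod (indicator (ball 0 1 - {0}) w *\<^sub>R G w))\<^sup>2) \<in> borel_measurable lborel"
      by measurable
    also have "(\<lambda>w. cmod w powr (2 * \<sigma> a) * (cmod (indicator (ball 0 1 - {0}) w *\<^sub>R G w))\<^sup>2)
       = (\<lambda>w. indicator (ball 0 1) w * (cmod w powr (2 * \<sigma> a) * (cmod (G w))\<^sup>2))"
      by (auto simp: fun_eq_iff indicator_def)
    finally show "(\<lambda>w. indicator (ball 0 1) w * (cmod w powr (2 * \<sigma> a) * (cmod (G w))\<^sup>2)) \<in> borel_measurable lborel" .
    show "AE w in lborel. norm (indicator (ball 0 1) w * (cmod w powr (2 * \<sigma> a) * (cmod (G w))\<^sup>2))
       \<le> norm ((real a + 1) / pi * (\<integral>x. indicator H (x, w) * (cmod (f (x, w)))\<^sup>2 \<partial>lborel))"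
      using slice(2)
    proof eventually_elim
      case (elim w)
      show ?case
      proof (cases "w \<in> ball 0 1 - {0}")
        case True
        then have "(cmod (G w))\<^sup>2 * (pi * cmod w powr (2 * \<sigma> a) / (real a + 1))
            \<le> (\<integral>x. indicator H (x, w) * (cmod (f (x, w)))\<^sup>2 \<partial>lborel)" using elim by blast
        then have "(real a + 1) / pi * ((cmod (G w))\<^sup>2 * (pi * cmod w powr (2 * \<sigma> a) / (real a + 1)))
            \<le> (real a + 1) / pi * (\<integral>x. indicator H (x, w) * (cmod (f (x, w)))\<^sup>2 \<partial>lborel)"
          by (intro mult_left_mono) auto
        also have "(real a + 1) / pi * ((cmod (G w))\<^sup>2 * (pi * cmod w powr (2 * \<sigma> a) / (real a + 1))) = cmod w powr (2 * \<sigma> a) * (cmod (G w))\<^sup>2"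
          by (simp add: divide_simps)
        finally have "cmod w powr (2 * \<sigma> a) * (cmod (G w))\<^sup>2
            \<le> (real a + 1) / pi * (\<integral>x. indicator H (x, w) * (cmod (f (x, w)))\<^sup>2 \<partial>lborel)" .
        moreover have "norm (indicator (ball 0 1) w * (cmod w powr (2 * \<sigma> a) * (cmod (G w))\<^sup>2)) = cmod w powr (2 * \<sigma> a) * (cmod (G w))\<^sup>2"
          using True by simp
        ultimately show ?thesis unfolding real_norm_def by linarith
      next
        case False
        then have "norm (indicator (ball 0 1) w * (cmod w powr (2 * \<sigma> a) * (cmod (G w))\<^sup>2)) = 0" by auto
        then show ?thesis by (simp only: norm_ge_zero)
      qed
    qed
  qed
  obtain E where E: "E holomorphic_on ball 0 1" "\<And>w. w \<in> ball 0 1 - {0} \<Longrightarrow> G w = w powi \<beta> a * E w"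
    using punctured_disc_extension[OF holG \<sigma>_nonneg intG] unfolding \<beta>_def by blast
  have "mom f a l = (deriv ^^ l) E 0 / fact l * complex_of_real (pi\<^sup>2 * real m / ((real a + 1) * (real m * real l + d a)))" for l
  proof -
    note it = mom_iterated[OF bergman_measurable(1,2)[OF f] bergman_weight_integrable[OF f], of a l]
    have "mom f a l = (\<integral>w. \<integral>x. indicator H (x, w) *\<^sub>R (f (x, w) * cnj x ^ a * cnj w powi (\<beta> a + int l)) \<partial>lborel \<partial>lborel)"
      by (rule it(2))
    also have "\<dots> = (\<integral>w. complex_of_real (pi / (real a + 1)) * (complex_of_real (indicator (ball 0 1) w * cmod w powr (2 * \<sigma> a)) * G w * cnj w powi (\<beta> a + int l)) \<partial>lborel)"
    proof (rule integral_cong_AE)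
      show "(\<lambda>w. \<integral>x. indicator H (x, w) *\<^sub>R (f (x, w) * cnj x ^ a * cnj w powi (\<beta> a + int l)) \<partial>lborel) \<in> borel_measurable lborel"
        using it(1) by (rule borel_measurable_integrable)
      have "(\<lambda>w. indicator (ball 0 1 - {0}) w *\<^sub>R G w) \<in> borel_measurable borel"
        by (intro borel_measurable_continuous_on_indicator holomorphic_on_imp_continuous_on holG) auto
      then have "(\<lambda>w. complex_of_real (pi / (real a + 1)) * (complex_of_real (cmod w powr (2 * \<sigma> a)) * (indicator (ball 0 1 - {0}) w *\<^sub>R G w) * cnj w powi (\<beta> a + int l))) \<in> borel_measurable lborel"
        by measurable
      also have "(\<lambda>w. complex_of_real (pi / (real a + 1)) * (complex_of_real (cmod w powr (2 * \<sigma> a)) * (indicator (ball 0 1 - {0}) w *\<^sub>R G w) * cnj w powi (\<beta> a + int l)))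
        = (\<lambda>w. complex_of_real (pi / (real a + 1)) * (complex_of_real (indicator (ball 0 1) w * cmod w powr (2 * \<sigma> a)) * G w * cnj w powi (\<beta> a + int l)))"
        by (auto simp: fun_eq_iff indicator_def)
      finally show "(\<lambda>w. complex_of_real (pi / (real a + 1)) * (complex_of_real (indicator (ball 0 1) w * cmod w powr (2 * \<sigma> a)) * G w * cnj w powi (\<beta> a + int l))) \<in> borel_measurable lborel" .
      show "AE w in lborel. (\<integral>x. indicator H (x, w) *\<^sub>R (f (x, w) * cnj x ^ a * cnj w powi (\<beta> a + int l)) \<partial>lborel)
        = complex_of_real (pi / (real a + 1)) * (complex_of_real (indicator (ball 0 1) w * cmod w powr (2 * \<sigma> a)) * G w * cnj w powi (\<beta> a + int l))"
        using slice(2)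
      proof eventually_elim
        case (elim w)
        show ?case
        proof (cases "w \<in> ball 0 1 - {0}")
          case True
          have "(\<integral>x. indicator H (x, w) *\<^sub>R (f (x, w) * cnj x ^ a * cnj w powi (\<beta> a + int l)) \<partial>lborel) = (\<integral>x. cnj w powi (\<beta> a + int l) * (indicator H (x, w) * f (x, w) * cnj x ^ a) \<partial>lborel)"
            by (intro Bochner_Integration.integral_cong refl) (simp add: indicator_def)
          also have "\<dots> = cnj w powi (\<beta> a + int l) * (\<integral>x. indicator H (x, w) * f (x, w) * cnj x ^ a \<partial>lborel)"
            by (rule integral_mult_right_zero)
          also have "\<dots> = cnj w powi (\<beta> a + int l) * (G w * complex_of_real (pi * cmod w powr (2 * \<sigma> a) / (real a + 1)))"
            using elim True by simp
          finally show ?thesis using True by simp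
        next
          case False
          then have "(x, w) \<notin> H" for x by (auto simp: H_iff radius_def)
          then have "(\<integral>x. indicator H (x, w) *\<^sub>R (f (x, w) * cnj x ^ a * cnj w powi (\<beta> a + int l)) \<partial>lborel) = 0" by simp
          then show ?thesis using False by auto
        qed
      qed
    qed
    also have "\<dots> = complex_of_real (pi / (real a + 1)) * ((deriv ^^ l) E 0 / fact l * complex_of_real (pi / (of_int \<lfloor>- \<sigma> a\<rfloor> + real l + \<sigma> a + 1)))"
      unfolding integral_mult_right_zero \<beta>_def
      by (subst punctured_disc_moment[OF E(1) E(2)[unfolded \<beta>_def] intG]) simp_all
    also have "of_int \<lfloor>- \<sigma> a\<rfloor> + real l + \<sigma> a + 1 = (real m * real l + d a) / real m"
      using m by (simp add: d_def \<beta>_def field_simps)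
    finally show ?thesis by (simp add: power2_eq_square mult_ac)
  qed
  then show ?thesis using that E unfolding G_def by blast
qed

text \<open>The coefficients of \<open>row\<close> are reciprocal to the squared norms in
  \<open>bergman_moment\<close>. After cancellation the expansion is the Taylor series of
  \<open>E\<close>.\<close>

lemma bergman_row:
  assumes f: "f \<in> bergman_space H" and z: "z \<in> H"
  shows "(\<integral>w. f w * row a z w \<partial>M) = slice_coeff f a (snd z) * fst z ^ a"
proof -
  obtain E where E: "E holomorphic_on ball 0 1"
    "\<And>w. w \<in> ball 0 1 - {0} \<Longrightarrow> slice_coeff f a w = w powi \<beta> a * E w"
    "\<And>l. mom f a l = (deriv ^^ l) E 0 / fact l * complex_of_real (pi\<^sup>2 * real m / ((real a + 1) * (real m * real l + d a)))"
    using bergman_moment[OF f] by blast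
  note zH = H_D[OF z]
  have "(\<lambda>l. coef a z * of_real (real m * real l + d a) * snd z powi (\<beta> a + int l) * mom f a l)
     sums (\<integral>w. f w * row a z w \<partial>M)"
    by (rule row_expansion[OF z bergman_measurable(1)[OF f] bergman_weight_integrable[OF f]])
  also have "(\<lambda>l. coef a z * of_real (real m * real l + d a) * snd z powi (\<beta> a + int l) * mom f a l)
     = (\<lambda>l. fst z ^ a * snd z powi \<beta> a * ((deriv ^^ l) E 0 / fact l * (snd z - 0) ^ l))"
  proof
    fix l
    define D where "D = real m * real l + d a"
    have "D > 0" using d_bounds(1)[of a] unfolding D_def by (intro add_nonneg_pos) auto
    have "coef a z * of_real D * (snd z powi \<beta> a * snd z ^ l) * ((deriv ^^ l) E 0 / fact l * complex_of_real (pi\<^sup>2 * real m / ((real a + 1) * D)))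
      = fst z ^ a * snd z powi \<beta> a * ((deriv ^^ l) E 0 / fact l * snd z ^ l) * of_real ((real a + 1) / (real m * pi\<^sup>2) * D * (pi\<^sup>2 * real m / ((real a + 1) * D)))"
      unfolding coef_def of_real_mult by (simp only: mult_ac)
    also have "(real a + 1) / (real m * pi\<^sup>2) * D * (pi\<^sup>2 * real m / ((real a + 1) * D)) = 1"
      using \<open>D > 0\<close> m by (simp add: divide_simps)
    finally show "coef a z * of_real (real m * real l + d a) * snd z powi (\<beta> a + int l) * mom f a l
      = fst z ^ a * snd z powi \<beta> a * ((deriv ^^ l) E 0 / fact l * (snd z - 0) ^ l)"
      unfolding E(3) D_def[symmetric] using zH by (simp add: power_int_add)
  qed
  finally have "(\<lambda>l. fst z ^ a * snd z powi \<beta> a * ((deriv ^^ l) E 0 / fact l * (snd z - 0) ^ l)) sums (\<integral>w. f w * row a z w \<partial>M)" .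
  moreover have "(\<lambda>l. fst z ^ a * snd z powi \<beta> a * ((deriv ^^ l) E 0 / fact l * (snd z - 0) ^ l)) sums (fst z ^ a * snd z powi \<beta> a * E (snd z))"
    using zH by (intro sums_mult holomorphic_power_series[OF E(1)]) auto
  ultimately have "(\<integral>w. f w * row a z w \<partial>M) = fst z ^ a * snd z powi \<beta> a * E (snd z)" by (rule sums_unique2)
  then show ?thesis using E(2)[of "snd z"] zH by (simp add: mult_ac)
qed

lemma K_reproduces:
  assumes f: "f \<in> bergman_space H" and z: "z \<in> H"
  shows "(\<integral>w. f w * K z w \<partial>M) = f z"
proof -
  note zH = H_D[OF z]
  have "(\<lambda>x. f (x, snd z)) holomorphic_on {x. (x, snd z) \<in> H}"
    using f by (intro holomorphic2_on_slices open_H) (simp add: bergman_space_def)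
  then have hol: "(\<lambda>x. f (x, snd z)) holomorphic_on ball 0 (radius (snd z))"
    by (rule holomorphic_on_subset) (use zH in \<open>auto simp: H_iff\<close>)
  have "(\<lambda>a. slice_coeff f a (snd z) * fst z ^ a) sums f z"
    using holomorphic_power_series[OF hol, of "fst z"] zH by (simp add: slice_coeff_def)
  \<comment> \<open>A block of \<open>m\<close> consecutive exponents contains each residue once,
    which matches the grouping in \<open>kernel_expansion\<close>.\<close>
  then have "(\<lambda>k. \<Sum>a\<in>{k * m..<k * m + m}. slice_coeff f a (snd z) * fst z ^ a) sums f z"
    using m by (rule sums_group)
  also have "(\<lambda>k. \<Sum>a\<in>{k * m..<k * m + m}. slice_coeff f a (snd z) * fst z ^ a)
      = (\<lambda>k. \<Sum>j<m. \<integral>w. f w * row (m * k + j) z w \<partial>M)"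
  proof
    fix k
    have "(\<Sum>a\<in>{k * m..<k * m + m}. slice_coeff f a (snd z) * fst z ^ a) = (\<Sum>j<m. slice_coeff f (m * k + j) (snd z) * fst z ^ (m * k + j))"
      by (rule sum.reindex_bij_witness[of _ "\<lambda>j. m * k + j" "\<lambda>a. a - m * k"]) (auto simp: mult.commute)
    then show "(\<Sum>a\<in>{k * m..<k * m + m}. slice_coeff f a (snd z) * fst z ^ a) = (\<Sum>j<m. \<integral>w. f w * row (m * k + j) z w \<partial>M)"
      unfolding bergman_row[OF f z] .
  qed
  finally have "(\<lambda>k. \<Sum>j<m. \<integral>w. f w * row (m * k + j) z w \<partial>M) sums f z" .
  with kernel_expansion(2)[OF z bergman_measurable(1)[OF f] bergman_weight_integrable[OF f]]
  show ?thesis by (rule sums_unique2)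
qed

section \<open>The closed form is the Bergman kernel\<close>

lemma S_cnj: "S w z = cnj (S z w)" by (simp add: S_def mult.commute)
lemma T_cnj: "T w z = cnj (T z w)" by (simp add: T_def mult.commute)

lemma K_cnj: "K w z = cnj (K z w)"
  unfolding K_def K_part_def S_cnj[of w z] T_cnj[of w z]
  by (auto simp: arith_kernel_cnj mult_ac power_mult_distrib)

lemma K_part_bound:
  assumes z: "z \<in> H" and w: "w \<in> H" and j: "j < m"
  shows "cmod (K_part j z w) \<le> cmod (fst z) ^ j * cmod (snd z) powr of_int (\<beta> j) * (cmod (fst w) ^ j * cmod (snd w) powr of_int (\<beta> j))
     * (real m / (cmod (1 - S z w))\<^sup>2 * (real m / (cmod (1 - T z w))\<^sup>2) / (real m * pi\<^sup>2))"
proof -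
  have "cmod (K_part j z w) = cmod (fst z) ^ j * cmod (snd z) powr of_int (\<beta> j) * (cmod (fst w) ^ j * cmod (snd w) powr of_int (\<beta> j))
     * (cmod (arith_kernel m (real j + 1) (S z w)) * cmod (arith_kernel m (d j) (T z w)) / (real m * pi\<^sup>2))"
    unfolding K_part_def norm_divide norm_mult norm_power norm_T_powi[OF z w] norm_of_real
    by (simp add: power_mult_distrib)
  also have "\<dots> \<le> cmod (fst z) ^ j * cmod (snd z) powr of_int (\<beta> j) * (cmod (fst w) ^ j * cmod (snd w) powr of_int (\<beta> j))
     * (real m / (cmod (1 - S z w))\<^sup>2 * (real m / (cmod (1 - T z w))\<^sup>2) / (real m * pi\<^sup>2))"
    using d_bounds[of j] j
    by (intro mult_left_mono divide_right_mono mult_mono arith_kernel_le norm_S_less norm_T_less z w) auto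
  finally show ?thesis .
qed

lemma K_in_bergman:
  assumes w: "w \<in> H"
  shows "(\<lambda>z. K z w) \<in> bergman_space H"
proof -
  have hol: "holomorphic2_on (\<lambda>z. K z w) H"
  proof (rule holomorphic2_on_cong)
    show "(\<Sum>j<m. K_part j z w) = K z w" if "z \<in> H" for z using w that by (simp add: K_def)
    have w0: "snd w \<noteq> 0" using H_D[OF w] by simp
    have hS: "holomorphic2_on (\<lambda>z. S z w) H"
    proof -
      have "holomorphic2_on (\<lambda>z. (\<lambda>u. (u * cnj (fst w)) ^ m) (fst z) * (\<lambda>v. 1 / (v * cnj (snd w)) ^ n) (snd z)) H"
      proof (rule holomorphic2_on_mult)
        show "holomorphic2_on (\<lambda>z. (\<lambda>u. (u * cnj (fst w)) ^ m) (fst z)) H"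
          by (rule holomorphic2_on_compose[where T = UNIV]) (auto intro!: holomorphic_intros)
        show "holomorphic2_on (\<lambda>z. (\<lambda>v. 1 / (v * cnj (snd w)) ^ n) (snd z)) H"
          by (rule holomorphic2_on_compose[where T = "- {0}"]) (auto intro!: holomorphic_intros simp: w0 dest: H_D)
      qed
      then show ?thesis by (simp add: S_def)
    qed
    have hT: "holomorphic2_on (\<lambda>z. T z w) H"
      unfolding T_def by (intro holomorphic2_on_mult holomorphic2_on_snd holomorphic2_on_const)
    show "holomorphic2_on (\<lambda>z. \<Sum>j<m. K_part j z w) H"
    proof (rule holomorphic2_on_sum)
      fix j
      have 1: "holomorphic2_on (\<lambda>z. (\<lambda>u. (u * cnj (fst w)) ^ j) (fst z)) H"
        by (rule holomorphic2_on_compose[where T = UNIV]) (auto intro!: holomorphic_intros)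
      have 2: "holomorphic2_on (\<lambda>z. (\<lambda>t. t powi \<beta> j * (arith_kernel m (d j) t / of_real (real m * pi\<^sup>2))) (T z w)) H"
      \<comment> \<open>The origin must be removed: \<open>\<beta> j\<close> is negative, so
        \<open>t powi \<beta> j\<close> has a pole there.\<close>
      proof (rule holomorphic2_on_compose[OF hT, where T = "ball 0 1 - {0}"])
        show "(\<lambda>t. t powi \<beta> j * (arith_kernel m (d j) t / of_real (real m * pi\<^sup>2))) holomorphic_on ball 0 1 - {0}"
          unfolding arith_kernel_def using m by (intro holomorphic_intros) auto
        show "T z w \<in> ball 0 1 - {0}" if "z \<in> H" for z
          using norm_T_less[OF that w] H_D(1)[OF that] w0 by (simp add: T_def)
      qed auto
      have 3: "holomorphic2_on (\<lambda>z. arith_kernel m (real j + 1) (S z w)) H"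
      proof (rule holomorphic2_on_compose[OF hS, where T = "ball 0 1"])
        show "arith_kernel m (real j + 1) holomorphic_on ball 0 1"
          unfolding arith_kernel_def[abs_def] by (intro holomorphic_intros) auto
        show "S z w \<in> ball 0 1" if "z \<in> H" for z using norm_S_less[OF that w] by simp
      qed auto
      from holomorphic2_on_mult[OF holomorphic2_on_mult[OF 1 2] 3]
      show "holomorphic2_on (\<lambda>z. K_part j z w) H"
        by (simp add: K_part_def mult_ac)
    qed
  qed
  have K_meas: "(\<lambda>z. K z w) \<in> borel_measurable M"
    by (intro continuous_imp_measurable_on_sets_lebesgue holomorphic2_on_imp_continuous_on hol) simp
  \<comment> \<open>A constant in \<open>z\<close>: with \<open>w\<close> fixed, \<open>S\<close>
    and \<open>T\<close> are bounded in modulus by \<open>U w\<close> and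
    \<open>cmod (snd w)\<close>, so both denominators stay away from 0 uniformly on
    \<open>H\<close>.\<close>
  define D where "D = (\<Sum>j<m. cmod (fst w) ^ j * cmod (snd w) powr of_int (\<beta> j) * (real m / (1 - U w)\<^sup>2 * (real m / (1 - cmod (snd w))\<^sup>2) / (real m * pi\<^sup>2)))"
  have bound: "cmod (K z w) \<le> D * cmod (snd z) powr (- \<kappa>)" if z: "z \<in> H" for z
  proof -
    have "cmod (K z w) \<le> (\<Sum>j<m. cmod (K_part j z w))" using z w by (simp add: K_def norm_sum)
    also have "\<dots> \<le> (\<Sum>j<m. cmod (snd z) powr (- \<kappa>) * (cmod (fst w) ^ j * cmod (snd w) powr of_int (\<beta> j)) * (real m / (1 - U w)\<^sup>2 * (real m / (1 - cmod (snd w))\<^sup>2) / (real m * pi\<^sup>2)))"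
    proof (rule sum_mono)
      fix j assume j: "j \<in> {..<m}"
      have s: "1 - U w \<le> cmod (1 - S z w)"
        using norm_S_le[OF w z] U_bounds[OF w] by (intro one_minus_norm_le) (auto simp: S_cnj[of w z])
      have t: "1 - cmod (snd w) \<le> cmod (1 - T z w)"
        using norm_T_le[OF w z] H_D[OF w] by (intro one_minus_norm_le) (auto simp: T_cnj[of w z])
      have "cmod (K_part j z w) \<le> cmod (fst z) ^ j * cmod (snd z) powr of_int (\<beta> j) * (cmod (fst w) ^ j * cmod (snd w) powr of_int (\<beta> j))
     * (real m / (cmod (1 - S z w))\<^sup>2 * (real m / (cmod (1 - T z w))\<^sup>2) / (real m * pi\<^sup>2))"
        using j by (intro K_part_bound z w) auto
      also have "\<dots> \<le> cmod (snd z) powr (- \<kappa>) * (cmod (fst w) ^ j * cmod (snd w) powr of_int (\<beta> j)) * (real m / (1 - U w)\<^sup>2 * (real m / (1 - cmod (snd w))\<^sup>2) / (real m * pi\<^sup>2))"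
        using s t U_bounds[OF w] H_D[OF w]
        by (intro mult_mono divide_right_mono divide_left_mono power_mono monomial_le z mult_pos_pos zero_less_power)
          (auto intro!: mult_nonneg_nonneg divide_nonneg_nonneg)
      finally show "cmod (K_part j z w) \<le> cmod (snd z) powr (- \<kappa>) * (cmod (fst w) ^ j * cmod (snd w) powr of_int (\<beta> j)) * (real m / (1 - U w)\<^sup>2 * (real m / (1 - cmod (snd w))\<^sup>2) / (real m * pi\<^sup>2))" .
    qed
    also have "\<dots> = D * cmod (snd z) powr (- \<kappa>)"
      unfolding D_def sum_distrib_right by (intro sum.cong refl) (simp only: mult_ac)
    finally show ?thesis .
  qed
  have "integrable M (\<lambda>z. (cmod (K z w))\<^sup>2)"
  proof (rule Bochner_Integration.integrable_bound)
    show "integrable M (\<lambda>z. D\<^sup>2 * cmod (snd z) powr (2 * (- \<kappa>)))"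
      by (intro integrable_mult_right integrable_M_snd_powr \<kappa>_less)
    show "(\<lambda>z. (cmod (K z w))\<^sup>2) \<in> borel_measurable M" using K_meas by measurable
    show "AE z in M. norm ((cmod (K z w))\<^sup>2) \<le> norm (D\<^sup>2 * cmod (snd z) powr (2 * (- \<kappa>)))"
    proof (rule AE_I2)
      fix z assume "z \<in> space M"
      then have "cmod (K z w) \<le> D * cmod (snd z) powr (- \<kappa>)" by (intro bound) simp
      then have "(cmod (K z w))\<^sup>2 \<le> (D * cmod (snd z) powr (- \<kappa>))\<^sup>2" by (intro power_mono) auto
      also have "\<dots> = D\<^sup>2 * cmod (snd z) powr (2 * (- \<kappa>))"
        by (simp only: power_mult_distrib) (simp add: power2_eq_square flip: powr_add)
      finally show "norm ((cmod (K z w))\<^sup>2) \<le> norm (D\<^sup>2 * cmod (snd z) powr (2 * (- \<kappa>)))" by simp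
    qed
  qed
  with hol show ?thesis by (simp add: bergman_space_def)
qed

lemma bergman_kernel_eq: "bergman_kernel H = K"
proof -
  have "reproducing_kernel H K"
    unfolding reproducing_kernel_def
  proof (intro conjI ballI allI impI)
    show "(\<lambda>z. K z w) \<in> bergman_space H" if "w \<in> H" for w using that by (rule K_in_bergman)
    show "f z = (\<integral>w. f w * cnj (K w z) \<partial>M)" if "f \<in> bergman_space H" "z \<in> H" for f z
      using K_reproduces[OF that] by (simp flip: K_cnj)
    show "K z w = 0" if "z \<notin> H \<or> w \<notin> H" for z w using that by (auto simp: K_def)
  qed
  then show ?thesis
    unfolding bergman_kernel_def using reproducing_kernel_unique by blast
qed

end

section \<open>The Schur test\<close>

text \<open>This pointwise inequality, with \<open>s\<close> optimised afterwards, takes the place of Hoelder's inequality.\<close>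

lemma weighted_split:
  fixes x :: real
  assumes "x \<ge> 0" "\<phi> > 0" "s > 0" "p > 1"
  shows "x \<le> s * \<phi> + s powr (1 - p) * (\<phi> powr (1 - p) * x powr p)"
proof (cases "x \<le> s * \<phi>")
  case True
  then show ?thesis using assms by (simp add: add_increasing2)
next
  case False
  then have x: "x > s * \<phi>" "x > 0" using assms by (auto intro: order.strict_trans[OF mult_pos_pos])
  have "1 \<le> (x / (s * \<phi>)) powr (p - 1)"
    using x assms by (intro ge_one_powr_ge_zero) (auto simp: field_simps)
  then have "x * 1 \<le> x * (x / (s * \<phi>)) powr (p - 1)" using x by (intro mult_left_mono) auto
  also have "(x / (s * \<phi>)) powr (p - 1) = x powr (p - 1) * (s powr (1 - p) * \<phi> powr (1 - p))"
  proof -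
    have "(x / (s * \<phi>)) powr (p - 1) = x powr (p - 1) / (s powr (p - 1) * \<phi> powr (p - 1))"
      using x assms by (simp add: powr_divide powr_mult)
    also have "\<dots> = x powr (p - 1) * (s powr (- (p - 1)) * \<phi> powr (- (p - 1)))"
      by (simp only: powr_minus) (simp add: field_simps)
    finally show ?thesis by simp
  qed
  also have "x * (x powr (p - 1) * (s powr (1 - p) * \<phi> powr (1 - p))) = s powr (1 - p) * (\<phi> powr (1 - p) * x powr p)"
  proof -
    have "x powr p = x * x powr (p - 1)" using x by (simp add: powr_diff)
    then show ?thesis by (simp only: mult_ac)
  qed
  finally show ?thesis using assms by (simp add: add_increasing)
qed

text \<open>If \<open>q\<close> is the conjugate exponent and \<open>\<phi>\<close> is the
  \<open>q\<close>-th power of a function, then \<open>\<phi> powr (p - 1)\<close> is its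
  \<open>p\<close>-th power, so these are the two usual Schur conditions. At each point
  \<open>weighted_split\<close> is integrated against the kernel and optimised in \<open>s\<close>.
  The second condition enters only after Tonelli, in \<open>QI\<close>.\<close>

lemma schur_test:
  fixes k :: "'a \<Rightarrow> 'a \<Rightarrow> complex" and \<phi> :: "'a \<Rightarrow> real"
  assumes sf: "sigma_finite_measure M" and p: "p > 1"
    and k[measurable]: "case_prod k \<in> borel_measurable (M \<Otimes>\<^sub>M M)"
    and \<phi>[measurable]: "\<phi> \<in> borel_measurable M" and \<phi>_pos: "\<And>x. x \<in> space M \<Longrightarrow> \<phi> x > 0"
    and A0: "A \<ge> 0" and B0: "B \<ge> 0"
    and A: "\<And>x. x \<in> space M \<Longrightarrow> (\<integral>\<^sup>+y. ennreal (cmod (k x y) * \<phi> y) \<partial>M) \<le> ennreal (A * \<phi> x)"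
    and B: "\<And>y. y \<in> space M \<Longrightarrow> (\<integral>\<^sup>+x. ennreal (cmod (k x y) * \<phi> x powr (p - 1)) \<partial>M) \<le> ennreal (B * \<phi> y powr (p - 1))"
  shows "integral_operator_bounded_on_Lp p M k"
proof -
  interpret sigma_finite_measure M by (rule sf)
  interpret P: pair_sigma_finite M M ..
  have "(AE x in M. integrable M (\<lambda>y. k x y * f y)) \<and> in_Lp p M (integral_operator M k f) \<and>
      Lp_norm p M (integral_operator M k f) \<le> ((A + 1) powr p * B) powr (1 / p) * Lp_norm p M f"
    if f: "in_Lp p M f" for f
  proof -
    have [measurable]: "f \<in> borel_measurable M" and fint: "integrable M (\<lambda>x. cmod (f x) powr p)"
      using f by (auto simp: in_Lp_def)
    \<comment> \<open>The part of the splitting that contains \<open>f\<close>. The weight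
      \<open>\<phi> y powr (1 - p)\<close> is compensated by the factor
      \<open>\<phi> y powr (p - 1)\<close> that condition \<open>B\<close> produces in
      \<open>QI\<close>.\<close>
    define Q where "Q x = (\<integral>\<^sup>+y. ennreal (cmod (k x y) * (\<phi> y powr (1 - p) * cmod (f y) powr p)) \<partial>M)" for x
    define N where "N x = (\<integral>\<^sup>+y. ennreal (cmod (k x y * f y)) \<partial>M)" for x
    define I where "I = (\<integral>x. cmod (f x) powr p \<partial>M)"
    have I0: "I \<ge> 0" unfolding I_def by (intro integral_nonneg_AE AE_I2) simp
    have Ieq: "(\<integral>\<^sup>+x. ennreal (cmod (f x) powr p) \<partial>M) = ennreal I"
      unfolding I_def by (rule nn_integral_eq_integral[OF fint]) simp
    have [measurable]: "Q \<in> borel_measurable M" unfolding Q_def by measurable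
    have QI: "(\<integral>\<^sup>+x. ennreal (\<phi> x powr (p - 1)) * Q x \<partial>M) \<le> ennreal (B * I)"
    proof -
      have "(\<integral>\<^sup>+x. ennreal (\<phi> x powr (p - 1)) * Q x \<partial>M)
        = (\<integral>\<^sup>+x. \<integral>\<^sup>+y. ennreal (\<phi> y powr (1 - p) * cmod (f y) powr p) * ennreal (cmod (k x y) * \<phi> x powr (p - 1)) \<partial>M \<partial>M)"
        unfolding Q_def
      proof (intro nn_integral_cong)
        fix x assume x: "x \<in> space M"
        have [measurable]: "(\<lambda>y. k x y) \<in> borel_measurable M" using x by measurable
        have "ennreal (\<phi> x powr (p - 1)) * (\<integral>\<^sup>+y. ennreal (cmod (k x y) * (\<phi> y powr (1 - p) * cmod (f y) powr p)) \<partial>M)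
          = (\<integral>\<^sup>+y. ennreal (\<phi> x powr (p - 1)) * ennreal (cmod (k x y) * (\<phi> y powr (1 - p) * cmod (f y) powr p)) \<partial>M)"
          by (rule nn_integral_cmult[symmetric]) measurable
        then show "ennreal (\<phi> x powr (p - 1)) * (\<integral>\<^sup>+y. ennreal (cmod (k x y) * (\<phi> y powr (1 - p) * cmod (f y) powr p)) \<partial>M)
          = (\<integral>\<^sup>+y. ennreal (\<phi> y powr (1 - p) * cmod (f y) powr p) * ennreal (cmod (k x y) * \<phi> x powr (p - 1)) \<partial>M)"
          by (simp add: mult_ac flip: ennreal_mult)
      qed
      also have "\<dots> = (\<integral>\<^sup>+y. \<integral>\<^sup>+x. ennreal (\<phi> y powr (1 - p) * cmod (f y) powr p) * ennreal (cmod (k x y) * \<phi> x powr (p - 1)) \<partial>M \<partial>M)"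
        by (rule P.Fubini') measurable
      also have "\<dots> = (\<integral>\<^sup>+y. ennreal (\<phi> y powr (1 - p) * cmod (f y) powr p) * (\<integral>\<^sup>+x. ennreal (cmod (k x y) * \<phi> x powr (p - 1)) \<partial>M) \<partial>M)"
        by (intro nn_integral_cong nn_integral_cmult) measurable
      also have "\<dots> \<le> (\<integral>\<^sup>+y. ennreal B * ennreal (cmod (f y) powr p) \<partial>M)"
      proof (intro nn_integral_mono)
        fix y assume y: "y \<in> space M"
        have "ennreal (\<phi> y powr (1 - p) * cmod (f y) powr p) * (\<integral>\<^sup>+x. ennreal (cmod (k x y) * \<phi> x powr (p - 1)) \<partial>M)
          \<le> ennreal (\<phi> y powr (1 - p) * cmod (f y) powr p) * ennreal (B * \<phi> y powr (p - 1))"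
          by (intro mult_left_mono B y) simp
        also have "\<dots> = ennreal B * ennreal (cmod (f y) powr p)"
        proof -
          have "\<phi> y powr (1 - p) * \<phi> y powr (p - 1) = 1"
            using \<phi>_pos[OF y] by (simp flip: powr_add)
          then have "\<phi> y powr (1 - p) * cmod (f y) powr p * (B * \<phi> y powr (p - 1)) = B * cmod (f y) powr p"
            by (metis (no_types, opaque_lifting) mult.assoc mult.commute mult.right_neutral)
          then show ?thesis using B0 by (simp flip: ennreal_mult)
        qed
        finally show "ennreal (\<phi> y powr (1 - p) * cmod (f y) powr p) * (\<integral>\<^sup>+x. ennreal (cmod (k x y) * \<phi> x powr (p - 1)) \<partial>M)
          \<le> ennreal B * ennreal (cmod (f y) powr p)" .
      qed
      also have "\<dots> = ennreal (B * I)"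
        using B0 by (subst nn_integral_cmult) (auto simp: Ieq ennreal_mult')
      finally show ?thesis .
    qed
    have "(\<integral>\<^sup>+x. ennreal (\<phi> x powr (p - 1)) * Q x \<partial>M) < \<infinity>"
      by (rule order.strict_trans1[OF QI]) simp
    then have "AE x in M. ennreal (\<phi> x powr (p - 1)) * Q x \<noteq> \<infinity>"
      by (intro nn_integral_PInf_AE) auto
    then have Qfin: "AE x in M. Q x \<noteq> \<infinity>"
      using AE_space
    proof eventually_elim
      case (elim x)
      then show ?case using \<phi>_pos[of x] by (auto simp: ennreal_mult_eq_top_iff)
    qed
    have Nle: "N x \<le> ennreal (A * \<phi> x * s + s powr (1 - p) * enn2real (Q x))"
      if x: "x \<in> space M" and q: "Q x \<noteq> \<infinity>" and s: "s > 0" for x s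
    proof -
      have "N x \<le> (\<integral>\<^sup>+y. ennreal s * ennreal (cmod (k x y) * \<phi> y) + ennreal (s powr (1 - p)) * ennreal (cmod (k x y) * (\<phi> y powr (1 - p) * cmod (f y) powr p)) \<partial>M)"
        unfolding N_def
      proof (intro nn_integral_mono)
        fix y assume y: "y \<in> space M"
        have "cmod (k x y) * cmod (f y) \<le> cmod (k x y) * (s * \<phi> y + s powr (1 - p) * (\<phi> y powr (1 - p) * cmod (f y) powr p))"
          using \<phi>_pos[OF y] s p by (intro mult_left_mono weighted_split) auto
        then have "ennreal (cmod (k x y * f y)) \<le> ennreal (s * (cmod (k x y) * \<phi> y) + s powr (1 - p) * (cmod (k x y) * (\<phi> y powr (1 - p) * cmod (f y) powr p)))"
          by (intro ennreal_leI) (simp add: norm_mult algebra_simps)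
        then show "ennreal (cmod (k x y * f y)) \<le> ennreal s * ennreal (cmod (k x y) * \<phi> y) + ennreal (s powr (1 - p)) * ennreal (cmod (k x y) * (\<phi> y powr (1 - p) * cmod (f y) powr p))"
          using s \<phi>_pos[OF y] by (simp add: ennreal_plus ennreal_mult')
      qed
      also have "\<dots> = ennreal s * (\<integral>\<^sup>+y. ennreal (cmod (k x y) * \<phi> y) \<partial>M) + ennreal (s powr (1 - p)) * Q x"
      proof -
        have [measurable]: "(\<lambda>y. k x y) \<in> borel_measurable M" using x by measurable
        have 1: "(\<lambda>y. ennreal (cmod (k x y) * \<phi> y)) \<in> borel_measurable M" by measurable
        have 2: "(\<lambda>y. ennreal (cmod (k x y) * (\<phi> y powr (1 - p) * cmod (f y) powr p))) \<in> borel_measurable M"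
          by measurable
        show ?thesis unfolding Q_def nn_integral_cmult[OF 1, symmetric] nn_integral_cmult[OF 2, symmetric]
          by (rule nn_integral_add) (use 1 2 in measurable)
      qed
      also have "\<dots> \<le> ennreal s * ennreal (A * \<phi> x) + ennreal (s powr (1 - p)) * Q x"
        by (intro add_right_mono mult_left_mono A x) simp
      also have "Q x = ennreal (enn2real (Q x))" using q by (simp add: ennreal_enn2real_if)
      also have "ennreal s * ennreal (A * \<phi> x) + ennreal (s powr (1 - p)) * ennreal (enn2real (Q x))
         = ennreal (A * \<phi> x * s + s powr (1 - p) * enn2real (Q x))"
        using s A0 less_imp_le[OF \<phi>_pos[OF x]]
        by (subst ennreal_plus) (auto simp: ennreal_mult enn2real_nonneg mult_ac)
      finally show ?thesis .
    qed
    have Npow: "N x \<noteq> \<infinity> \<and> enn2real (N x) powr p \<le> (A + 1) powr p * (\<phi> x powr (p - 1) * enn2real (Q x))"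
      if x: "x \<in> space M" and q: "Q x \<noteq> \<infinity>" for x
    proof -
      define q where "q = enn2real (Q x)"
      have fin: "N x \<noteq> \<infinity>" using Nle[OF x that(2), of 1] by (auto simp: top_unique)
      have Nr: "enn2real (N x) \<le> A * \<phi> x * s + s powr (1 - p) * q" if "s > 0" for s
        using Nle[OF x \<open>Q x \<noteq> \<infinity>\<close> that] \<phi>_pos[OF x] A0 that unfolding q_def
        by (intro enn2real_leI) (auto simp: enn2real_nonneg)
      note \<phi>x = \<phi>_pos[OF x]
      have "enn2real (N x) powr p \<le> (A + 1) powr p * (\<phi> x powr (p - 1) * q)"
      proof (cases "q = 0")
        case True
        have "enn2real (N x) \<le> 0"
        \<comment> \<open>For \<open>q = 0\<close> no optimal \<open>s\<close> exists; the bound is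
          \<open>A * \<phi> x * s\<close> for every \<open>s > 0\<close>, and a small
          \<open>s\<close> is taken. The summand 1 in the denominator covers
          \<open>A = 0\<close>.\<close>
        proof (rule field_le_epsilon)
          fix e :: real assume e: "e > 0"
          have "enn2real (N x) \<le> A * \<phi> x * (e / (A * \<phi> x + 1))"
            using Nr[of "e / (A * \<phi> x + 1)"] e A0 \<phi>x True by (simp add: add_nonneg_pos)
          also have "\<dots> \<le> e" using e A0 \<phi>x by (simp add: divide_simps add_nonneg_pos mult_right_mono)
          finally show "enn2real (N x) \<le> 0 + e" by simp
        qed
        then have "enn2real (N x) = 0" using enn2real_nonneg[of "N x"] by linarith
        then show ?thesis using True by simp
      next
        case False
        then have q0: "q > 0" unfolding q_def using enn2real_nonneg[of "Q x"] by linarith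
        \<comment> \<open>Chosen so that \<open>s powr (1 - p) * q\<close> becomes
          \<open>s * \<phi> x\<close>; both terms then combine with the constant
          \<open>A + 1\<close>.\<close>
        define s where "s = (q / \<phi> x) powr (1 / p)"
        have s: "s > 0" using q0 \<phi>x by (simp add: s_def)
        have sp: "s powr p = q / \<phi> x" using p q0 \<phi>x by (simp add: s_def powr_powr)
        have "s powr (1 - p) = s / s powr p" using s by (simp add: powr_diff)
        then have "s powr (1 - p) * q = s * \<phi> x" unfolding sp using q0 \<phi>x by simp
        then have "enn2real (N x) \<le> (A + 1) * (s * \<phi> x)" using Nr[OF s] by (simp add: algebra_simps)
        then have "enn2real (N x) powr p \<le> ((A + 1) * (s * \<phi> x)) powr p"
          using p by (intro powr_mono2) (auto simp: enn2real_nonneg)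
        also have "\<dots> = (A + 1) powr p * (s powr p * \<phi> x powr p)"
          using A0 s \<phi>x by (simp add: powr_mult)
        also have "s powr p * \<phi> x powr p = \<phi> x powr (p - 1) * q"
          unfolding sp using \<phi>x by (simp add: powr_diff)
        finally show ?thesis .
      qed
      with fin show ?thesis by (simp add: q_def)
    qed
    have integ: "AE x in M. integrable M (\<lambda>y. k x y * f y)"
      using Qfin AE_space
    proof eventually_elim
      case (elim x)
      show ?case
      proof (rule integrableI_bounded)
        show "(\<lambda>y. k x y * f y) \<in> borel_measurable M" using elim by measurable
        show "(\<integral>\<^sup>+y. ennreal (norm (k x y * f y)) \<partial>M) < \<infinity>"
          using Npow[of x] elim by (simp add: N_def less_top)
      qed
    qed
    define g where "g = integral_operator M k f"
    have [measurable]: "g \<in> borel_measurable M"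
      unfolding g_def integral_operator_def[abs_def] by measurable
    have gp: "AE x in M. ennreal (cmod (g x) powr p) \<le> ennreal ((A + 1) powr p) * (ennreal (\<phi> x powr (p - 1)) * Q x)"
      using Qfin AE_space integ
    proof eventually_elim
      case (elim x)
      have "ennreal (cmod (g x)) \<le> N x"
        unfolding g_def integral_operator_def N_def by (rule integral_norm_bound_ennreal) (use elim in simp)
      then have "cmod (g x) \<le> enn2real (N x)"
        using Npow[of x] elim by (metis enn2real_ennreal enn2real_mono infinity_ennreal_def less_top norm_ge_zero)
      then have "cmod (g x) powr p \<le> enn2real (N x) powr p" using p by (intro powr_mono2) auto
      also have "\<dots> \<le> (A + 1) powr p * (\<phi> x powr (p - 1) * enn2real (Q x))" using Npow[of x] elim by simp
      finally have "ennreal (cmod (g x) powr p) \<le> ennreal ((A + 1) powr p * (\<phi> x powr (p - 1) * enn2real (Q x)))"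
        by (rule ennreal_leI)
      also have "\<dots> = ennreal ((A + 1) powr p) * (ennreal (\<phi> x powr (p - 1)) * ennreal (enn2real (Q x)))"
        by (simp add: ennreal_mult)
      also have "ennreal (enn2real (Q x)) = Q x" using elim by (simp add: ennreal_enn2real_if)
      finally show ?case .
    qed
    have "(\<integral>\<^sup>+x. ennreal (cmod (g x) powr p) \<partial>M) \<le> (\<integral>\<^sup>+x. ennreal ((A + 1) powr p) * (ennreal (\<phi> x powr (p - 1)) * Q x) \<partial>M)"
      by (rule nn_integral_mono_AE[OF gp])
    also have "\<dots> = ennreal ((A + 1) powr p) * (\<integral>\<^sup>+x. ennreal (\<phi> x powr (p - 1)) * Q x \<partial>M)"
      by (rule nn_integral_cmult) measurable
    also have "\<dots> \<le> ennreal ((A + 1) powr p) * ennreal (B * I)" by (intro mult_left_mono QI) simp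
    also have "\<dots> = ennreal ((A + 1) powr p * B * I)" by (simp add: ennreal_mult'[symmetric] mult.assoc)
    finally have gI: "(\<integral>\<^sup>+x. ennreal (cmod (g x) powr p) \<partial>M) \<le> ennreal ((A + 1) powr p * B * I)" .
    have gint: "integrable M (\<lambda>x. cmod (g x) powr p)"
    proof (rule integrableI_bounded)
      show "(\<integral>\<^sup>+x. ennreal (norm (cmod (g x) powr p)) \<partial>M) < \<infinity>"
        using order.strict_trans1[OF gI] by simp
    qed measurable
    have "ennreal (\<integral>x. cmod (g x) powr p \<partial>M) \<le> ennreal ((A + 1) powr p * B * I)"
      using gI by (subst (asm) nn_integral_eq_integral[OF gint]) auto
    then have "(\<integral>x. cmod (g x) powr p \<partial>M) \<le> (A + 1) powr p * B * I"
      using B0 I0 by (simp add: ennreal_le_iff)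
    then have "Lp_norm p M g \<le> ((A + 1) powr p * B * I) powr (1 / p)"
      unfolding Lp_norm_def using p by (intro powr_mono2 integral_nonneg_AE AE_I2) auto
    also have "\<dots> = ((A + 1) powr p * B) powr (1 / p) * Lp_norm p M f"
      unfolding Lp_norm_def I_def[symmetric] using B0 I0 by (subst powr_mult) auto
    finally show ?thesis using integ gint by (simp add: in_Lp_def flip: g_def)
  qed
  then show ?thesis unfolding integral_operator_bounded_on_Lp_def by blast
qed

section \<open>Upper bounds for the Berezin kernel\<close>

lemma nn_integral_complex_scale:
  fixes g :: "complex \<Rightarrow> ennreal"
  assumes [measurable]: "g \<in> borel_measurable borel" and r: "r > 0"
  shows "(\<integral>\<^sup>+x. g x \<partial>lborel) = ennreal (r\<^sup>2) * (\<integral>\<^sup>+x. g (of_real r * x) \<partial>lborel)"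
proof -
  have "(\<integral>\<^sup>+x. g x \<partial>lborel) = (\<integral>\<^sup>+x. g x \<partial>density (distr lborel borel (\<lambda>x::complex. 0 + r *\<^sub>R x)) (\<lambda>_. \<bar>r\<bar> ^ DIM(complex)))"
    using r by (subst lborel_affine[of r 0, symmetric]) auto
  also have "\<dots> = ennreal (r\<^sup>2) * (\<integral>\<^sup>+x. g (of_real r * x) \<partial>lborel)"
    using r by (simp add: nn_integral_density nn_integral_distr nn_integral_cmult scaleR_conv_of_real)
  finally show ?thesis .
qed

context hartogs begin

text \<open>Each slice is rescaled to the unit disc. The slice integral then has the form of
  \<open>forelli_rudin_disc\<close> with a parameter of modulus \<open>U z\<close>, the same for
  every \<open>v\<close>, so its bound factors out. What remains is the disc integral with
  \<open>m = 1\<close>, the half exponent being raised by \<open>n / m\<close> through the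
  Jacobian.\<close>

lemma forelli_rudin_hartogs:
  assumes \<gamma>: "\<gamma> + real n / real m > -1" and b: "-1 < b" "b < 2"
  obtains C where "C > 0"
    "\<And>z. z \<in> H \<Longrightarrow> (\<integral>\<^sup>+w. ennreal (cmod (snd w) powr (2 * \<gamma>) * ((1 - (U w)\<^sup>2) powr b * (1 - (cmod (snd w))\<^sup>2) powr b)
        / (cmod (1 - S z w) ^ 4 * cmod (1 - T z w) ^ 4)) \<partial>M)
      \<le> ennreal (C * ((1 - (U z)\<^sup>2) powr (b - 2) * (1 - (cmod (snd z))\<^sup>2) powr (b - 2)))"
proof -
  obtain C1 where C1: "C1 > 0" and FR1: "\<And>\<mu>. cmod \<mu> < 1 \<Longrightarrow>
      (\<integral>\<^sup>+z. ennreal (cmod z powr (2 * 0) * (1 - cmod z ^ (2 * m)) powr b / cmod (1 - \<mu> * z ^ m) ^ 4)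
          * indicator (ball 0 1) z \<partial>lborel) \<le> ennreal (C1 * (1 - (cmod \<mu>)\<^sup>2) powr (b - 2))"
    by (rule forelli_rudin_disc[OF m _ b, of 0]) auto
  obtain C2 where C2: "C2 > 0" and FR2: "\<And>\<mu>. cmod \<mu> < 1 \<Longrightarrow>
      (\<integral>\<^sup>+z. ennreal (cmod z powr (2 * (\<gamma> + real n / real m)) * (1 - cmod z ^ (2 * 1)) powr b / cmod (1 - \<mu> * z ^ 1) ^ 4)
          * indicator (ball 0 1) z \<partial>lborel) \<le> ennreal (C2 * (1 - (cmod \<mu>)\<^sup>2) powr (b - 2))"
    by (rule forelli_rudin_disc[OF _ \<gamma> b, of 1]) auto
  have "(\<integral>\<^sup>+w. ennreal (cmod (snd w) powr (2 * \<gamma>) * ((1 - (U w)\<^sup>2) powr b * (1 - (cmod (snd w))\<^sup>2) powr b)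
        / (cmod (1 - S z w) ^ 4 * cmod (1 - T z w) ^ 4)) \<partial>M)
      \<le> ennreal (C1 * C2 * ((1 - (U z)\<^sup>2) powr (b - 2) * (1 - (cmod (snd z))\<^sup>2) powr (b - 2)))"
    if z: "z \<in> H" for z
  proof -
    note zH = H_D[OF z]
    define X where "X = C1 * (1 - (U z)\<^sup>2) powr (b - 2)"
    have X: "X \<ge> 0" using C1 by (simp add: X_def)
    define g where "g w = ennreal (cmod (snd w) powr (2 * \<gamma>) * ((1 - (U w)\<^sup>2) powr b * (1 - (cmod (snd w))\<^sup>2) powr b)
        / (cmod (1 - S z w) ^ 4 * cmod (1 - T z w) ^ 4))" for w
    have [measurable]: "g \<in> borel_measurable borel"
      unfolding g_def[abs_def] U_def S_def T_def by measurable
    define Y where "Y v = ennreal (cmod v powr (2 * (\<gamma> + real n / real m)) * (1 - cmod v ^ (2 * 1)) powr b / cmod (1 - cnj (snd z) * v ^ 1) ^ 4) * indicator (ball 0 1) v" for v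
    have [measurable]: "ball (0::complex) r \<in> sets borel" for r by simp
    have inner: "(\<integral>\<^sup>+x. g (x, v) * indicator (ball 0 (radius v)) x \<partial>lborel) * indicator (ball 0 1) v \<le> ennreal X * Y v" for v
    proof (cases "v \<in> ball 0 1 - {0}")
      case False
      then have "v = 0 \<or> v \<notin> ball 0 1" by auto
      then show ?thesis by (auto simp: radius_def)
    next
      case True
      then have v: "v \<noteq> 0" "cmod v < 1" by auto
      define r where "r = radius v"
      have r: "r > 0" unfolding r_def by (rule radius_pos[OF v(1)])
      have rm: "r ^ m = cmod v ^ n" unfolding r_def by (rule radius_power[OF v(1)])
      define c where "c = cmod v powr (2 * \<gamma>) * (1 - (cmod v)\<^sup>2) powr b / cmod (1 - T z (0, v)) ^ 4"
      have c: "c \<ge> 0" by (simp add: c_def)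
      \<comment> \<open>Conjugated because \<open>S z w\<close> is antiholomorphic in
        \<open>w\<close>. In the modulus the power of the radius cancels against that of
        \<open>v\<close>.\<close>
      define \<mu> where "\<mu> = cnj (fst z ^ m * of_real (r ^ m) / (snd z * cnj v) ^ n)"
      have \<mu>: "cmod \<mu> = U z"
        unfolding \<mu>_def complex_mod_cnj norm_divide norm_mult norm_power norm_of_real using r v
        by (simp add: rm U_def power_mult_distrib)
      have gx: "g (of_real r * x, v) = ennreal c * ennreal ((1 - cmod x ^ (2 * m)) powr b / cmod (1 - \<mu> * x ^ m) ^ 4)" for x
      proof -
        have "U (of_real r * x, v) = cmod x ^ m"
          using r v by (simp add: U_def norm_mult power_mult_distrib rm)
        then have u: "(U (of_real r * x, v))\<^sup>2 = cmod x ^ (2 * m)"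
          by (simp add: power_even_eq)
        have "S z (of_real r * x, v) = cnj (\<mu> * x ^ m)"
          by (simp add: S_def \<mu>_def power_mult_distrib)
        then have "1 - S z (of_real r * x, v) = cnj (1 - \<mu> * x ^ m)" by simp
        then have s: "cmod (1 - S z (of_real r * x, v)) = cmod (1 - \<mu> * x ^ m)"
          by (simp only: complex_mod_cnj)
        have t: "T z (of_real r * x, v) = T z (0, v)" by (simp add: T_def)
        have "g (of_real r * x, v) = ennreal (c * ((1 - cmod x ^ (2 * m)) powr b / cmod (1 - \<mu> * x ^ m) ^ 4))"
          unfolding g_def u s t c_def by (simp add: mult_ac)
        then show ?thesis by (simp only: ennreal_mult'[OF c])
      qed
      have "(\<integral>\<^sup>+x. g (x, v) * indicator (ball 0 (radius v)) x \<partial>lborel)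
        = ennreal (r\<^sup>2) * (\<integral>\<^sup>+x. g (of_real r * x, v) * indicator (ball 0 (radius v)) (of_real r * x) \<partial>lborel)"
        by (rule nn_integral_complex_scale[OF _ r]) measurable
      also have "(\<integral>\<^sup>+x. g (of_real r * x, v) * indicator (ball 0 (radius v)) (of_real r * x) \<partial>lborel)
        = (\<integral>\<^sup>+x. ennreal c * (ennreal (cmod x powr (2 * 0) * (1 - cmod x ^ (2 * m)) powr b / cmod (1 - \<mu> * x ^ m) ^ 4) * indicator (ball 0 1) x) \<partial>lborel)"
        \<comment> \<open>Since \<open>0 powr 0 = 0\<close>, the two integrands differ at the
          origin.\<close>
        using AE_lborel_singleton[of "0::complex"]
      proof (intro nn_integral_cong_AE, eventually_elim)
        case (elim x)
        have "indicator (ball 0 (radius v)) (of_real r * x) = (indicator (ball 0 1) x :: ennreal)"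
          using r by (simp add: indicator_def norm_mult flip: r_def)
        then show ?case unfolding gx using elim by (simp add: mult.assoc)
      qed
      also have "\<dots> = ennreal c * (\<integral>\<^sup>+x. (ennreal (cmod x powr (2 * 0) * (1 - cmod x ^ (2 * m)) powr b / cmod (1 - \<mu> * x ^ m) ^ 4) * indicator (ball 0 1) x) \<partial>lborel)"
        by (rule nn_integral_cmult) measurable
      also have "ennreal (r\<^sup>2) * \<dots> \<le> ennreal (r\<^sup>2) * (ennreal c * ennreal (C1 * (1 - (cmod \<mu>)\<^sup>2) powr (b - 2)))"
        by (intro mult_left_mono FR1) (use U_bounds[OF z] in \<open>simp_all add: \<mu>\<close>)
      also have "\<dots> = ennreal X * ennreal (r\<^sup>2 * c)"
        unfolding \<mu> X_def[symmetric] using c X by (simp add: mult_ac flip: ennreal_mult)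
      also have "ennreal (r\<^sup>2 * c) = Y v"
      proof -
        have "cmod v powr (2 * (\<gamma> + real n / real m)) = cmod v powr (2 * \<gamma>) * r\<^sup>2"
          using v unfolding r_def by (simp add: radius_def powr_power distrib_left powr_add mult.commute)
        moreover have "cmod (1 - T z (0, v)) = cmod (1 - cnj (snd z) * v)"
        proof -
          have "1 - T z (0, v) = cnj (1 - cnj (snd z) * v)" by (simp add: T_def)
          then show ?thesis by (simp only: complex_mod_cnj)
        qed
        ultimately show ?thesis using v by (simp add: Y_def c_def mult_ac)
      qed
      finally show ?thesis using True by simp
    qed
    have [measurable]: "Y \<in> borel_measurable borel" unfolding Y_def[abs_def] by measurable
    have "(\<integral>\<^sup>+w. g w \<partial>M) = (\<integral>\<^sup>+v. (\<integral>\<^sup>+x. g (x, v) * indicator (ball 0 (radius v)) x \<partial>lborel) * indicator (ball 0 1) v \<partial>lborel)"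
      by (rule nn_integral_M) measurable
    also have "\<dots> \<le> (\<integral>\<^sup>+v. ennreal X * Y v \<partial>lborel)" by (intro nn_integral_mono inner)
    also have "\<dots> = ennreal X * (\<integral>\<^sup>+v. Y v \<partial>lborel)" by (rule nn_integral_cmult) measurable
    also have "\<dots> \<le> ennreal X * ennreal (C2 * (1 - (cmod (cnj (snd z)))\<^sup>2) powr (b - 2))"
      unfolding Y_def by (intro mult_left_mono FR2) (use zH in auto)
    also have "\<dots> = ennreal (C1 * C2 * ((1 - (U z)\<^sup>2) powr (b - 2) * (1 - (cmod (snd z))\<^sup>2) powr (b - 2)))"
      using C1 C2 by (simp add: X_def ennreal_mult mult_ac)
    finally show ?thesis unfolding g_def .
  qed
  moreover have "C1 * C2 > 0" using C1 C2 by simp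
  ultimately show ?thesis using that by blast
qed

section \<open>Pointwise bound for the Berezin kernel\<close>

lemma K_part_diag:
  assumes z: "z \<in> H" and j: "j < m"
  obtains r where "K_part j z z = of_real r"
    "(cmod (fst z) ^ j * cmod (snd z) powr of_int (\<beta> j))\<^sup>2 / ((1 - (U z)\<^sup>2)\<^sup>2 * (1 - (cmod (snd z))\<^sup>2)\<^sup>2 * (real m * pi\<^sup>2)) \<le> r"
proof -
  note zH = H_D[OF z]
  define u v where "u = (U z)\<^sup>2" and "v = (cmod (snd z))\<^sup>2"
  have u: "0 \<le> u" "u < 1" using U_bounds[OF z] by (simp_all add: u_def power_less_one_iff)
  have v: "0 \<le> v" "v < 1" using zH by (simp_all add: v_def power_less_one_iff)
  have T: "T z z = of_real v" by (simp add: T_def v_def complex_norm_square flip: of_real_power)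
  have F: "fst z * cnj (fst z) = of_real ((cmod (fst z))\<^sup>2)" by (simp only: complex_norm_square)
  have G: "snd z * cnj (snd z) = of_real ((cmod (snd z))\<^sup>2)" by (simp only: complex_norm_square)
  have S: "S z z = of_real u"
    unfolding S_def F G u_def U_def by (simp add: power_divide power_mult_distrib power_mult[symmetric] mult.commute)
  define gu gv where "gu = Re (arith_kernel m (real j + 1) (of_real u))" and "gv = Re (arith_kernel m (d j) (of_real v))"
  have gu: "arith_kernel m (real j + 1) (of_real u) = of_real gu" "1 / (1 - u)\<^sup>2 \<le> gu"
    unfolding gu_def using j u by (intro arith_kernel_ge; simp)+
  have gv: "arith_kernel m (d j) (of_real v) = of_real gv" "1 / (1 - v)\<^sup>2 \<le> gv"
    unfolding gv_def using d_bounds[of j] v by (intro arith_kernel_ge; simp)+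
  define A where "A = ((cmod (fst z))\<^sup>2) ^ j * v powi \<beta> j"
  have A: "A = (cmod (fst z) ^ j * cmod (snd z) powr of_int (\<beta> j))\<^sup>2"
  proof -
    have "v powi \<beta> j = (cmod (snd z) powi \<beta> j)\<^sup>2"
      by (simp add: v_def power2_eq_square power_int_mult_distrib)
    then show ?thesis
      using zH by (simp add: A_def power_mult_distrib powr_real_of_int' power_mult[symmetric] mult.commute)
  qed
  have "K_part j z z = of_real (A * gu * gv / (real m * pi\<^sup>2))"
    unfolding K_part_def S gu(1) F
    by (simp add: T gv(1) A_def)
  moreover have "A / ((1 - u)\<^sup>2 * (1 - v)\<^sup>2 * (real m * pi\<^sup>2)) \<le> A * gu * gv / (real m * pi\<^sup>2)"
  proof -
    have "A \<ge> 0" by (simp add: A)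
    then have "A * ((1 / (1 - u)\<^sup>2) * (1 / (1 - v)\<^sup>2)) \<le> A * (gu * gv)"
      using gu(2) gv(2) by (intro mult_left_mono mult_mono order.trans[OF _ gu(2)]) auto
    then have "A * ((1 / (1 - u)\<^sup>2) * (1 / (1 - v)\<^sup>2)) / (real m * pi\<^sup>2) \<le> A * (gu * gv) / (real m * pi\<^sup>2)"
      by (intro divide_right_mono) auto
    then show ?thesis by (simp add: mult_ac)
  qed
  ultimately show ?thesis using that unfolding A u_def v_def by blast
qed

lemma K_diag:
  assumes z: "z \<in> H"
  obtains r where "\<And>j. j < m \<Longrightarrow> (cmod (fst z) ^ j * cmod (snd z) powr of_int (\<beta> j))\<^sup>2
      / ((1 - (U z)\<^sup>2)\<^sup>2 * (1 - (cmod (snd z))\<^sup>2)\<^sup>2 * (real m * pi\<^sup>2)) \<le> r j"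
    "\<And>j. j < m \<Longrightarrow> 0 \<le> r j" "0 < (\<Sum>j<m. r j)" "K z z = of_real (\<Sum>j<m. r j)"
proof -
  note zH = H_D[OF z]
  define E where "E = (1 - (U z)\<^sup>2)\<^sup>2 * (1 - (cmod (snd z))\<^sup>2)\<^sup>2"
  have E: "E > 0"
    using U_bounds[OF z] zH unfolding E_def
    by (intro mult_pos_pos zero_less_power) (simp_all add: power_less_one_iff)
  define a where "a j = cmod (fst z) ^ j * cmod (snd z) powr of_int (\<beta> j)" for j
  have "\<exists>r. \<forall>j<m. K_part j z z = of_real (r j) \<and> (a j)\<^sup>2 / (E * (real m * pi\<^sup>2)) \<le> r j"
    unfolding a_def E_def using K_part_diag[OF z] by (intro choice allI) metis
  then obtain r where r: "\<And>j. j < m \<Longrightarrow> K_part j z z = of_real (r j)" "\<And>j. j < m \<Longrightarrow> (a j)\<^sup>2 / (E * (real m * pi\<^sup>2)) \<le> r j"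
    by blast
  have r0: "r j \<ge> 0" if "j < m" for j
    by (rule order.trans[OF _ r(2)[OF that]]) (use E in simp)
  have Kzz: "K z z = of_real (\<Sum>j<m. r j)" using z r(1) by (simp add: K_def)
  have pos: "(\<Sum>j<m. r j) > 0"
  \<comment> \<open>The class \<open>j = 0\<close> contains no positive power of
    \<open>fst z\<close> in its prefactor, so it is positive even where
    \<open>fst z = 0\<close>.\<close>
  proof (rule sum_pos2[of _ 0])
    have "(a 0)\<^sup>2 / (E * (real m * pi\<^sup>2)) > 0" using E m zH by (simp add: a_def)
    then show "r 0 > 0" using r(2)[OF m] by linarith
  qed (use m r0 in auto)
  show ?thesis by (rule that[OF r(2)[unfolded a_def E_def] r0 pos Kzz])
qed

text \<open>The \<open>z\<close>-monomial in \<open>K_part j z w\<close> appears squared in the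
  diagonal bound of the same class, and the \<open>w\<close>-monomial is bounded by
  \<open>monomial_le\<close>. So each squared part is at most \<open>Z * r j\<close> with
  \<open>Z\<close> independent of \<open>j\<close>, and the sum of the \<open>r j\<close> cancels
  against \<open>K z z\<close>. Cauchy-Schwarz over the \<open>m\<close> classes costs one more
  factor \<open>m\<close>.\<close>

lemma berezin_kernel_bound:
  assumes z: "z \<in> H" and w: "w \<in> H"
  shows "cmod (berezin_kernel H z w) \<le> real m ^ 4 / pi\<^sup>2 * cmod (snd w) powr (2 * (- \<kappa>)) *
     ((1 - (U z)\<^sup>2)\<^sup>2 * (1 - (cmod (snd z))\<^sup>2)\<^sup>2) / (cmod (1 - S z w) ^ 4 * cmod (1 - T z w) ^ 4)"
proof -
  note zH = H_D[OF z] and wH = H_D[OF w]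
  define E where "E = (1 - (U z)\<^sup>2)\<^sup>2 * (1 - (cmod (snd z))\<^sup>2)\<^sup>2"
  have E: "E > 0"
    using U_bounds[OF z] zH unfolding E_def
    by (intro mult_pos_pos zero_less_power) (simp_all add: power_less_one_iff)
  define a where "a j = cmod (fst z) ^ j * cmod (snd z) powr of_int (\<beta> j)" for j
  define D where "D = cmod (1 - S z w) ^ 4 * cmod (1 - T z w) ^ 4"
  have D: "D > 0" using norm_S_less[OF z w] norm_T_less[OF z w] by (auto simp: D_def intro!: mult_pos_pos zero_less_power)
  obtain r where r: "\<And>j. j < m \<Longrightarrow> (a j)\<^sup>2 / (E * (real m * pi\<^sup>2)) \<le> r j"
    and r0: "\<And>j. j < m \<Longrightarrow> 0 \<le> r j" and pos: "0 < (\<Sum>j<m. r j)" and Kzz: "K z z = of_real (\<Sum>j<m. r j)"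
    unfolding a_def E_def using K_diag[OF z] by blast
  define Z where "Z = real m ^ 3 / pi\<^sup>2 * cmod (snd w) powr (2 * (- \<kappa>)) * E / D"
  have Z: "Z \<ge> 0" using E D by (simp add: Z_def)
  have part: "(cmod (K_part j z w))\<^sup>2 \<le> Z * r j" if j: "j < m" for j
  proof -
    define q where "q = real m / (cmod (1 - S z w))\<^sup>2 * (real m / (cmod (1 - T z w))\<^sup>2) / (real m * pi\<^sup>2)"
    have q: "q \<ge> 0" "q\<^sup>2 = (real m)\<^sup>2 / (pi\<^sup>2)\<^sup>2 / D"
      using m by (simp_all add: q_def D_def power_divide power_mult_distrib field_simps flip: power_mult)
    have "cmod (K_part j z w) \<le> a j * (cmod (fst w) ^ j * cmod (snd w) powr of_int (\<beta> j)) * q"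
      unfolding a_def q_def by (rule K_part_bound[OF z w j])
    also have "\<dots> \<le> a j * cmod (snd w) powr (- \<kappa>) * q"
      using q by (intro mult_right_mono mult_left_mono monomial_le w) (auto simp: a_def)
    finally have "(cmod (K_part j z w))\<^sup>2 \<le> (a j * cmod (snd w) powr (- \<kappa>) * q)\<^sup>2"
      by (intro power_mono) auto
    also have "\<dots> = (a j)\<^sup>2 * (cmod (snd w) powr (2 * (- \<kappa>)) * q\<^sup>2)"
      by (simp only: power_mult_distrib) (simp add: power2_eq_square mult_ac flip: powr_add)
    also have "\<dots> = Z * ((a j)\<^sup>2 / (E * (real m * pi\<^sup>2)))"
      using E D m unfolding q(2) Z_def by (simp add: field_simps power2_eq_square power3_eq_cube)
    also have "\<dots> \<le> Z * r j" by (intro mult_left_mono r j Z)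
    finally show ?thesis .
  qed
  have "(cmod (K z w))\<^sup>2 \<le> (\<Sum>j<m. cmod (K_part j z w))\<^sup>2"
    using z w by (intro power_mono) (auto simp: K_def norm_sum)
  also have "\<dots> \<le> (\<Sum>j<m. (cmod (K_part j z w))\<^sup>2) * real m"
    using sum_squared_le_sum_of_squares[of "\<lambda>j. cmod (K_part j z w)" "{..<m}"] by simp
  also have "\<dots> \<le> (\<Sum>j<m. Z * r j) * real m" using part by (intro mult_right_mono sum_mono) auto
  also have "\<dots> = real m * Z * (\<Sum>j<m. r j)" by (simp add: sum_distrib_left[symmetric])
  finally have "(cmod (K z w))\<^sup>2 / (\<Sum>j<m. r j) \<le> real m * Z"
    using pos by (simp add: divide_le_eq)
  moreover have "cmod (berezin_kernel H z w) = (cmod (K z w))\<^sup>2 / (\<Sum>j<m. r j)"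
    unfolding berezin_kernel_def bergman_kernel_eq Kzz using pos by (simp add: norm_divide norm_power del: of_real_sum)
  ultimately show ?thesis unfolding Z_def E_def[symmetric] D_def[symmetric] by (simp add: power_numeral_reduce mult_ac)
qed

section \<open>Boundedness for large exponents\<close>

lemma sigma_finite_M: "sigma_finite_measure M"
proof -
  have "bounded H"
  proof (rule boundedI)
    fix z assume "z \<in> H"
    note z = H_D[OF this]
    have "radius (snd z) \<le> 1" unfolding radius_def using z by (intro powr_le1) auto
    then have "cmod (fst z) \<le> 1" using z by linarith
    then show "norm z \<le> 2"
      using norm_Pair_le[of "fst z" "snd z"] z by simp
  qed
  then have "H \<in> lmeasurable" using open_H by (rule lmeasurable_open)
  then interpret finite_measure M by (rule finite_measure_lebesgue_on)
  show ?thesis ..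
qed

lemma berezin_measurable: "case_prod (berezin_kernel H) \<in> borel_measurable (M \<Otimes>\<^sub>M M)"
proof -
  have [measurable]: "(\<lambda>x. K_part j (fst x) (snd x)) \<in> borel_measurable (M \<Otimes>\<^sub>M M)"
    "(\<lambda>x. K_part j (fst x) (fst x)) \<in> borel_measurable (M \<Otimes>\<^sub>M M)" for j
    unfolding K_part_def S_def T_def by measurable
  have "(\<lambda>x. complex_of_real ((cmod (\<Sum>j<m. K_part j (fst x) (snd x)))\<^sup>2) / (\<Sum>j<m. K_part j (fst x) (fst x))) \<in> borel_measurable (M \<Otimes>\<^sub>M M)"
    by measurable
  also have "?this \<longleftrightarrow> ?thesis"
    by (rule measurable_cong) (auto simp: space_pair_measure berezin_kernel_def bergman_kernel_eq K_def)
  finally show ?thesis .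
qed

lemma one_minus_sq_pos:
  assumes "z \<in> H" shows "0 < 1 - (U z)\<^sup>2" "0 < 1 - (cmod (snd z))\<^sup>2"
  using U_bounds[OF assms] H_D[OF assms] by (simp_all add: power_less_one_iff)

lemma berezin_bounded:
  assumes p1: "p > 1" and p: "p > real (m + n)"
  shows "integral_operator_bounded_on_Lp p M (berezin_kernel H)"
proof -
  \<comment> \<open>The smallest admissible choice: \<open>\<theta> * (p - 1) = \<kappa>\<close>
    reproduces the factor in \<open>w\<close> exactly in the second Schur inequality.\<close>
  define \<theta> where "\<theta> = \<kappa> / (p - 1)"
  \<comment> \<open>The boundary exponents met in the two integrals are \<open>- e\<close> and
    \<open>2 - e * (p - 1) = 1 + e\<close>; both lie in the range \<open>-1 < b < 2\<close> for
    every \<open>p > 1\<close>.\<close>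
  define e where "e = 1 / p"
  define \<phi> where "\<phi> z = cmod (snd z) powr (2 * (- \<theta>)) * ((1 - (U z)\<^sup>2) powr (- e) * (1 - (cmod (snd z))\<^sup>2) powr (- e))" for z
  have \<kappa>0: "\<kappa> \<ge> 0" using m n by (simp add: \<kappa>_def)
  have \<theta>0: "\<theta> \<ge> 0" using p1 \<kappa>0 by (simp add: \<theta>_def)
  have e: "0 < e" "e < 1" using p1 by (auto simp: e_def)
  have ep: "e * (p - 1) = 1 - e" using p1 by (simp add: e_def field_simps)
  have g1: "- \<kappa> - \<theta> + real n / real m > -1"
  proof -
    \<comment> \<open>This is equivalent to \<open>p > m + n\<close>.\<close>
    have "\<theta> < 1 / real m"
      unfolding \<theta>_def \<kappa>_def using p p1 m by (simp add: divide_simps)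
    moreover have "- \<kappa> + real n / real m = 1 / real m - 1" using m by (simp add: \<kappa>_def field_simps)
    ultimately show ?thesis by linarith
  qed
  obtain C1 where C1: "C1 > 0" and FR1: "\<And>z. z \<in> H \<Longrightarrow>
      (\<integral>\<^sup>+w. ennreal (cmod (snd w) powr (2 * (- \<kappa> - \<theta>)) * ((1 - (U w)\<^sup>2) powr (- e) * (1 - (cmod (snd w))\<^sup>2) powr (- e))
        / (cmod (1 - S z w) ^ 4 * cmod (1 - T z w) ^ 4)) \<partial>M)
      \<le> ennreal (C1 * ((1 - (U z)\<^sup>2) powr (- e - 2) * (1 - (cmod (snd z))\<^sup>2) powr (- e - 2)))"
    by (rule forelli_rudin_hartogs[OF g1, of "- e"]) (use e in auto)
  obtain C2 where C2: "C2 > 0" and FR2: "\<And>z. z \<in> H \<Longrightarrow>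
      (\<integral>\<^sup>+w. ennreal (cmod (snd w) powr (2 * (- \<kappa>)) * ((1 - (U w)\<^sup>2) powr (1 + e) * (1 - (cmod (snd w))\<^sup>2) powr (1 + e))
        / (cmod (1 - S z w) ^ 4 * cmod (1 - T z w) ^ 4)) \<partial>M)
      \<le> ennreal (C2 * ((1 - (U z)\<^sup>2) powr (1 + e - 2) * (1 - (cmod (snd z))\<^sup>2) powr (1 + e - 2)))"
    by (rule forelli_rudin_hartogs[OF \<kappa>_less, of "1 + e"]) (use e in auto)
  define C0 where "C0 = real m ^ 4 / pi\<^sup>2"
  have C0: "C0 \<ge> 0" by (simp add: C0_def)
  define E where "E z = (1 - (U z)\<^sup>2)\<^sup>2 * (1 - (cmod (snd z))\<^sup>2)\<^sup>2" for z
  define D where "D z w = cmod (1 - S z w) ^ 4 * cmod (1 - T z w) ^ 4" for z w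
  have bound: "cmod (berezin_kernel H z w) \<le> C0 * cmod (snd w) powr (2 * (- \<kappa>)) * E z / D z w"
    if "z \<in> H" "w \<in> H" for z w
    using berezin_kernel_bound[OF that] unfolding C0_def E_def D_def .
  have D_sym: "D z w = D w z" for z w
  proof -
    have "1 - S z w = cnj (1 - S w z)" "1 - T z w = cnj (1 - T w z)"
      using S_cnj[of z w] T_cnj[of z w] by simp_all
    then show ?thesis unfolding D_def by (simp only: complex_mod_cnj)
  qed
  have D_nonneg: "D z w \<ge> 0" for z w by (simp add: D_def)
  have [measurable]: "U \<in> borel_measurable M" "(\<lambda>w. D z w) \<in> borel_measurable M" "(\<lambda>w. D w z) \<in> borel_measurable M" for z
    unfolding U_def[abs_def] D_def S_def T_def by measurable
  have \<phi>m: "\<phi> \<in> borel_measurable M" unfolding \<phi>_def[abs_def] by measurable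
  show ?thesis
  proof (rule schur_test[OF sigma_finite_M p1 berezin_measurable \<phi>m])
    fix z assume "z \<in> space M"
    then have z: "z \<in> H" by simp
    note pos = one_minus_sq_pos[OF z]
    show "\<phi> z > 0" unfolding \<phi>_def using pos H_D[OF z] by (intro mult_pos_pos) auto
    have "(\<integral>\<^sup>+w. ennreal (cmod (berezin_kernel H z w) * \<phi> w) \<partial>M)
      \<le> (\<integral>\<^sup>+w. ennreal (C0 * E z) * ennreal (cmod (snd w) powr (2 * (- \<kappa> - \<theta>)) * ((1 - (U w)\<^sup>2) powr (- e) * (1 - (cmod (snd w))\<^sup>2) powr (- e)) / D z w) \<partial>M)"
    proof (intro nn_integral_mono)
      fix w assume "w \<in> space M"
      then have w: "w \<in> H" by simp
      have "cmod (berezin_kernel H z w) * \<phi> w \<le> C0 * cmod (snd w) powr (2 * (- \<kappa>)) * E z / D z w * \<phi> w"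
        by (intro mult_right_mono bound z w) (simp add: \<phi>_def)
      also have "\<dots> = C0 * E z * (cmod (snd w) powr (2 * (- \<kappa> - \<theta>)) * ((1 - (U w)\<^sup>2) powr (- e) * (1 - (cmod (snd w))\<^sup>2) powr (- e)) / D z w)"
      proof -
        have "cmod (snd w) powr (2 * (- \<kappa> - \<theta>)) = cmod (snd w) powr (2 * (- \<kappa>)) * cmod (snd w) powr (2 * (- \<theta>))"
        proof -
          have "2 * (- \<kappa> - \<theta>) = 2 * (- \<kappa>) + 2 * (- \<theta>)" by simp
          then show ?thesis by (simp only: powr_add)
        qed
        then show ?thesis unfolding \<phi>_def by (simp add: mult_ac)
      qed
      finally have "ennreal (cmod (berezin_kernel H z w) * \<phi> w) \<le> ennreal (C0 * E z * (cmod (snd w) powr (2 * (- \<kappa> - \<theta>)) * ((1 - (U w)\<^sup>2) powr (- e) * (1 - (cmod (snd w))\<^sup>2) powr (- e)) / D z w))"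
        by (rule ennreal_leI)
      also have "\<dots> = ennreal (C0 * E z) * ennreal (cmod (snd w) powr (2 * (- \<kappa> - \<theta>)) * ((1 - (U w)\<^sup>2) powr (- e) * (1 - (cmod (snd w))\<^sup>2) powr (- e)) / D z w)"
        by (rule ennreal_mult') (simp add: C0_def E_def)
      finally show "ennreal (cmod (berezin_kernel H z w) * \<phi> w) \<le> \<dots>" .
    qed
    also have "\<dots> = ennreal (C0 * E z) * (\<integral>\<^sup>+w. ennreal (cmod (snd w) powr (2 * (- \<kappa> - \<theta>)) * ((1 - (U w)\<^sup>2) powr (- e) * (1 - (cmod (snd w))\<^sup>2) powr (- e)) / D z w) \<partial>M)"
      by (rule nn_integral_cmult) measurable
    also have "\<dots> \<le> ennreal (C0 * E z) * ennreal (C1 * ((1 - (U z)\<^sup>2) powr (- e - 2) * (1 - (cmod (snd z))\<^sup>2) powr (- e - 2)))"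
      unfolding D_def by (intro mult_left_mono FR1 z) simp
    also have "\<dots> = ennreal (C0 * E z * (C1 * ((1 - (U z)\<^sup>2) powr (- e - 2) * (1 - (cmod (snd z))\<^sup>2) powr (- e - 2))))"
      by (rule ennreal_mult'[symmetric]) (simp add: C0_def E_def)
    also have "C0 * E z * (C1 * ((1 - (U z)\<^sup>2) powr (- e - 2) * (1 - (cmod (snd z))\<^sup>2) powr (- e - 2)))
       = C0 * C1 * ((1 - (U z)\<^sup>2) powr (- e) * (1 - (cmod (snd z))\<^sup>2) powr (- e))"
    proof -
      have q: "x\<^sup>2 * x powr (- e - 2) = x powr (- e)" if "x > 0" for x :: real
        using that by (simp add: powr_diff powr_numeral)
      have "E z * ((1 - (U z)\<^sup>2) powr (- e - 2) * (1 - (cmod (snd z))\<^sup>2) powr (- e - 2))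
          = ((1 - (U z)\<^sup>2)\<^sup>2 * (1 - (U z)\<^sup>2) powr (- e - 2)) * ((1 - (cmod (snd z))\<^sup>2)\<^sup>2 * (1 - (cmod (snd z))\<^sup>2) powr (- e - 2))"
        unfolding E_def by (simp only: mult_ac)
      then have "E z * ((1 - (U z)\<^sup>2) powr (- e - 2) * (1 - (cmod (snd z))\<^sup>2) powr (- e - 2)) = (1 - (U z)\<^sup>2) powr (- e) * (1 - (cmod (snd z))\<^sup>2) powr (- e)"
        by (simp only: q pos)
      then show ?thesis by (simp add: mult_ac)
    qed
    also have "C0 * C1 * ((1 - (U z)\<^sup>2) powr (- e) * (1 - (cmod (snd z))\<^sup>2) powr (- e)) \<le> C0 * C1 * \<phi> z"
    proof -
      \<comment> \<open>The first Schur integral shows no growth at \<open>snd z = 0\<close>,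
        whereas \<open>\<phi>\<close> blows up there or stays constant in this factor, so the factor
        may be inserted.\<close>
      have "cmod (snd z) powr 0 \<le> cmod (snd z) powr (2 * (- \<theta>))"
        using H_D[OF z] \<theta>0 by (intro powr_mono') auto
      then have "1 \<le> cmod (snd z) powr (2 * (- \<theta>))" using H_D[OF z] by simp
      then have "1 * ((1 - (U z)\<^sup>2) powr (- e) * (1 - (cmod (snd z))\<^sup>2) powr (- e)) \<le> \<phi> z"
        unfolding \<phi>_def by (intro mult_right_mono) auto
      then show ?thesis using C0 C1 by (intro mult_left_mono) auto
    qed
    finally show "(\<integral>\<^sup>+w. ennreal (cmod (berezin_kernel H z w) * \<phi> w) \<partial>M) \<le> ennreal (C0 * C1 * \<phi> z)"
      by (simp add: ennreal_leI)
  next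
    fix w assume "w \<in> space M"
    then have w: "w \<in> H" by simp
    have \<phi>p: "\<phi> z powr (p - 1) = cmod (snd z) powr (2 * (- \<kappa>)) * ((1 - (U z)\<^sup>2) powr (1 + e - 2) * (1 - (cmod (snd z))\<^sup>2) powr (1 + e - 2))"
      if "z \<in> H" for z
    proof -
      have 1: "2 * (- \<theta>) * (p - 1) = 2 * (- \<kappa>)" using p1 by (simp add: \<theta>_def)
      have 2: "- e * (p - 1) = 1 + e - 2" using ep by simp
      show ?thesis
        unfolding \<phi>_def using one_minus_sq_pos[OF that]
        by (simp only: powr_mult powr_ge_zero mult_nonneg_nonneg powr_powr 1 2)
    qed
    have "(\<integral>\<^sup>+z. ennreal (cmod (berezin_kernel H z w) * \<phi> z powr (p - 1)) \<partial>M)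
      \<le> (\<integral>\<^sup>+z. ennreal (C0 * cmod (snd w) powr (2 * (- \<kappa>))) * ennreal (cmod (snd z) powr (2 * (- \<kappa>)) * ((1 - (U z)\<^sup>2) powr (1 + e) * (1 - (cmod (snd z))\<^sup>2) powr (1 + e)) / D w z) \<partial>M)"
    proof (intro nn_integral_mono)
      fix z assume "z \<in> space M"
      then have z: "z \<in> H" by simp
      note pos = one_minus_sq_pos[OF z]
      have "cmod (berezin_kernel H z w) * \<phi> z powr (p - 1) \<le> C0 * cmod (snd w) powr (2 * (- \<kappa>)) * E z / D z w * \<phi> z powr (p - 1)"
        by (intro mult_right_mono bound z w) simp
      also have "\<dots> = C0 * cmod (snd w) powr (2 * (- \<kappa>)) * (cmod (snd z) powr (2 * (- \<kappa>)) * (E z * ((1 - (U z)\<^sup>2) powr (1 + e - 2) * (1 - (cmod (snd z))\<^sup>2) powr (1 + e - 2))) / D z w)"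
        unfolding \<phi>p[OF z] by (simp add: mult_ac)
      also have "E z * ((1 - (U z)\<^sup>2) powr (1 + e - 2) * (1 - (cmod (snd z))\<^sup>2) powr (1 + e - 2)) = (1 - (U z)\<^sup>2) powr (1 + e) * (1 - (cmod (snd z))\<^sup>2) powr (1 + e)"
      proof -
        have q: "x\<^sup>2 * x powr (1 + e - 2) = x powr (1 + e)" if "x > 0" for x :: real
        proof -
          have "x powr (2 + (1 + e - 2)) = x powr 2 * x powr (1 + e - 2)" by (rule powr_add)
          then show ?thesis using that by (simp add: powr_numeral)
        qed
        have "E z * ((1 - (U z)\<^sup>2) powr (1 + e - 2) * (1 - (cmod (snd z))\<^sup>2) powr (1 + e - 2))
          = ((1 - (U z)\<^sup>2)\<^sup>2 * (1 - (U z)\<^sup>2) powr (1 + e - 2)) * ((1 - (cmod (snd z))\<^sup>2)\<^sup>2 * (1 - (cmod (snd z))\<^sup>2) powr (1 + e - 2))"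
          unfolding E_def by (simp only: mult_ac)
        then show ?thesis by (simp only: q pos)
      qed
      finally have "ennreal (cmod (berezin_kernel H z w) * \<phi> z powr (p - 1)) \<le> ennreal (C0 * cmod (snd w) powr (2 * (- \<kappa>)) * (cmod (snd z) powr (2 * (- \<kappa>)) * ((1 - (U z)\<^sup>2) powr (1 + e) * (1 - (cmod (snd z))\<^sup>2) powr (1 + e)) / D w z))"
        unfolding D_sym[of w z] by (rule ennreal_leI)
      also have "\<dots> = ennreal (C0 * cmod (snd w) powr (2 * (- \<kappa>))) * ennreal (cmod (snd z) powr (2 * (- \<kappa>)) * ((1 - (U z)\<^sup>2) powr (1 + e) * (1 - (cmod (snd z))\<^sup>2) powr (1 + e)) / D w z)"
        by (rule ennreal_mult') (simp add: C0_def)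
      finally show "ennreal (cmod (berezin_kernel H z w) * \<phi> z powr (p - 1)) \<le> \<dots>" .
    qed
    also have "\<dots> = ennreal (C0 * cmod (snd w) powr (2 * (- \<kappa>))) * (\<integral>\<^sup>+z. ennreal (cmod (snd z) powr (2 * (- \<kappa>)) * ((1 - (U z)\<^sup>2) powr (1 + e) * (1 - (cmod (snd z))\<^sup>2) powr (1 + e)) / D w z) \<partial>M)"
      by (rule nn_integral_cmult) measurable
    also have "\<dots> \<le> ennreal (C0 * cmod (snd w) powr (2 * (- \<kappa>))) * ennreal (C2 * ((1 - (U w)\<^sup>2) powr (1 + e - 2) * (1 - (cmod (snd w))\<^sup>2) powr (1 + e - 2)))"
      unfolding D_def by (intro mult_left_mono FR2 w) simp
    also have "\<dots> = ennreal (C0 * cmod (snd w) powr (2 * (- \<kappa>)) * (C2 * ((1 - (U w)\<^sup>2) powr (1 + e - 2) * (1 - (cmod (snd w))\<^sup>2) powr (1 + e - 2))))"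
      by (rule ennreal_mult'[symmetric]) (simp add: C0_def)
    also have "C0 * cmod (snd w) powr (2 * (- \<kappa>)) * (C2 * ((1 - (U w)\<^sup>2) powr (1 + e - 2) * (1 - (cmod (snd w))\<^sup>2) powr (1 + e - 2))) = C0 * C2 * \<phi> w powr (p - 1)"
      unfolding \<phi>p[OF w] by (simp only: mult_ac)
    finally show "(\<integral>\<^sup>+z. ennreal (cmod (berezin_kernel H z w) * \<phi> z powr (p - 1)) \<partial>M) \<le> ennreal (C0 * C2 * \<phi> w powr (p - 1))" .
  qed (use C0 C1 C2 in auto)
qed

end

section \<open>Failure of boundedness\<close>

text \<open>The inverse square is the critical power in the plane; the inner radius
  \<open>exp (- N)\<close> turns its logarithmic divergence into growth linear in
  \<open>N\<close>.\<close>

lemma nn_integral_annulus: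
  assumes N: "N \<ge> 0"
  shows "(\<integral>\<^sup>+v. ennreal (cmod v powr (-2)) * indicator {v. exp (- N) \<le> cmod v} v * indicator (ball 0 1) v \<partial>lborel) = ennreal (2 * pi * N)"
proof -
  have "(\<integral>\<^sup>+v. ennreal (cmod v powr (-2)) * indicator {v. exp (- N) \<le> cmod v} v * indicator (ball 0 1) v \<partial>lborel)
    = (\<integral>\<^sup>+v. (\<lambda>t. ennreal (1 / t) * indicator {exp (- 2 * N)..<1} t) ((cmod v)\<^sup>2) \<partial>lborel)"
  proof (intro nn_integral_cong)
    fix v :: complex
    have "exp (- N) \<le> cmod v \<longleftrightarrow> (exp (- N))\<^sup>2 \<le> (cmod v)\<^sup>2"
      by (simp add: abs_le_square_iff[symmetric])
    also have "(exp (- N))\<^sup>2 = exp (- 2 * N)" by (simp flip: exp_double)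
    finally have 1: "exp (- N) \<le> cmod v \<longleftrightarrow> exp (- 2 * N) \<le> (cmod v)\<^sup>2" .
    have 2: "(cmod v)\<^sup>2 < 1 \<longleftrightarrow> cmod v < 1" by (simp add: power_less_one_iff)
    have 3: "cmod v powr (-2) = 1 / (cmod v)\<^sup>2"
      by (cases "v = 0") (simp_all add: powr_minus_divide)
    show "ennreal (cmod v powr (-2)) * indicator {v. exp (- N) \<le> cmod v} v * indicator (ball 0 1) v
      = ennreal (1 / (cmod v)\<^sup>2) * indicator {exp (- 2 * N)..<1} ((cmod v)\<^sup>2)"
      unfolding 3 by (auto simp: indicator_def 1 2)
  qed
  also have "\<dots> = ennreal pi * (\<integral>\<^sup>+t. ennreal (1 / t) * indicator {exp (- 2 * N)..<1} t * indicator {0..} t \<partial>lborel)"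
    by (rule nn_integral_radial) measurable
  also have "(\<integral>\<^sup>+t. ennreal (1 / t) * indicator {exp (- 2 * N)..<1} t * indicator {0..} t \<partial>lborel)
     = (\<integral>\<^sup>+t. ennreal (1 / t) * indicator {exp (- 2 * N)..1} t \<partial>lborel)"
    using AE_lborel_singleton[of "1::real"]
  proof (intro nn_integral_cong_AE, eventually_elim)
    case (elim t)
    then show ?case by (auto simp: indicator_def intro: order.trans[OF exp_ge_zero])
  qed
  also have "\<dots> = ennreal (ln 1 - ln (exp (- 2 * N)))"
  proof (rule nn_integral_FTC_Icc)
    fix t assume "t \<in> {exp (- 2 * N)..1}"
    then have t: "t > 0" using exp_gt_zero[of "- 2 * N"] by (simp only: atLeastAtMost_iff) linarith
    then show "(ln has_real_derivative 1 / t) (at t)" "0 \<le> 1 / t"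
      by (auto intro!: derivative_eq_intros)
  qed (use N in auto)
  finally show ?thesis using N by (simp flip: ennreal_mult)
qed

context hartogs begin

text \<open>Coprimality makes \<open>n\<close> invertible modulo \<open>m\<close>, so some
  \<open>j\<close> satisfies \<open>n * (j + 1) \<equiv> 1\<close>. Then \<open>d j\<close> is
  congruent to 1 modulo \<open>m\<close> and lies between 1 and \<open>m\<close>.\<close>

lemma critical_index:
  assumes "coprime m n"
  obtains j where "j < m" "d j = 1"
proof -
  obtain u v where "u * int n + v * int m = gcd (int n) (int m)"
    using bezout_int by blast
  then have uv: "u * int n + v * int m = 1"
    using assms by (simp add: coprime_commute)
  \<comment> \<open>The coefficient \<open>u\<close> is the inverse of \<open>n\<close> modulo
    \<open>m\<close>; the shift by 1 is due to \<open>j + 1\<close> in the formula for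
    \<open>d\<close>.\<close>
  define j where "j = nat ((u - 1) mod int m)"
  have ij: "int j = (u - 1) mod int m" using m by (simp add: j_def)
  have jm: "j < m" using m by (simp add: j_def nat_less_iff)
  define X where "X = int m * (\<beta> j + 1) + int n * (int j + 1)"
  have X: "1 \<le> X" "X \<le> int m"
    using d_bounds[of j] unfolding d_eq X_def by linarith+
  have "int j = u - 1 - int m * ((u - 1) div int m)"
    unfolding ij by (simp add: minus_mult_div_eq_mod)
  then have j1: "int j + 1 = u - int m * ((u - 1) div int m)" by simp
  have "X - 1 = int m * (\<beta> j + 1 - int n * ((u - 1) div int m) - v)"
    using uv unfolding X_def j1 by algebra
  then have "int m dvd X - 1" by simp
  then have "X = 1" using X zdvd_not_zless[of "X - 1" "int m"] by linarith
  then have "d j = 1" unfolding d_eq X_def[symmetric] by simp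
  with jm that show ?thesis by blast
qed

lemma K_diag_meas: "(\<lambda>z. \<Sum>j<m. K_part j z z) \<in> borel_measurable M"
  unfolding K_part_def S_def T_def by measurable

section \<open>The truncated test function and its Berezin transform\<close>

context
  fixes p \<tau> N :: real and j :: nat
  assumes p1: "p > 1" and p: "p \<le> real (m + n)" and j: "j < m" and dj: "d j = 1"
    and N: "N > 0" and \<tau>_def: "\<tau> = (1 + real n / real m) / p"
begin

text \<open>By \<open>\<tau> * p = 1 + n / m\<close> the untruncated power is on the edge of
  \<open>L\<^sup>p\<close>: together with the slice area its \<open>p\<close>-th power is an inverse
  square in \<open>z\<^sub>2\<close>.\<close>

definition cut :: "complex \<times> complex \<Rightarrow> real" where
  "cut w = cmod (snd w) powr (2 * (- \<tau>)) * indicator {v. exp (- N) \<le> cmod v} (snd w)"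

definition h :: "complex \<times> complex \<Rightarrow> real" where
  "h w = (cmod (fst w) ^ j * cmod (snd w) powr of_int (\<beta> j))\<^sup>2 * cut w"

text \<open>The test function times the critical monomial. It has the angular dependence of that
  monomial and is therefore orthogonal to all other basis monomials.\<close>

definition F :: "complex \<times> complex \<Rightarrow> complex" where
  "F w = fst w ^ j * snd w powi \<beta> j * of_real (cut w)"

text \<open>The first inequality is the assumption \<open>p \<le> m + n\<close> in another form;
  \<open>h_integral_ge\<close> rests on it.\<close>

lemma \<tau>: "\<tau> \<ge> 1 / real m" "\<tau> * p = 1 + real n / real m" "\<tau> \<ge> 0"
proof -
  show *: "\<tau> \<ge> 1 / real m" unfolding \<tau>_def using p p1 m by (simp add: divide_simps)
  show "\<tau> * p = 1 + real n / real m" unfolding \<tau>_def using p1 by simp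
  show "\<tau> \<ge> 0" using order.trans[OF _ *] by simp
qed

lemma cut_measurable [measurable]: "cut \<in> borel_measurable borel" "cut \<in> borel_measurable M"
proof -
  have [measurable]: "{v::complex. exp (- N) \<le> cmod v} \<in> sets borel" by measurable
  show "cut \<in> borel_measurable borel" unfolding cut_def[abs_def] by measurable
  then show "cut \<in> borel_measurable M" by (rule borel_imp_measurable_M)
qed

lemma cut_nonneg: "cut w \<ge> 0" by (simp add: cut_def)

lemma cut_le: "cut w \<le> exp (- N) powr (2 * (- \<tau>))"
proof (cases "exp (- N) \<le> cmod (snd w)")
  case True
  then show ?thesis unfolding cut_def using \<tau>(3) by (simp add: powr_mono2')
qed (simp add: cut_def)

lemma h_nonneg: "h w \<ge> 0" by (simp add: h_def cut_nonneg)

lemma h_measurable [measurable]: "h \<in> borel_measurable borel" "h \<in> borel_measurable M"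
proof -
  show "h \<in> borel_measurable borel" unfolding h_def[abs_def] by measurable
  then show "h \<in> borel_measurable M" by (rule borel_imp_measurable_M)
qed

lemma h_integrable: "integrable M h"
proof (rule Bochner_Integration.integrable_bound)
  show "integrable M (\<lambda>w. exp (- N) powr (2 * (- \<tau>)) * cmod (snd w) powr (2 * (- \<kappa>)))"
    by (intro integrable_mult_right integrable_M_snd_powr \<kappa>_less)
  show "AE w in M. norm (h w) \<le> norm (exp (- N) powr (2 * (- \<tau>)) * cmod (snd w) powr (2 * (- \<kappa>)))"
  proof (rule AE_I2)
    fix w assume "w \<in> space M"
    then have "(cmod (fst w) ^ j * cmod (snd w) powr of_int (\<beta> j))\<^sup>2 \<le> (cmod (snd w) powr (- \<kappa>))\<^sup>2"
      by (intro power_mono monomial_le) auto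
    also have "\<dots> = cmod (snd w) powr (2 * (- \<kappa>))"
      by (simp add: power2_eq_square flip: powr_add)
    finally have "h w \<le> cmod (snd w) powr (2 * (- \<kappa>)) * exp (- N) powr (2 * (- \<tau>))"
      unfolding h_def using cut_le cut_nonneg by (intro mult_mono) auto
    then show "norm (h w) \<le> norm (exp (- N) powr (2 * (- \<tau>)) * cmod (snd w) powr (2 * (- \<kappa>)))"
      using h_nonneg[of w] by (simp add: mult.commute)
  qed
qed measurable

lemma radius_square: "v \<noteq> 0 \<Longrightarrow> (radius v)\<^sup>2 = cmod v powr (2 * (real n / real m))"
  unfolding radius_def by (subst powr_power) (auto simp: mult_ac)

lemma cut_Lp: "integrable M (\<lambda>w. cut w powr p)" "(\<integral>w. cut w powr p \<partial>M) = 2 * pi\<^sup>2 * N"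
proof -
  have [measurable]: "{v::complex. exp (- N) \<le> cmod v} \<in> sets borel" "ball (0::complex) r \<in> sets borel" for r
    by measurable
  have "(\<integral>\<^sup>+w. ennreal (cut w powr p) \<partial>M)
     = (\<integral>\<^sup>+v. (\<integral>\<^sup>+x. ennreal (cut (x, v) powr p) * indicator (ball 0 (radius v)) x \<partial>lborel) * indicator (ball 0 1) v \<partial>lborel)"
    by (rule nn_integral_M) measurable
  also have "\<dots> = (\<integral>\<^sup>+v. ennreal pi * (ennreal (cmod v powr (-2)) * indicator {v. exp (- N) \<le> cmod v} v * indicator (ball 0 1) v) \<partial>lborel)"
  proof (intro nn_integral_cong)
    fix v :: complex
    have c: "cut (x, v) powr p = cmod v powr (- 2 * (1 + real n / real m)) * indicator {v. exp (- N) \<le> cmod v} v" for x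
    proof -
      have "2 * (- \<tau>) * p = - 2 * (\<tau> * p)" by simp
      then have "2 * (- \<tau>) * p = - 2 * (1 + real n / real m)" unfolding \<tau>(2) .
      then have "(cmod v powr (2 * (- \<tau>))) powr p = cmod v powr (- 2 * (1 + real n / real m))"
        by (simp only: powr_powr)
      then show ?thesis using p1 by (simp add: cut_def indicator_def)
    qed
    have "(\<integral>\<^sup>+x. ennreal (cut (x, v) powr p) * indicator (ball 0 (radius v)) x \<partial>lborel)
       = ennreal (cmod v powr (- 2 * (1 + real n / real m)) * indicator {v. exp (- N) \<le> cmod v} v) * ennreal (pi * (radius v)\<^sup>2)"
      unfolding c by (subst nn_integral_cmult_indicator) (auto simp: emeasure_ball unit_ball_vol_2 radius_def)
    also have "\<dots> = ennreal (cmod v powr (- 2 * (1 + real n / real m)) * indicator {v. exp (- N) \<le> cmod v} v * (pi * (radius v)\<^sup>2))"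
      by (rule ennreal_mult'[symmetric]) simp
    also have "cmod v powr (- 2 * (1 + real n / real m)) * indicator {v. exp (- N) \<le> cmod v} v * (pi * (radius v)\<^sup>2)
      = pi * (cmod v powr (-2) * indicator {v. exp (- N) \<le> cmod v} v)"
    proof (cases "v = 0")
      case False
      have "cmod v powr (- 2 * (1 + real n / real m)) * (radius v)\<^sup>2 = cmod v powr (-2)"
        unfolding radius_square[OF False] by (simp add: algebra_simps flip: powr_add)
      then show ?thesis by (simp add: mult_ac)
    qed simp
    also have "ennreal \<dots> = ennreal pi * (ennreal (cmod v powr (-2)) * indicator {v. exp (- N) \<le> cmod v} v)"
      by (simp add: ennreal_mult ennreal_indicator)
    finally show "(\<integral>\<^sup>+x. ennreal (cut (x, v) powr p) * indicator (ball 0 (radius v)) x \<partial>lborel) * indicator (ball 0 1) v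
      = ennreal pi * (ennreal (cmod v powr (-2)) * indicator {v. exp (- N) \<le> cmod v} v * indicator (ball 0 1) v)"
      by (simp add: mult.assoc)
  qed
  also have "\<dots> = ennreal pi * ennreal (2 * pi * N)"
    using N by (subst nn_integral_cmult) (auto simp: nn_integral_annulus)
  also have "\<dots> = ennreal (2 * pi\<^sup>2 * N)" using N by (simp add: power2_eq_square mult_ac flip: ennreal_mult)
  finally have "(\<integral>\<^sup>+w. ennreal (cut w powr p) \<partial>M) = ennreal (2 * pi\<^sup>2 * N)" .
  then have "integrable M (\<lambda>w. cut w powr p) \<and> (\<integral>w. cut w powr p \<partial>M) = 2 * pi\<^sup>2 * N"
    using N by (subst (asm) nn_integral_eq_integrable) auto
  then show "integrable M (\<lambda>w. cut w powr p)" "(\<integral>w. cut w powr p \<partial>M) = 2 * pi\<^sup>2 * N" by auto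
qed

text \<open>After integration over slices the half exponent is
  \<open>\<beta> j + \<sigma> j - \<tau>\<close>, which \<open>d j = 1\<close> turns into
  \<open>1 / m - \<tau> - 1 \<le> -1\<close>. So the integrand is at least an inverse square on the
  annulus.\<close>

lemma h_integral_ge: "2 * pi\<^sup>2 / (real j + 1) * N \<le> (\<integral>w. h w \<partial>M)"
proof -
  have [measurable]: "{v::complex. exp (- N) \<le> cmod v} \<in> sets borel" "ball (0::complex) r \<in> sets borel" for r
    by measurable
  have "ennreal (2 * pi\<^sup>2 / (real j + 1) * N) = ennreal (pi / (real j + 1)) * ennreal (2 * pi * N)"
    using N by (simp add: power2_eq_square mult_ac flip: ennreal_mult)
  also have "\<dots> = (\<integral>\<^sup>+v. ennreal (pi / (real j + 1)) * (ennreal (cmod v powr (-2)) * indicator {v. exp (- N) \<le> cmod v} v * indicator (ball 0 1) v) \<partial>lborel)"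
    using N by (subst nn_integral_cmult) (auto simp: nn_integral_annulus)
  also have "\<dots> \<le> (\<integral>\<^sup>+v. (\<integral>\<^sup>+x. ennreal (h (x, v)) * indicator (ball 0 (radius v)) x \<partial>lborel) * indicator (ball 0 1) v \<partial>lborel)"
  proof (intro nn_integral_mono)
    fix v :: complex
    show "ennreal (pi / (real j + 1)) * (ennreal (cmod v powr (-2)) * indicator {v. exp (- N) \<le> cmod v} v * indicator (ball 0 1) v)
      \<le> (\<integral>\<^sup>+x. ennreal (h (x, v)) * indicator (ball 0 (radius v)) x \<partial>lborel) * indicator (ball 0 1) v"
    proof (cases "exp (- N) \<le> cmod v \<and> cmod v < 1")
      case True
      have v0: "v \<noteq> 0" using True exp_gt_zero[of "- N"] by auto
      define c where "c = cmod v powr (2 * (of_int (\<beta> j) - \<tau>))"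
      have hx: "h (x, v) = c * cmod x powr (2 * real j)" if "x \<noteq> 0" for x
      proof -
        have "(cmod x ^ j)\<^sup>2 = cmod x powr (2 * real j)"
          using that by (simp add: powr_realpow[symmetric] power2_eq_square flip: powr_add)
        moreover have "(cmod v powr of_int (\<beta> j))\<^sup>2 * cmod v powr (2 * (- \<tau>)) = c"
          by (simp add: c_def power2_eq_square algebra_simps flip: powr_add)
        ultimately show ?thesis using True by (simp add: h_def cut_def power_mult_distrib mult_ac)
      qed
      have "(\<integral>\<^sup>+x. ennreal (h (x, v)) * indicator (ball 0 (radius v)) x \<partial>lborel)
        = (\<integral>\<^sup>+x. ennreal c * (ennreal (cmod x powr (2 * real j)) * indicator (ball 0 (radius v)) x) \<partial>lborel)"
        using AE_lborel_singleton[of "0::complex"]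
        by (intro nn_integral_cong_AE) (auto elim!: eventually_mono simp: hx ennreal_mult c_def mult.assoc)
      also have "\<dots> = ennreal c * ennreal (pi * radius v powr (2 * real j + 2) / (real j + 1))"
        by (subst nn_integral_cmult) (auto simp: nn_integral_cmod_powr radius_def)
      also have "\<dots> = ennreal (pi / (real j + 1) * (c * cmod v powr (2 * \<sigma> j)))"
      proof -
        have "radius v powr (2 * real j + 2) = cmod v powr (2 * \<sigma> j)"
          using radius_powr[OF v0, of j] powr_realpow[OF radius_pos[OF v0], of "2 * j + 2"] by (simp add: add.commute)
        then show ?thesis by (simp add: c_def mult_ac flip: ennreal_mult)
      qed
      finally have eq: "(\<integral>\<^sup>+x. ennreal (h (x, v)) * indicator (ball 0 (radius v)) x \<partial>lborel)
         = ennreal (pi / (real j + 1) * (c * cmod v powr (2 * \<sigma> j)))" .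
      have "c * cmod v powr (2 * \<sigma> j) = cmod v powr (2 * (of_int (\<beta> j) + \<sigma> j - \<tau>))"
        by (simp add: c_def algebra_simps flip: powr_add)
      also have "\<dots> \<ge> cmod v powr (-2)"
      proof (rule powr_mono')
        have "of_int (\<beta> j) + \<sigma> j = 1 / real m - 1"
          using dj m by (simp add: d_def field_simps)
        then have "2 * (of_int (\<beta> j) + \<sigma> j - \<tau>) = 2 * (1 / real m - \<tau>) - 2" by simp
        then show "2 * (of_int (\<beta> j) + \<sigma> j - \<tau>) \<le> - 2" using \<tau>(1) by simp
      qed (use True in auto)
      finally have "pi / (real j + 1) * cmod v powr (-2) \<le> pi / (real j + 1) * (c * cmod v powr (2 * \<sigma> j))"
        by (intro mult_left_mono) auto
      then have "ennreal (pi / (real j + 1) * cmod v powr (-2)) \<le> ennreal (pi / (real j + 1) * (c * cmod v powr (2 * \<sigma> j)))"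
        by (rule ennreal_leI)
      then have "ennreal (pi / (real j + 1)) * ennreal (cmod v powr (-2)) \<le> ennreal (pi / (real j + 1) * (c * cmod v powr (2 * \<sigma> j)))"
        by (subst (asm) ennreal_mult) auto
      then show ?thesis unfolding eq using True by simp
    qed (auto simp: indicator_def)
  qed
  also have "\<dots> = (\<integral>\<^sup>+w. ennreal (h w) \<partial>M)"
    by (rule nn_integral_M[symmetric]) measurable
  also have "\<dots> = ennreal (\<integral>w. h w \<partial>M)"
    by (rule nn_integral_eq_integral[OF h_integrable]) (simp add: h_nonneg)
  finally show ?thesis
    by (subst (asm) ennreal_le_iff) (auto intro!: integral_nonneg_AE simp: h_nonneg)
qed

lemma F_measurable [measurable]: "F \<in> borel_measurable borel" "F \<in> borel_measurable M"
proof -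
  show "F \<in> borel_measurable borel" unfolding F_def[abs_def] by measurable
  then show "F \<in> borel_measurable M" by (rule borel_imp_measurable_M)
qed

lemma norm_F: "w \<in> H \<Longrightarrow> cmod (F w) = cmod (fst w) ^ j * cmod (snd w) powr of_int (\<beta> j) * cut w"
  using H_D(1)[of w] by (simp add: F_def norm_mult norm_power norm_powi cut_nonneg)

lemma F_integrable: "integrable M (\<lambda>w. cmod (F w) * cmod (snd w) powr (- \<kappa>))"
proof (rule Bochner_Integration.integrable_bound)
  show "integrable M (\<lambda>w. exp (- N) powr (2 * (- \<tau>)) * cmod (snd w) powr (2 * (- \<kappa>)))"
    by (intro integrable_mult_right integrable_M_snd_powr \<kappa>_less)
  show "AE w in M. norm (cmod (F w) * cmod (snd w) powr (- \<kappa>)) \<le> norm (exp (- N) powr (2 * (- \<tau>)) * cmod (snd w) powr (2 * (- \<kappa>)))"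
  proof (rule AE_I2)
    fix w assume "w \<in> space M"
    then have w: "w \<in> H" by simp
    have "cmod (F w) * cmod (snd w) powr (- \<kappa>)
       \<le> cmod (snd w) powr (- \<kappa>) * exp (- N) powr (2 * (- \<tau>)) * cmod (snd w) powr (- \<kappa>)"
      unfolding norm_F[OF w] using cut_le cut_nonneg by (intro mult_mono monomial_le w) auto
    also have "\<dots> = exp (- N) powr (2 * (- \<tau>)) * (cmod (snd w) powr (- \<kappa>) * cmod (snd w) powr (- \<kappa>))"
      by (simp only: mult_ac)
    also have "cmod (snd w) powr (- \<kappa>) * cmod (snd w) powr (- \<kappa>) = cmod (snd w) powr (2 * (- \<kappa>))"
      by (simp flip: powr_add)
    finally show "norm (cmod (F w) * cmod (snd w) powr (- \<kappa>)) \<le> norm (exp (- N) powr (2 * (- \<tau>)) * cmod (snd w) powr (2 * (- \<kappa>)))"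
      by simp
  qed
qed measurable

lemma mom_F_diag: "mom F j 0 = of_real (\<integral>w. h w \<partial>M)"
proof -
  have "mom F j 0 = (\<integral>w. complex_of_real (h w) \<partial>M)"
    unfolding mom_def
  proof (intro Bochner_Integration.integral_cong refl)
    fix w assume "w \<in> space M"
    then have w: "snd w \<noteq> 0" using H_D(1)[of w] by simp
    have 1: "fst w ^ j * cnj (fst w) ^ j = complex_of_real ((cmod (fst w) ^ j)\<^sup>2)"
      using complex_norm_square[of "fst w ^ j"] by (simp add: norm_power)
    have 2: "snd w powi \<beta> j * cnj (snd w) powi \<beta> j = complex_of_real ((cmod (snd w) powr of_int (\<beta> j))\<^sup>2)"
      using complex_norm_square[of "snd w powi \<beta> j"] by (simp add: norm_powi[OF w])
    have "F w * cnj (fst w) ^ j * cnj (snd w) powi (\<beta> j + int 0)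
      = (fst w ^ j * cnj (fst w) ^ j) * (snd w powi \<beta> j * cnj (snd w) powi \<beta> j) * complex_of_real (cut w)"
      unfolding F_def by (simp add: mult_ac)
    then show "F w * cnj (fst w) ^ j * cnj (snd w) powi (\<beta> j + int 0) = complex_of_real (h w)"
      unfolding 1 2 h_def by (simp add: power_mult_distrib)
  qed
  then show ?thesis by simp
qed

text \<open>\<open>cut\<close> depends only on the modulus of \<open>z\<^sub>2\<close>, so rotations
  act on both variables separately: orthogonality in \<open>z\<^sub>1\<close> treats
  \<open>a \<noteq> j\<close>, and orthogonality in \<open>z\<^sub>2\<close> treats
  \<open>a = j\<close> with \<open>l \<noteq> 0\<close>.\<close>

lemma mom_F_off_diag:
  assumes "a \<noteq> j \<or> l \<noteq> 0"
  shows "mom F a l = 0"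
proof -
  have [measurable]: "{v::complex. exp (- N) \<le> cmod v} \<in> sets borel" "ball (0::complex) r \<in> sets borel" for r
    by measurable
  have "(\<lambda>z. indicator H z *\<^sub>R F z) \<in> borel_measurable borel" by measurable
  note it = mom_iterated(2)[OF F_measurable(2) this F_integrable, of a l]
  define c where "c v = complex_of_real (indicator (ball 0 1) v * cut (0, v)) * v powi \<beta> j * cnj v powi (\<beta> a + int l)" for v
  have inner: "(\<integral>x. indicator H (x, v) *\<^sub>R (F (x, v) * cnj x ^ a * cnj v powi (\<beta> a + int l)) \<partial>lborel)
     = c v * (if j = a then complex_of_real (\<integral>x. indicator {..<radius v} (cmod x) * cmod x ^ (2 * j) \<partial>(lborel::complex measure)) else 0)" for v
  proof -
    have "(\<integral>x. indicator H (x, v) *\<^sub>R (F (x, v) * cnj x ^ a * cnj v powi (\<beta> a + int l)) \<partial>lborel)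
      = (\<integral>x. c v * (complex_of_real (indicator {..<radius v} (cmod x)) * x ^ j * cnj x ^ a) \<partial>lborel)"
    proof (intro Bochner_Integration.integral_cong refl)
      fix x :: complex
      have "indicator H (x, v) = (indicator (ball 0 1) v * indicator {..<radius v} (cmod x) :: real)"
        by (auto simp: indicator_def H_iff)
      then show "indicator H (x, v) *\<^sub>R (F (x, v) * cnj x ^ a * cnj v powi (\<beta> a + int l))
        = c v * (complex_of_real (indicator {..<radius v} (cmod x)) * x ^ j * cnj x ^ a)"
        by (simp add: c_def F_def cut_def scaleR_conv_of_real mult_ac)
    qed
    also have "\<dots> = c v * (\<integral>x. complex_of_real (indicator {..<radius v} (cmod x)) * x ^ j * cnj x ^ a \<partial>lborel)"
      by (rule integral_mult_right_zero)
    finally show ?thesis by (subst (asm) monomials_orthogonal_nat) auto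
  qed
  show ?thesis
  proof (cases "a = j")
    case False
    then show ?thesis unfolding it inner by simp
  next
    case True
    then have l: "l \<noteq> 0" using assms by simp
    define R where "R s = s powr (real n / real m)" for s :: real
    define \<rho> where "\<rho> s = indicator {..<1} s * (s powr (2 * (- \<tau>)) * indicator {exp (- N)..} s) * (pi * R s powr (2 * real j + 2) / (real j + 1))" for s :: real
    have [measurable]: "\<rho> \<in> borel_measurable borel" unfolding \<rho>_def R_def by measurable
    have rad: "(\<integral>x. indicator {..<r} (cmod x) * cmod x ^ (2 * j) \<partial>(lborel::complex measure)) = pi * r powr (2 * real j + 2) / (real j + 1)"
      if "r \<ge> 0" for r
    proof -
      have "(\<integral>x. indicator {..<r} (cmod x) * cmod x ^ (2 * j) \<partial>(lborel::complex measure))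
        = (\<integral>x. indicator (ball 0 r) x * cmod x powr (2 * real j) \<partial>(lborel::complex measure))"
        using AE_lborel_singleton[of "0::complex"]
        by (intro integral_cong_AE) (auto elim!: eventually_mono simp: indicator_def powr_realpow[symmetric])
      also have "\<dots> = pi * r powr (2 * real j + 2) / (real j + 1)" using that by (intro integral_cmod_powr) auto
      finally show ?thesis .
    qed
    have "mom F a l = (\<integral>v. complex_of_real (\<rho> (cmod v)) * v powi \<beta> j * cnj v powi (\<beta> j + int l) \<partial>lborel)"
    proof -
      have rn: "radius v \<ge> 0" for v by (simp add: radius_def)
      have "mom F a l = (\<integral>v. c v * complex_of_real (pi * radius v powr (2 * real j + 2) / (real j + 1)) \<partial>lborel)"
        unfolding it inner rad[OF rn] using True by simp
      also have "\<dots> = (\<integral>v. complex_of_real (\<rho> (cmod v)) * v powi \<beta> j * cnj v powi (\<beta> j + int l) \<partial>lborel)"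
        using True by (intro Bochner_Integration.integral_cong refl)
          (simp add: radius_def c_def \<rho>_def R_def cut_def indicator_def)
      finally show ?thesis .
    qed
    also have "\<dots> = 0" using l by (intro monomials_orthogonal) auto
    finally show ?thesis .
  qed
qed

text \<open>A single moment survives in the double expansion, so the Bergman projection of
  \<open>F\<close> is a multiple of the critical monomial. Its factor \<open>m * 0 + d j\<close> is
  1.\<close>

lemma integral_F_K:
  assumes z: "z \<in> H"
  shows "(\<integral>w. F w * K z w \<partial>M) = coef j z * snd z powi \<beta> j * of_real (\<integral>w. h w \<partial>M)"
proof -
  define X where "X = coef j z * snd z powi \<beta> j * of_real (\<integral>w. h w \<partial>M)"
  have row: "(\<integral>w. F w * row a z w \<partial>M) = (if a = j then X else 0)" for a
  proof -
    have "(\<lambda>l. coef a z * of_real (real m * real l + d a) * snd z powi (\<beta> a + int l) * mom F a l) sums (\<integral>w. F w * row a z w \<partial>M)"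
      by (rule row_expansion[OF z F_measurable(2) F_integrable])
    also have "(\<lambda>l. coef a z * of_real (real m * real l + d a) * snd z powi (\<beta> a + int l) * mom F a l)
       = (\<lambda>l. if l = 0 then (if a = j then X else 0) else 0)"
      using mom_F_off_diag by (auto simp: mom_F_diag X_def dj)
    finally show ?thesis
      using sums_single[of 0 "\<lambda>_. if a = j then X else 0"] by (rule sums_unique2)
  qed
  have "(\<lambda>k. \<Sum>i<m. \<integral>w. F w * row (m * k + i) z w \<partial>M) sums (\<integral>w. F w * K z w \<partial>M)"
    by (rule kernel_expansion(2)[OF z F_measurable(2) F_integrable])
  also have "(\<lambda>k. \<Sum>i<m. \<integral>w. F w * row (m * k + i) z w \<partial>M) = (\<lambda>k. if k = 0 then X else 0)"
  proof
    fix k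
    show "(\<Sum>i<m. \<integral>w. F w * row (m * k + i) z w \<partial>M) = (if k = 0 then X else 0)"
    proof (cases "k = 0")
      case True
      then show ?thesis using j by (simp add: row sum.delta)
    next
      case False
      have "m * k + i \<noteq> j" for i
      proof -
        have "m * 1 \<le> m * k" using False by (intro mult_le_mono2) simp
        then show ?thesis using j by linarith
      qed
      then show ?thesis using False by (simp add: row)
    qed
  qed
  finally show ?thesis using sums_single[of 0 "\<lambda>_. X"] unfolding X_def by (rule sums_unique2)
qed

lemma K_square_integrable:
  assumes z: "z \<in> H"
  shows "integrable M (\<lambda>w. (cmod (K z w))\<^sup>2)" "(\<lambda>w. K z w) \<in> borel_measurable M"
proof -
  show "integrable M (\<lambda>w. (cmod (K z w))\<^sup>2)"
    using bergman_measurable(3)[OF K_in_bergman[OF z]] by (subst K_cnj) simp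
  have "(\<lambda>w. cnj (K w z)) \<in> borel_measurable M"
    by (rule borel_measurable_cnj[OF bergman_measurable(1)[OF K_in_bergman[OF z]]])
  then show "(\<lambda>w. K z w) \<in> borel_measurable M" by (subst K_cnj)
qed

lemma K_cut_integrable:
  assumes z: "z \<in> H"
  shows "integrable M (\<lambda>w. (cmod (K z w))\<^sup>2 * cut w)"
proof (rule Bochner_Integration.integrable_bound)
  note [measurable] = K_square_integrable(2)[OF z]
  show "integrable M (\<lambda>w. exp (- N) powr (2 * (- \<tau>)) * (cmod (K z w))\<^sup>2)"
    by (intro integrable_mult_right K_square_integrable z)
  show "(\<lambda>w. (cmod (K z w))\<^sup>2 * cut w) \<in> borel_measurable M" by measurable
  show "AE w in M. norm ((cmod (K z w))\<^sup>2 * cut w) \<le> norm (exp (- N) powr (2 * (- \<tau>)) * (cmod (K z w))\<^sup>2)"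
  proof (rule AE_I2)
    fix w
    have "(cmod (K z w))\<^sup>2 * cut w \<le> (cmod (K z w))\<^sup>2 * exp (- N) powr (2 * (- \<tau>))"
      by (intro mult_left_mono cut_le) simp
    then show "norm ((cmod (K z w))\<^sup>2 * cut w) \<le> norm (exp (- N) powr (2 * (- \<tau>)) * (cmod (K z w))\<^sup>2)"
      using cut_nonneg[of w] by (simp add: abs_mult mult.commute)
  qed
qed

text \<open>Cauchy-Schwarz for the measure with density \<open>cut\<close>, applied to the pairing
  of \<open>F\<close> with the kernel. The pairing contributes the square of the integral of
  \<open>h\<close>, the norm of the monomial contributes its first power, and one power remains
  after division.\<close>

lemma K_cut_integral_ge:
  assumes z: "z \<in> H"
  shows "(cmod (coef j z * snd z powi \<beta> j))\<^sup>2 * (\<integral>w. h w \<partial>M) \<le> (\<integral>w. (cmod (K z w))\<^sup>2 * cut w \<partial>M)"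
proof -
  note [measurable] = K_square_integrable(2)[OF z]
  define A where "A = (\<integral>w. h w \<partial>M)"
  define I where "I = (\<integral>w. (cmod (K z w))\<^sup>2 * cut w \<partial>M)"
  define c where "c = cmod (coef j z * snd z powi \<beta> j)"
  have "2 * pi\<^sup>2 / (real j + 1) * N > 0" using N by simp
  then have A: "A > 0" using h_integral_ge unfolding A_def by linarith
  have I: "I \<ge> 0" unfolding I_def by (intro integral_nonneg_AE AE_I2 mult_nonneg_nonneg) (auto simp: cut_nonneg)
  have "ennreal (c * A) = ennreal (norm (\<integral>w. F w * K z w \<partial>M))"
    unfolding integral_F_K[OF z] norm_mult A_def c_def using A by (simp add: norm_mult A_def)
  also have "\<dots> \<le> (\<integral>\<^sup>+w. ennreal (norm (F w * K z w)) \<partial>M)"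
    by (rule integral_norm_bound_ennreal[OF kernel_expansion(1)[OF z F_measurable(2) F_integrable]])
  also have "\<dots> = (\<integral>\<^sup>+w. ennreal (cmod (K z w) * sqrt (cut w)) * ennreal (cmod (fst w) ^ j * cmod (snd w) powr of_int (\<beta> j) * sqrt (cut w)) \<partial>M)"
  proof (intro nn_integral_cong)
    fix w assume "w \<in> space M"
    then have w: "w \<in> H" by simp
    have "norm (F w * K z w) = (cmod (K z w) * sqrt (cut w)) * (cmod (fst w) ^ j * cmod (snd w) powr of_int (\<beta> j) * sqrt (cut w))"
    proof -
      have "cut w = sqrt (cut w) * sqrt (cut w)" using cut_nonneg by simp
      then have "norm (F w * K z w) = cmod (fst w) ^ j * cmod (snd w) powr of_int (\<beta> j) * (sqrt (cut w) * sqrt (cut w)) * cmod (K z w)"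
        unfolding norm_mult norm_F[OF w] by simp
      then show ?thesis by (simp only: mult_ac)
    qed
    then show "ennreal (norm (F w * K z w)) = ennreal (cmod (K z w) * sqrt (cut w)) * ennreal (cmod (fst w) ^ j * cmod (snd w) powr of_int (\<beta> j) * sqrt (cut w))"
      using cut_nonneg[of w] by (simp add: ennreal_mult'[symmetric])
  qed
  finally have "(ennreal (c * A))\<^sup>2 \<le> (\<integral>\<^sup>+w. ennreal (cmod (K z w) * sqrt (cut w)) * ennreal (cmod (fst w) ^ j * cmod (snd w) powr of_int (\<beta> j) * sqrt (cut w)) \<partial>M)\<^sup>2"
    by (intro power_mono) auto
  also have "\<dots> \<le> (\<integral>\<^sup>+w. (ennreal (cmod (K z w) * sqrt (cut w)))\<^sup>2 \<partial>M) * (\<integral>\<^sup>+w. (ennreal (cmod (fst w) ^ j * cmod (snd w) powr of_int (\<beta> j) * sqrt (cut w)))\<^sup>2 \<partial>M)"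
    by (rule Cauchy_Schwarz_nn_integral) measurable
  also have "(\<integral>\<^sup>+w. (ennreal (cmod (K z w) * sqrt (cut w)))\<^sup>2 \<partial>M) = (\<integral>\<^sup>+w. ennreal ((cmod (K z w))\<^sup>2 * cut w) \<partial>M)"
    using cut_nonneg by (intro nn_integral_cong) (simp add: ennreal_power power_mult_distrib)
  also have "\<dots> = ennreal I"
    unfolding I_def by (rule nn_integral_eq_integral[OF K_cut_integrable[OF z]]) (simp add: cut_nonneg)
  also have "(\<integral>\<^sup>+w. (ennreal (cmod (fst w) ^ j * cmod (snd w) powr of_int (\<beta> j) * sqrt (cut w)))\<^sup>2 \<partial>M) = (\<integral>\<^sup>+w. ennreal (h w) \<partial>M)"
    using cut_nonneg by (intro nn_integral_cong) (simp add: ennreal_power power_mult_distrib h_def)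
  also have "\<dots> = ennreal A"
    unfolding A_def by (rule nn_integral_eq_integral[OF h_integrable]) (simp add: h_nonneg)
  also have "ennreal I * ennreal A = ennreal (I * A)" using I by (rule ennreal_mult'[symmetric])
  also have "(ennreal (c * A))\<^sup>2 = ennreal ((c * A)\<^sup>2)" using A by (intro ennreal_power) (simp add: c_def)
  finally have "ennreal ((c * A)\<^sup>2) \<le> ennreal (I * A)" .
  then have "(c * A)\<^sup>2 \<le> I * A" using A I by (subst (asm) ennreal_le_iff) auto
  then have "c\<^sup>2 * A * A \<le> I * A" by (simp add: power2_eq_square mult_ac)
  then show ?thesis using A unfolding c_def A_def I_def by simp
qed

lemma berezin_cut_ge:
  assumes z: "z \<in> H"
  shows "(cmod (coef j z * snd z powi \<beta> j))\<^sup>2 / cmod (K z z) * (2 * pi\<^sup>2 / (real j + 1) * N)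
     \<le> cmod (integral_operator M (berezin_kernel H) (\<lambda>w. of_real (cut w)) z)"
proof -
  have "integral_operator M (berezin_kernel H) (\<lambda>w. of_real (cut w)) z = (\<integral>w. of_real ((cmod (K z w))\<^sup>2 * cut w) / K z z \<partial>M)"
    unfolding integral_operator_def berezin_kernel_def bergman_kernel_eq by simp
  also have "\<dots> = (\<integral>w. of_real ((cmod (K z w))\<^sup>2 * cut w) \<partial>M) / K z z"
    by (rule integral_divide_zero)
  also have "\<dots> = of_real (\<integral>w. (cmod (K z w))\<^sup>2 * cut w \<partial>M) / K z z"
    by (simp only: integral_complex_of_real)
  finally have eq: "cmod (integral_operator M (berezin_kernel H) (\<lambda>w. of_real (cut w)) z) = (\<integral>w. (cmod (K z w))\<^sup>2 * cut w \<partial>M) / cmod (K z z)"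
    by (simp add: norm_divide cut_nonneg del: of_real_mult)
  have "(cmod (coef j z * snd z powi \<beta> j))\<^sup>2 * (2 * pi\<^sup>2 / (real j + 1) * N) \<le> (cmod (coef j z * snd z powi \<beta> j))\<^sup>2 * (\<integral>w. h w \<partial>M)"
    by (intro mult_left_mono h_integral_ge) simp
  also have "\<dots> \<le> (\<integral>w. (cmod (K z w))\<^sup>2 * cut w \<partial>M)" by (rule K_cut_integral_ge[OF z])
  finally have "(cmod (coef j z * snd z powi \<beta> j))\<^sup>2 * (2 * pi\<^sup>2 / (real j + 1) * N) / cmod (K z z) \<le> (\<integral>w. (cmod (K z w))\<^sup>2 * cut w \<partial>M) / cmod (K z z)"
    by (rule divide_right_mono) simp
  then show ?thesis unfolding eq by (simp add: mult_ac)
qed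

end

text \<open>The integrand can vanish only where \<open>fst z = 0\<close>, and the rest of
  \<open>H\<close> is a nonempty open set, hence not a null set.\<close>

lemma lower_bound_weight_pos:
  assumes p: "p > 0"
  shows "0 < (\<integral>\<^sup>+z. ennreal (((cmod (coef j z * snd z powi \<beta> j))\<^sup>2 / cmod (\<Sum>i<m. K_part i z z)) powr p) \<partial>M)" (is "0 < ?I")
proof (rule ccontr)
  assume "\<not> 0 < ?I"
  then have I: "?I = 0" by simp
  note [measurable] = K_diag_meas
  have "AE z in M. ennreal (((cmod (coef j z * snd z powi \<beta> j))\<^sup>2 / cmod (\<Sum>i<m. K_part i z z)) powr p) = 0"
    using I unfolding coef_def by (subst (asm) nn_integral_0_iff_AE) measurable
  then have "AE z in M. fst z = 0"
    using AE_space
  proof eventually_elim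
    case (elim z)
    then have z: "z \<in> H" by simp
    obtain r where "0 < (\<Sum>i<m. r i)" "K z z = of_real (\<Sum>i<m. r i)" by (rule K_diag[OF z])
    then have "K z z \<noteq> 0" by (simp del: of_real_sum)
    then have "(\<Sum>i<m. K_part i z z) \<noteq> 0" using z by (simp add: K_def)
    moreover have "(real j + 1) / (real m * pi\<^sup>2) \<noteq> 0" using m by simp
    ultimately show "fst z = 0"
      using elim H_D(1)[OF z] by (auto simp: coef_def simp del: of_real_divide)
  qed
  then have "AE z in lebesgue. z \<in> H \<longrightarrow> fst z = 0"
    by (subst (asm) AE_restrict_space_iff) auto
  then have ae: "AE z in lebesgue. z \<notin> H \<inter> {z. fst z \<noteq> 0}" by eventually_elim auto
  have W: "open (H \<inter> {z. fst z \<noteq> 0})"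
    by (intro open_Int open_H open_Collect_neq continuous_intros)
  then have "H \<inter> {z. fst z \<noteq> 0} \<in> sets lebesgue"
    using borel_open by (intro sets_completionI_sets) simp
  with ae have "H \<inter> {z. fst z \<noteq> 0} \<in> null_sets lebesgue"
    by (simp only: AE_iff_null_sets)
  moreover have "H \<inter> {z. fst z \<noteq> 0} \<noteq> {}"
  proof -
    have r: "radius (1/2) > 0" by (intro radius_pos) simp
    then have "(complex_of_real (radius (1/2) / 2), 1/2) \<in> H \<inter> {z. fst z \<noteq> 0}"
      by (simp add: H_iff norm_divide)
    then show ?thesis by blast
  qed
  ultimately show False
    using open_not_negligible[OF W] by (simp only: negligible_iff_null_sets) blast
qed

text \<open>The \<open>p\<close>-th power of the transform's norm grows at least like
  \<open>N powr p\<close>, that of the test function only like \<open>N\<close>. As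
  \<open>p > 1\<close>, no constant works for all \<open>N\<close>.\<close>

lemma berezin_unbounded:
  assumes cop: "coprime m n" and p1: "p > 1" and p: "p \<le> real (m + n)"
  shows "\<not> integral_operator_bounded_on_Lp p M (berezin_kernel H)"
proof
  assume "integral_operator_bounded_on_Lp p M (berezin_kernel H)"
  then obtain C where C: "\<And>f. in_Lp p M f \<Longrightarrow> in_Lp p M (integral_operator M (berezin_kernel H) f) \<and>
      Lp_norm p M (integral_operator M (berezin_kernel H) f) \<le> C * Lp_norm p M f"
    unfolding integral_operator_bounded_on_Lp_def by blast
  obtain j where j: "j < m" "d j = 1" by (rule critical_index[OF cop])
  define \<psi> where "\<psi> z = (cmod (coef j z * snd z powi \<beta> j))\<^sup>2 / cmod (\<Sum>i<m. K_part i z z)" for z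
  note [measurable] = K_diag_meas
  have [measurable]: "\<psi> \<in> borel_measurable M" unfolding \<psi>_def[abs_def] coef_def by measurable
  have \<psi>0: "\<psi> z \<ge> 0" for z by (simp add: \<psi>_def)
  define c where "c = 2 * pi\<^sup>2 / (real j + 1)"
  have c: "c > 0" by (simp add: c_def)
  define \<Psi> where "\<Psi> = (\<integral>\<^sup>+z. ennreal (\<psi> z powr p) \<partial>M)"
  have \<Psi>0: "\<Psi> > 0" unfolding \<Psi>_def \<psi>_def using p1 by (intro lower_bound_weight_pos) simp
  have main: "ennreal ((c * N) powr p) * \<Psi> \<le> ennreal (\<bar>C\<bar> powr p * (2 * pi\<^sup>2 * N))" if N: "N > 0" for N
  proof -
    define \<tau> where "\<tau> = (1 + real n / real m) / p"
    note ctx = p1 p j N \<tau>_def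
    define f where "f w = complex_of_real (cut \<tau> N w)" for w
    have fp: "cmod (f w) powr p = cut \<tau> N w powr p" for w
      using cut_nonneg[OF ctx, of w] by (simp add: f_def)
    have [measurable]: "f \<in> borel_measurable M"
      unfolding f_def[abs_def] using cut_measurable(2)[OF ctx] by measurable
    have "in_Lp p M f" unfolding in_Lp_def fp using cut_Lp(1)[OF ctx] by simp
    from C[OF this] have g: "in_Lp p M (integral_operator M (berezin_kernel H) f)"
      "Lp_norm p M (integral_operator M (berezin_kernel H) f) \<le> C * Lp_norm p M f" by auto
    define G where "G = (\<integral>z. cmod (integral_operator M (berezin_kernel H) f z) powr p \<partial>M)"
    have gint: "integrable M (\<lambda>z. cmod (integral_operator M (berezin_kernel H) f z) powr p)"
      using g(1) by (simp add: in_Lp_def)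
    have G0: "G \<ge> 0" unfolding G_def by (intro integral_nonneg_AE AE_I2) simp
    have "Lp_norm p M f = (2 * pi\<^sup>2 * N) powr (1 / p)"
      unfolding Lp_norm_def fp using cut_Lp(2)[OF ctx] by simp
    \<comment> \<open>The definition of boundedness allows any real \<open>C\<close>; the absolute
      value makes it possible to raise to the power \<open>p\<close>.\<close>
    then have "G powr (1 / p) \<le> \<bar>C\<bar> * (2 * pi\<^sup>2 * N) powr (1 / p)"
    proof -
      have "C * Lp_norm p M f \<le> \<bar>C\<bar> * Lp_norm p M f" by (intro mult_right_mono) (auto simp: Lp_norm_def)
      moreover have "Lp_norm p M (integral_operator M (berezin_kernel H) f) = G powr (1 / p)"
        by (simp add: Lp_norm_def G_def)
      ultimately show ?thesis using g(2) \<open>Lp_norm p M f = (2 * pi\<^sup>2 * N) powr (1 / p)\<close> by simp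
    qed
    then have "(G powr (1 / p)) powr p \<le> (\<bar>C\<bar> * (2 * pi\<^sup>2 * N) powr (1 / p)) powr p"
      using p1 by (intro powr_mono2) auto
    then have GC: "G \<le> \<bar>C\<bar> powr p * (2 * pi\<^sup>2 * N)"
      using p1 G0 N by (simp add: powr_powr powr_mult)
    have "ennreal ((c * N) powr p) * \<Psi> = (\<integral>\<^sup>+z. ennreal ((c * N) powr p) * ennreal (\<psi> z powr p) \<partial>M)"
      unfolding \<Psi>_def by (rule nn_integral_cmult[symmetric]) measurable
    also have "\<dots> \<le> (\<integral>\<^sup>+z. ennreal (cmod (integral_operator M (berezin_kernel H) f z) powr p) \<partial>M)"
    proof (intro nn_integral_mono)
      fix z assume "z \<in> space M"
      then have z: "z \<in> H" by simp
      then have "\<psi> z * (c * N) \<le> cmod (integral_operator M (berezin_kernel H) f z)"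
        using berezin_cut_ge[OF ctx z] unfolding \<psi>_def c_def f_def by (simp add: K_def)
      then have "(\<psi> z * (c * N)) powr p \<le> cmod (integral_operator M (berezin_kernel H) f z) powr p"
        using p1 \<psi>0[of z] c N by (intro powr_mono2) auto
      moreover have "(\<psi> z * (c * N)) powr p = (c * N) powr p * \<psi> z powr p"
        using \<psi>0[of z] c N by (simp add: powr_mult mult_ac)
      ultimately show "ennreal ((c * N) powr p) * ennreal (\<psi> z powr p) \<le> ennreal (cmod (integral_operator M (berezin_kernel H) f z) powr p)"
        by (simp add: ennreal_leI flip: ennreal_mult)
    qed
    also have "\<dots> = ennreal G" unfolding G_def by (rule nn_integral_eq_integral[OF gint]) simp
    also have "\<dots> \<le> ennreal (\<bar>C\<bar> powr p * (2 * pi\<^sup>2 * N))" by (rule ennreal_leI[OF GC])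
    finally show ?thesis .
  qed
  \<comment> \<open>Finiteness comes from the assumed boundedness itself, through
    \<open>main\<close> at \<open>N = 1\<close>.\<close>
  have "\<Psi> \<noteq> top"
  proof
    assume "\<Psi> = top"
    moreover have "ennreal ((c * 1) powr p) \<noteq> 0" using c by simp
    ultimately show False using main[of 1] by (simp add: ennreal_mult_top top_unique)
  qed
  then obtain r where r: "\<Psi> = ennreal r" "r \<ge> 0" by (cases \<Psi>) auto
  with \<Psi>0 have r0: "r > 0" by simp
  define B where "B = \<bar>C\<bar> powr p * (2 * pi\<^sup>2) / (c powr p * r)"
  have B: "B \<ge> 0" unfolding B_def using r0 by simp
  have le: "N powr (p - 1) \<le> B" if N: "N > 0" for N
  proof -
    have "ennreal ((c * N) powr p * r) \<le> ennreal (\<bar>C\<bar> powr p * (2 * pi\<^sup>2 * N))"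
      using main[OF N] r by (simp add: ennreal_mult)
    then have "(c * N) powr p * r \<le> \<bar>C\<bar> powr p * (2 * pi\<^sup>2 * N)"
      using N by (subst (asm) ennreal_le_iff) auto
    also have "(c * N) powr p = c powr p * (N * N powr (p - 1))"
      using c N by (simp add: powr_mult powr_diff)
    finally have "N * (N powr (p - 1) * (c powr p * r)) \<le> N * (\<bar>C\<bar> powr p * (2 * pi\<^sup>2))"
      by (simp add: mult_ac)
    then have "N powr (p - 1) * (c powr p * r) \<le> \<bar>C\<bar> powr p * (2 * pi\<^sup>2)" using N by simp
    then show ?thesis unfolding B_def using c r0 by (simp add: pos_le_divide_eq)
  qed
  \<comment> \<open>The value of \<open>N\<close> for which \<open>N powr (p - 1)\<close> equals
    \<open>B + 1\<close>.\<close>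
  have "((B + 1) powr (1 / (p - 1))) powr (p - 1) \<le> B"
    using B by (intro le) simp
  moreover have "((B + 1) powr (1 / (p - 1))) powr (p - 1) = B + 1"
    using B p1 by (simp add: powr_powr)
  ultimately show False by simp
qed

end

theorem corollary1p4:
  fixes m n :: nat and p :: real
  assumes "m > 0" and "n > 0" and "coprime m n" and "1 < p"
  shows "integral_operator_bounded_on_Lp p (lebesgue_on (hartogs_triangle m n))
           (berezin_kernel (hartogs_triangle m n))
         \<longleftrightarrow> p > real (m + n)"
proof -
  interpret hartogs m n using assms by unfold_locales
  show ?thesis using berezin_bounded[OF assms(4)] berezin_unbounded[OF assms(3,4)] by force
qed

end
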